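(* Let $S$ be a set of $n$ points in $\mathbb{R}^2$ and let $u\ge1$ be a fixed integer. Assume that the hypergraph formed by all triangles with vertices in $S$ and area between $0.9$ and $1.1$ contains no $K_{u,u,u}$, i.e. there do not exist disjoint sets $A,B,C\subset S$ with $|A|,|B|,|C|\ge u$ such that every $a\in A$, $b\in B$, $c\in C$ form a triangle of area between $0.9$ and $1.1$. Then for every $\varepsilon>0$ the number of triangles with vertices in $S$ and area between $0.9$ and $1.1$ is $O_{u,\varepsilon}(n^{12/5+\varepsilon})$.
   Context: The hypergraph in question is the 3-uniform hypergraph on vertex set $S$ whose hyperedges are the triples of points forming a triangle with area in the range $[0.9,1.1]$. $K_{u,u,u}$ is the complete 3-uniform 3-partite hypergraph with all parts of size $u$. The subscripts of $O$ indicate what the implied constant depends on. *)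

theory Defs
  imports "HOL-Analysis.Analysis"
begin

definition triangle_area :: "(real^2) set \<Rightarrow> real" where
  "triangle_area T = measure lborel (convex hull T)"

definition area_triangles :: "(real^2) set \<Rightarrow> (real^2) set set" where
  "area_triangles S = {T. T \<subseteq> S \<and> card T = 3 \<and> 0.9 \<le> triangle_area T \<and> triangle_area T \<le> 1.1}"

(* The hypergraph with vertex set V and hyperedge set E contains the complete 3-partite
   3-uniform hypergraph as a (not necessarily induced) subhypergraph.  The parts are required
   to have at least u vertices; for finite V and u \<ge> 1 one may pass to parts of exactly u. *)
definition contains_K3 :: "nat \<Rightarrow> 'a set \<Rightarrow> 'a set set \<Rightarrow> bool" where
  "contains_K3 u V E \<longleftrightarrow>
     (\<exists>A B C. A \<subseteq> V \<and> B \<subseteq> V \<and> C \<subseteq> V \<and>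
        A \<inter> B = {} \<and> A \<inter> C = {} \<and> B \<inter> C = {} \<and>
        card A \<ge> u \<and> card B \<ge> u \<and> card C \<ge> u \<and>
        (\<forall>a\<in>A. \<forall>b\<in>B. \<forall>c\<in>C. {a, b, c} \<in> E))"

end

theory Submission
  imports Defs "HOL-Analysis.Analysis"
begin

text \<open>
  Twice the signed area of a triangle is affine in each vertex. So when two vertices are fixed, the third
  one has to lie in two parallel strips, and whether it does is decided by its position relative to four
  lines. If $A$, $B$, $C$ are nonempty sets all of whose triples span a triangle of admissible area, then
  these sets are disjoint, because degenerate triples have area $0$; as there is no $K_{u,u,u}$, one of
  them has fewer than $u$ elements. The proof covers the set of all triples by boxes for
  most of which either no triple or every triple is admissible, and counts what is left.

  The boxes come from Matousek's partition theorem (\<open>simplicial_partition\<close>): $N$ points split into about $N/s$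
  classes of size $s$ such that every line of a given finite family cuts only about $\sqrt{N/s}$
  classes. The version proved here loses a logarithmic factor, which $n^\varepsilon$ absorbs. It rests on three ideas.
  A greedy hitting set provides $K$ lines that meet every trapezoid crossed by many lines
  (\<open>greedy_hitting_set\<close>). These $K$ lines cut the plane into at most $2K^2$ trapezoids that none of them
  enters (\<open>card_trapezoid_classes\<close>), so the trapezoid with the most points has many points and is
  crossed by few lines. Repeating this, while a line doubles its weight whenever it crosses the class just split off,
  spreads the crossings evenly over the lines (\<open>reweighted_partition\<close>).

  For the count let $n = w^5$ and ignore logarithms and constants that depend on $u$.
  Two copies of the point set are split into $w^2$ classes of size $w^3$ each. A fixed point $a$
  sees only $w^3$ of the $w^4$ resulting boxes $Q_j \times R_k$ with a mixed outcome: $R_k$ lies in a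
  quadrilateral, and whether a line cuts that is decided by its four corners
  (\<open>partition_boxes\<close>). On average $w^4$ points $a$ are mixed on a box.
  A set of $w^4$ points $a$ contributes at most $w^8$ triples to a box (\<open>chunk_bound\<close>): if it is
  split into classes of size $u$, each of the $w^6$ pairs of the box cuts $w^2$ classes, and the pairs that
  are admissible with a whole class form a $K_{u,u}$-free bipartite graph on $w^3$ and $w^3$ points.
  Such a graph has at most $w^4$ edges (\<open>bipartite_bound\<close>), the exponent $4/3$
  of point-line incidences, again by two rounds of partitioning. Altogether there are at most
  $w^4 \cdot w^8 = n^{12/5}$ triples.
\<close>

section \<open>Greedy hitting sets\<close>

text \<open>
  This replaces the random sample in the usual proofs of cutting lemmas: when every $f$ is hit by a
  $1/\rho$ fraction of the weight, some $x$ hits a $1/\rho$ fraction of those $f$ that are not hit yet. With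
  $k > \rho \ln |F|$ elements nothing remains, since then $|F| (1 - 1/\rho)^k < 1$.
\<close>

lemma greedy_hitting_set:
  fixes w :: "'l \<Rightarrow> real" and R :: "'l \<Rightarrow> 'f \<Rightarrow> bool"
  assumes "finite X" "finite F" and w: "\<And>x. x \<in> X \<Longrightarrow> 0 \<le> w x" and \<rho>: "\<rho> > 0"
    and heavy: "\<And>f. f \<in> F \<Longrightarrow> sum w X < \<rho> * sum w {x \<in> X. R x f}"
  shows "\<exists>Q \<subseteq> X. card Q \<le> k \<and>
           real (card {f \<in> F. \<forall>x\<in>Q. \<not> R x f}) \<le> real (card F) * (1 - 1 / \<rho>) ^ k"
proof (induction k)
  case 0
  show ?case by (intro exI[of _ "{}"]) auto
next
  case (Suc k)
  then obtain Q where Q: "Q \<subseteq> X" "card Q \<le> k"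
    "real (card {f \<in> F. \<forall>x\<in>Q. \<not> R x f}) \<le> real (card F) * (1 - 1 / \<rho>) ^ k" by blast
  define U where "U = {f \<in> F. \<forall>x\<in>Q. \<not> R x f}"
  have finU: "finite U" using assms(2) by (auto simp: U_def)
  show ?case
  proof (cases "U = {}")
    case True
    have "1 - 1 / \<rho> \<ge> 0" if ne: "F \<noteq> {}"
    proof -
      obtain f where f: "f \<in> F" using ne by blast
      have "sum w {x \<in> X. R x f} \<le> sum w X" using assms(1) w by (intro sum_mono2) auto
      moreover have "0 \<le> sum w {x \<in> X. R x f}" using w by (auto intro: sum_nonneg)
      moreover note heavy[OF f]
      ultimately have "\<rho> > 1"
        by (smt (verit) mult_left_le_one_le \<rho>)
      thus ?thesis by simp
    qed
    hence "0 \<le> real (card F) * (1 - 1 / \<rho>) ^ Suc k" by (cases "F = {}") auto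
    moreover have "card {f \<in> F. \<forall>x\<in>Q. \<not> R x f} = 0" using True by (simp add: U_def[symmetric])
    ultimately show ?thesis using Q by (intro exI[of _ Q]) auto
  next
    case False
    \<comment> \<open>double counting of the pairs of an element and a target that it hits\<close>
    have "\<exists>x\<in>X. real (card U) \<le> \<rho> * real (card {f \<in> U. R x f})"
    proof (rule ccontr)
      assume "\<not> ?thesis"
      hence less: "\<And>x. x \<in> X \<Longrightarrow> \<rho> * real (card {f \<in> U. R x f}) \<le> real (card U)" by force
      have "real (card U) * sum w X = (\<Sum>f\<in>U. sum w X)" by simp
      also have "\<dots> < (\<Sum>f\<in>U. \<rho> * sum w {x \<in> X. R x f})"
        using finU False heavy by (intro sum_strict_mono) (auto simp: U_def)
      also have "\<dots> = \<rho> * (\<Sum>f\<in>U. \<Sum>x\<in>X. if R x f then w x else 0)"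
        using assms(1) by (simp add: sum_distrib_left sum.inter_filter)
      also have "\<dots> = \<rho> * (\<Sum>x\<in>X. \<Sum>f\<in>U. if R x f then w x else 0)"
        by (subst sum.swap) simp
      also have "\<dots> = (\<Sum>x\<in>X. w x * (\<rho> * real (card {f \<in> U. R x f})))"
        using finU by (simp add: sum_distrib_left sum.inter_filter[symmetric] mult_ac)
      also have "\<dots> \<le> (\<Sum>x\<in>X. w x * real (card U))"
        using less w by (intro sum_mono mult_left_mono) auto
      finally show False by (simp add: sum_distrib_left[symmetric] sum_distrib_right[symmetric] mult.commute)
    qed
    then obtain x where x: "x \<in> X" "real (card U) \<le> \<rho> * real (card {f \<in> U. R x f})" by blast
    have eq: "{f \<in> F. \<forall>y\<in>insert x Q. \<not> R y f} = U - {f \<in> U. R x f}" by (auto simp: U_def)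
    have "real (card (U - {f \<in> U. R x f})) = real (card U) - real (card {f \<in> U. R x f})"
      using finU by (subst card_Diff_subset) (auto intro!: card_mono of_nat_diff)
    also have "\<dots> \<le> real (card U) * (1 - 1 / \<rho>)"
      using x(2) \<rho> by (simp add: field_simps)
    finally have 1: "real (card (U - {f \<in> U. R x f})) \<le> real (card U) * (1 - 1 / \<rho>)" .
    have nn: "1 - 1 / \<rho> \<ge> 0"
    proof -
      have "0 < real (card U)" using False finU by (simp add: card_gt_0_iff)
      moreover have "0 \<le> real (card U) * (1 - 1 / \<rho>)" using 1 by linarith
      ultimately show ?thesis by (simp add: zero_le_mult_iff)
    qed
    have "real (card U) * (1 - 1 / \<rho>) \<le> real (card F) * (1 - 1 / \<rho>) ^ k * (1 - 1 / \<rho>)"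
      using Q(3) nn by (intro mult_right_mono) (auto simp: U_def)
    with 1 have "real (card {f \<in> F. \<forall>y\<in>insert x Q. \<not> R y f}) \<le> real (card F) * (1 - 1 / \<rho>) ^ Suc k"
      unfolding eq by (simp add: mult_ac)
    moreover have "card (insert x Q) \<le> Suc k" 
      using Q(2) finite_subset[OF Q(1) assms(1)] by (simp add: card_insert_if)
    ultimately show ?thesis using Q(1) x(1) by (intro exI[of _ "insert x Q"]) auto
  qed
qed

section \<open>Trapezoids in an arrangement of lines\<close>

text \<open>
  A line that is not vertical is given by its slope and its intercept.
\<close>

definition at_x :: "real \<times> real \<Rightarrow> real \<Rightarrow> real" where
  "at_x l x = fst l * x + snd l"

definition meet_x :: "real \<times> real \<Rightarrow> real \<times> real \<Rightarrow> real" where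
  "meet_x l g = (snd g - snd l) / (fst l - fst g)"

text \<open>
  The set grows with $x$, so its cardinality numbers the edge of the arrangement of $Q$ on which the
  point of $l$ above $x$ lies.
\<close>

definition met_before :: "(real \<times> real) set \<Rightarrow> real \<times> real \<Rightarrow> real \<Rightarrow> (real \<times> real) set" where
  "met_before Q l x = {g \<in> Q. fst g \<noteq> fst l \<and> meet_x l g < x}"

lemma at_x_diff: "fst g \<noteq> fst l \<Longrightarrow> at_x g x - at_x l x = (fst g - fst l) * (x - meet_x l g)"
  by (simp add: at_x_def meet_x_def field_simps)

lemma order_unchanged:
  assumes "g \<in> Q" "x \<le> x'" "met_before Q l x = met_before Q l x'"
    and "at_x g x \<noteq> at_x l x" "at_x g x' \<noteq> at_x l x'"
  shows "at_x g x < at_x l x \<longleftrightarrow> at_x g x' < at_x l x'"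
proof (cases "fst g = fst l")
  case True
  thus ?thesis by (simp add: at_x_def)
next
  case False
  have d: "at_x g x - at_x l x = (fst g - fst l) * (x - meet_x l g)"
    "at_x g x' - at_x l x' = (fst g - fst l) * (x' - meet_x l g)"
    using at_x_diff[OF False] by auto
  have "meet_x l g < x \<longleftrightarrow> meet_x l g < x'"
    using assms(1,3) False by (auto simp: met_before_def)
  moreover have "meet_x l g \<noteq> x" "meet_x l g \<noteq> x'" using d assms(4,5) by auto
  ultimately have "(0 < x - meet_x l g \<and> 0 < x' - meet_x l g) \<or> (x - meet_x l g < 0 \<and> x' - meet_x l g < 0)"
    by linarith
  hence "((fst g - fst l) * (x - meet_x l g) < 0) \<longleftrightarrow> ((fst g - fst l) * (x' - meet_x l g) < 0)"
    by (auto simp: mult_less_0_iff)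
  thus ?thesis using d by linarith
qed

lemma met_before_mono: "x \<le> x' \<Longrightarrow> met_before Q l x \<subseteq> met_before Q l x'"
  by (auto simp: met_before_def)

lemma met_before_card_eq:
  assumes "finite Q" "x \<le> x'" "card (met_before Q l x) = card (met_before Q l x')"
  shows "met_before Q l x = met_before Q l x'"
  using assms by (intro card_subset_eq met_before_mono) (auto simp: met_before_def)

lemma card_met_before: "finite Q \<Longrightarrow> l \<in> Q \<Longrightarrow> card (met_before Q l x) < card Q"
  by (intro psubset_card_mono) (auto simp: met_before_def)

text \<open>
  The charging argument behind the count of trapezoids. The lines $l$ and $u$ bound the trapezoid of a point
  from two sides, $\sigma$ telling which of them is the upper one, and the assumption \<open>last\<close> says that the
  edge of $l$ begins no earlier than the edge of $u$. Then the
  edge of $l$ determines the edge of $u$: between two points over the same edge of $l$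
  neither line meets another one, so the line next to $l$ stays the same.
\<close>

lemma opposite_side_determined:
  fixes X :: "'p \<Rightarrow> real" and l u :: "'p \<Rightarrow> real \<times> real"
  assumes "finite Q" and pq: "p \<in> P" "q \<in> P"
    and lu: "\<And>p. p \<in> P \<Longrightarrow> l p \<in> Q \<and> u p \<in> Q \<and> (at_x (u p) (X p) - at_x (l p) (X p)) * \<sigma> > 0"
    and adj: "\<And>p g. p \<in> P \<Longrightarrow> g \<in> Q \<Longrightarrow> \<not> ((at_x g (X p) - at_x (l p) (X p)) * \<sigma> > 0 \<and> (at_x (u p) (X p) - at_x g (X p)) * \<sigma> > 0)"
    and gen: "\<And>p g h. p \<in> P \<Longrightarrow> g \<in> Q \<Longrightarrow> h \<in> Q \<Longrightarrow> g \<noteq> h \<Longrightarrow> at_x g (X p) \<noteq> at_x h (X p)"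
    and last: "\<And>p g. p \<in> P \<Longrightarrow> g \<in> met_before Q (u p) (X p) \<Longrightarrow>
                 \<exists>h\<in>met_before Q (l p) (X p). meet_x (u p) g \<le> meet_x (l p) h"
    and eq: "(l p, card (met_before Q (l p) (X p))) = (l q, card (met_before Q (l q) (X q)))"
  shows "(u p, card (met_before Q (u p) (X p))) = (u q, card (met_before Q (u q) (X q)))"
proof -
  have main: "u p = u q \<and> met_before Q (u p) (X p) = met_before Q (u q) (X q)"
    if pq: "p \<in> P" "q \<in> P" and eq: "l p = l q" "card (met_before Q (l p) (X p)) = card (met_before Q (l q) (X q))"
      and le: "X p \<le> X q" for p q
  proof -
    have el: "met_before Q (l q) (X p) = met_before Q (l q) (X q)"
      using met_before_card_eq[OF assms(1) le] eq by simp
    have eu: "met_before Q (u q) (X p) = met_before Q (u q) (X q)"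
    proof
      show "met_before Q (u q) (X p) \<subseteq> met_before Q (u q) (X q)" using met_before_mono[OF le] .
      show "met_before Q (u q) (X q) \<subseteq> met_before Q (u q) (X p)"
      proof
        fix g assume g: "g \<in> met_before Q (u q) (X q)"
        then obtain h where h: "h \<in> met_before Q (l q) (X q)" "meet_x (u q) g \<le> meet_x (l q) h"
          using last[OF pq(2)] by blast
        have "meet_x (l q) h < X p" using h(1) unfolding el[symmetric] by (simp add: met_before_def)
        thus "g \<in> met_before Q (u q) (X p)" using g h(2) by (simp add: met_before_def)
      qed
    qed
    have inQ: "l p \<in> Q" "l q \<in> Q" "u p \<in> Q" "u q \<in> Q" using lu pq by auto
    have o_l: "at_x g (X p) < at_x (l q) (X p) \<longleftrightarrow> at_x g (X q) < at_x (l q) (X q)" if "g \<in> Q" "g \<noteq> l q" for g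
      using order_unchanged[OF that(1) le el] gen that pq inQ by auto
    have o_u: "at_x g (X p) < at_x (u q) (X p) \<longleftrightarrow> at_x g (X q) < at_x (u q) (X q)" if "g \<in> Q" "g \<noteq> u q" for g
      using order_unchanged[OF that(1) le eu] gen that pq inQ by auto
    have "u p = u q"
    proof (rule ccontr)
      assume ne: "u p \<noteq> u q"
      have ne2: "u p \<noteq> l q" "u q \<noteq> l q" using lu[OF pq(1)] lu[OF pq(2)] eq by auto
      have np: "at_x (u p) (X p) \<noteq> at_x (u q) (X p)" "at_x (u p) (X q) \<noteq> at_x (u q) (X q)"
         "at_x (u p) (X q) \<noteq> at_x (l q) (X q)" "at_x (u q) (X p) \<noteq> at_x (l q) (X p)"
        using gen ne ne2 inQ pq by auto
      note a1 = adj[OF pq(1) inQ(4), unfolded eq(1)] 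
      note a2 = adj[OF pq(2) inQ(3)]
      note l1 = lu[OF pq(1), unfolded eq(1)] lu[OF pq(2)]
      show False using a1 a2 l1 np o_l[OF inQ(3) ne2(1)] o_l[OF inQ(4) ne2(2)] o_u[OF inQ(3) ne]
        by (cases "\<sigma> > 0") (auto simp: zero_less_mult_iff)
    qed
    thus ?thesis using eu by simp
  qed
  show ?thesis
  proof (cases "X p \<le> X q")
    case True
    have "u p = u q" "met_before Q (u p) (X p) = met_before Q (u q) (X q)"
      using main[OF pq _ _ True] eq by auto
    thus ?thesis by presburger
  next
    case False
    have "u q = u p" "met_before Q (u q) (X q) = met_before Q (u p) (X p)"
      using main[OF pq(2) pq(1)] eq False by auto
    thus ?thesis by presburger
  qed
qed

lemma card_image_factor:
  assumes "finite A" "\<And>x y. x \<in> A \<Longrightarrow> y \<in> A \<Longrightarrow> f x = f y \<Longrightarrow> g x = g y"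
  shows "card (g ` A) \<le> card (f ` A)"
proof -
  have "g ` A = (\<lambda>z. g (SOME x. x \<in> A \<and> f x = z)) ` (f ` A)"
  proof -
    have "g (SOME y. y \<in> A \<and> f y = f x) = g x" if "x \<in> A" for x
      using someI[of "\<lambda>y. y \<in> A \<and> f y = f x" x] that assms(2)[of _ x] by blast
    thus ?thesis by (force simp: image_iff)
  qed
  thus ?thesis using assms(1) by (metis card_image_le finite_imageI)
qed

text \<open>
  Every trapezoid begins where its lower or its upper edge begins, and it is determined by that edge.
  An arrangement of $K$ lines has at most $K^2$ edges, which gives $2 K^2$. The points are classified by the
  two edges next to them, so that no trapezoid has to be constructed.
\<close>

lemma card_trapezoid_classes:
  fixes X :: "'p \<Rightarrow> real" and l u :: "'p \<Rightarrow> real \<times> real"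
  assumes "finite Q" "finite P"
    and lu: "\<And>p. p \<in> P \<Longrightarrow> l p \<in> Q \<and> u p \<in> Q \<and> at_x (l p) (X p) < at_x (u p) (X p)"
    and adj: "\<And>p g. p \<in> P \<Longrightarrow> g \<in> Q \<Longrightarrow> \<not> (at_x (l p) (X p) < at_x g (X p) \<and> at_x g (X p) < at_x (u p) (X p))"
    and gen: "\<And>p g h. p \<in> P \<Longrightarrow> g \<in> Q \<Longrightarrow> h \<in> Q \<Longrightarrow> g \<noteq> h \<Longrightarrow> at_x g (X p) \<noteq> at_x h (X p)"
  defines "key \<equiv> \<lambda>p. ((l p, card (met_before Q (l p) (X p))), (u p, card (met_before Q (u p) (X p))))"
  shows "card (key ` P) \<le> 2 * (card Q)\<^sup>2"
proof -
  \<comment> \<open>P1: the lower edge begins last; P2: the upper edge does\<close>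
  define P1 where "P1 = {p \<in> P. \<forall>g\<in>met_before Q (u p) (X p).
                 \<exists>h\<in>met_before Q (l p) (X p). meet_x (u p) g \<le> meet_x (l p) h}"
  define P2 where "P2 = {p \<in> P. \<forall>g\<in>met_before Q (l p) (X p).
                 \<exists>h\<in>met_before Q (u p) (X p). meet_x (l p) g \<le> meet_x (u p) h}"
  have P12: "P = P1 \<union> P2" 
  proof
    show "P \<subseteq> P1 \<union> P2"
    proof
      fix p assume p: "p \<in> P"
      show "p \<in> P1 \<union> P2"
      proof (cases "p \<in> P1")
        case False
        then obtain g where g: "g \<in> met_before Q (u p) (X p)"
          "\<And>h. h \<in> met_before Q (l p) (X p) \<Longrightarrow> meet_x (l p) h \<le> meet_x (u p) g"
          using p by (force simp: P1_def)
        thus ?thesis using p by (auto simp: P2_def)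
      qed simp
    qed
  qed (auto simp: P1_def P2_def)
  have fin: "finite P1" "finite P2" using P12 assms(2) by auto
  have "card (key ` P1) \<le> card ((\<lambda>p. (l p, card (met_before Q (l p) (X p)))) ` P1)"
  proof (rule card_image_factor[OF fin(1)])
    fix p q assume pq: "p \<in> P1" "q \<in> P1"
      "(l p, card (met_before Q (l p) (X p))) = (l q, card (met_before Q (l q) (X q)))"
    have "(u p, card (met_before Q (u p) (X p))) = (u q, card (met_before Q (u q) (X q)))"
      by (rule opposite_side_determined[where P = P1 and l = l and \<sigma> = 1])
         (use assms pq in \<open>auto simp: P1_def\<close>)
    with pq(3) show "key p = key q" unfolding key_def by presburger
  qed
  also have "\<dots> \<le> card (Q \<times> {..<card Q})"
  proof (intro card_mono image_subsetI)
    fix p assume "p \<in> P1"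
    hence "l p \<in> Q" using lu by (simp add: P1_def)
    thus "(l p, card (met_before Q (l p) (X p))) \<in> Q \<times> {..<card Q}"
      using card_met_before[OF assms(1)] by simp
  qed (use assms(1) in simp)
  finally have 1: "card (key ` P1) \<le> (card Q)\<^sup>2" by (simp add: power2_eq_square card_cartesian_product)
  have "card (key ` P2) \<le> card ((\<lambda>p. (u p, card (met_before Q (u p) (X p)))) ` P2)"
  proof (rule card_image_factor[OF fin(2)])
    fix p q assume pq: "p \<in> P2" "q \<in> P2"
      "(u p, card (met_before Q (u p) (X p))) = (u q, card (met_before Q (u q) (X q)))"
    have "(l p, card (met_before Q (l p) (X p))) = (l q, card (met_before Q (l q) (X q)))"
      by (rule opposite_side_determined[where P = P2 and l = u and \<sigma> = "-1"])
         (use assms pq in \<open>auto simp: P2_def\<close>)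
    with pq(3) show "key p = key q" unfolding key_def by presburger
  qed
  also have "\<dots> \<le> card (Q \<times> {..<card Q})"
  proof (intro card_mono image_subsetI)
    fix p assume "p \<in> P2"
    hence "u p \<in> Q" using lu by (simp add: P2_def)
    thus "(u p, card (met_before Q (u p) (X p))) \<in> Q \<times> {..<card Q}"
      using card_met_before[OF assms(1)] by simp
  qed (use assms(1) in simp)
  finally have 2: "card (key ` P2) \<le> (card Q)\<^sup>2" by (simp add: power2_eq_square card_cartesian_product)
  have "card (key ` P) \<le> card (key ` P1) + card (key ` P2)"
    unfolding P12 image_Un by (rule card_Un_le)
  thus ?thesis using 1 2 by linarith
qed

section \<open>A large class that few lines cut\<close>

text \<open>
  The trapezoid between $l$ and $u$ over the interval from $x_1$ to $x_2$: a line misses its interior iff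
  at both ends it is weakly below $l$, or at both ends weakly above $u$.
\<close>

definition crosses :: "real \<times> real \<Rightarrow> real \<Rightarrow> real \<Rightarrow> real \<times> real \<Rightarrow> real \<times> real \<Rightarrow> bool" where
  "crosses h x1 x2 l u \<longleftrightarrow>
     \<not> (at_x h x1 \<le> at_x l x1 \<and> at_x h x2 \<le> at_x l x2) \<and>
     \<not> (at_x u x1 \<le> at_x h x1 \<and> at_x u x2 \<le> at_x h x2)"

definition splits :: "real \<times> real \<Rightarrow> (real \<times> real) set \<Rightarrow> bool" where
  "splits h V \<longleftrightarrow> \<not> (\<forall>v\<in>V. at_x h (fst v) < snd v) \<and> \<not> (\<forall>v\<in>V. snd v < at_x h (fst v))"

lemma finite_positive_lower_bound:
  fixes f :: "'a \<Rightarrow> real"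
  assumes "finite A" "\<And>a. a \<in> A \<Longrightarrow> 0 < f a"
  shows "\<exists>\<eta>>0. \<forall>a\<in>A. \<eta> \<le> f a"
proof (cases "A = {}")
  case True
  thus ?thesis by (auto intro: exI[of _ 1])
next
  case False
  thus ?thesis using assms by (intro exI[of _ "Min (f ` A)"]) auto
qed

lemma finite_upper_bound:
  fixes f :: "'a \<Rightarrow> real"
  assumes "finite A"
  shows "\<exists>Y>0. \<forall>a\<in>A. f a < Y"
proof -
  have "bdd_above (f ` A)" using assms by simp
  then obtain B where "\<forall>a\<in>A. f a \<le> B" by (auto simp: bdd_above_def)
  thus ?thesis by (intro exI[of _ "max 0 B + 1"]) (auto simp: max_def intro: le_less_trans)
qed

lemma finite_argmax:
  fixes f :: "'a \<Rightarrow> real"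
  assumes "finite A" "A \<noteq> {}"
  shows "\<exists>a\<in>A. \<forall>b\<in>A. f b \<le> f a"
proof -
  have "Max (f ` A) \<in> f ` A" using assms by (intro Max_in) auto
  then obtain a where "a \<in> A" "Max (f ` A) = f a" by auto
  thus ?thesis using assms(1) by (metis Max_ge finite_imageI imageI)
qed

lemma finite_argmax_such_that:
  fixes f :: "'a \<Rightarrow> real"
  assumes "finite A" "a \<in> A" "R a"
  shows "\<exists>a. a \<in> A \<and> R a \<and> (\<forall>b\<in>A. R b \<longrightarrow> f b \<le> f a)"
proof -
  have "\<exists>a\<in>{a \<in> A. R a}. \<forall>b\<in>{a \<in> A. R a}. f b \<le> f a"
    using assms by (intro finite_argmax) auto
  then obtain a where "a \<in> A" "R a" "\<And>b. b \<in> A \<Longrightarrow> R b \<Longrightarrow> f b \<le> f a" by blast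
  thus ?thesis by blast
qed

text \<open>
  Moving the lower and the upper side of the trapezoid inwards by a small $\eta$ keeps the finitely many points
  inside, while lines that run along a side or through a corner no longer touch the corners in $V$.
\<close>

lemma trapezoid_corners:
  assumes "finite C" "x1 \<in> fst ` C" "x2 \<in> fst ` C"
    and x: "\<And>p. p \<in> C \<Longrightarrow> x1 \<le> fst p \<and> fst p \<le> x2"
    and between: "\<And>p. p \<in> C \<Longrightarrow> at_x l (fst p) < snd p \<and> snd p < at_x u (fst p)"
  shows "\<exists>V. finite V \<and> card V \<le> 4 \<and> C \<subseteq> convex hull V \<and> (\<forall>h. splits h V \<longrightarrow> crosses h x1 x2 l u)"
proof -
  obtain \<eta> where \<eta>: "\<eta> > 0" "\<And>p. p \<in> C \<Longrightarrow> \<eta> \<le> min (snd p - at_x l (fst p)) (at_x u (fst p) - snd p)"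
    using finite_positive_lower_bound[OF assms(1), of "\<lambda>p. min (snd p - at_x l (fst p)) (at_x u (fst p) - snd p)"] between
    by auto
  have C: "at_x l (fst p) + \<eta> \<le> snd p" "snd p \<le> at_x u (fst p) - \<eta>" if "p \<in> C" for p
    using \<eta>(2)[OF that] by auto
  define V where "V = {(x1, at_x l x1 + \<eta>), (x1, at_x u x1 - \<eta>), (x2, at_x l x2 + \<eta>), (x2, at_x u x2 - \<eta>)}"
  have gap: "at_x l x1 + 2 * \<eta> \<le> at_x u x1" "at_x l x2 + 2 * \<eta> \<le> at_x u x2"
    using C assms(2,3) by fastforce+
  have "C \<subseteq> convex hull V"
  proof
    fix p assume p: "p \<in> C"
    obtain t where t: "0 \<le> t" "t \<le> 1" "fst p = (1 - t) * x1 + t * x2"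
    proof -
      have "fst p \<in> closed_segment x1 x2" using x[OF p] by (simp add: closed_segment_eq_real_ivl)
      thus ?thesis using that by (auto simp: in_segment)
    qed
    have cv: "convex (convex hull V)" by (rule convex_convex_hull)
    have inV: "v \<in> convex hull V" if "v \<in> V" for v using that by (rule hull_inc)
    have "(1 - t) *\<^sub>R (x1, at_x l x1 + \<eta>) + t *\<^sub>R (x2, at_x l x2 + \<eta>) \<in> convex hull V"
      using t by (intro convexD[OF cv] inV) (auto simp: V_def)
    also have "(1 - t) *\<^sub>R (x1, at_x l x1 + \<eta>) + t *\<^sub>R (x2, at_x l x2 + \<eta>) = (fst p, at_x l (fst p) + \<eta>)"
      by (simp add: t(3) at_x_def algebra_simps)
    finally have lo: "(fst p, at_x l (fst p) + \<eta>) \<in> convex hull V" .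
    have "(1 - t) *\<^sub>R (x1, at_x u x1 - \<eta>) + t *\<^sub>R (x2, at_x u x2 - \<eta>) \<in> convex hull V"
      using t by (intro convexD[OF cv] inV) (auto simp: V_def)
    also have "(1 - t) *\<^sub>R (x1, at_x u x1 - \<eta>) + t *\<^sub>R (x2, at_x u x2 - \<eta>) = (fst p, at_x u (fst p) - \<eta>)"
      by (simp add: t(3) at_x_def algebra_simps)
    finally have hi: "(fst p, at_x u (fst p) - \<eta>) \<in> convex hull V" .
    obtain r where r: "0 \<le> r" "r \<le> 1" "snd p = (1 - r) * (at_x l (fst p) + \<eta>) + r * (at_x u (fst p) - \<eta>)"
    proof -
      have "snd p \<in> closed_segment (at_x l (fst p) + \<eta>) (at_x u (fst p) - \<eta>)"
        using C[OF p] by (simp add: closed_segment_eq_real_ivl)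
      thus ?thesis using that by (auto simp: in_segment)
    qed
    have "(1 - r) *\<^sub>R (fst p, at_x l (fst p) + \<eta>) + r *\<^sub>R (fst p, at_x u (fst p) - \<eta>) \<in> convex hull V"
      using r by (intro convexD[OF cv] lo hi) auto
    also have "(1 - r) *\<^sub>R (fst p, at_x l (fst p) + \<eta>) + r *\<^sub>R (fst p, at_x u (fst p) - \<eta>) = p"
      using r(3) by (cases p) (simp add: algebra_simps)
    finally show "p \<in> convex hull V" .
  qed
  moreover have "card V \<le> 4"
    unfolding V_def by (rule order_trans[OF card_insert_le_m1]) (auto intro!: card_insert_le_m1 order_trans[OF card_insert_le_m1])
  moreover have "\<forall>h. splits h V \<longrightarrow> crosses h x1 x2 l u"
    using gap \<eta>(1) unfolding splits_def crosses_def V_def by auto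
  ultimately show ?thesis by (intro exI[of _ V]) (auto simp: V_def)
qed

lemma ex_min_max_fst:
  assumes "finite C" "C \<noteq> {}"
  shows "\<exists>p\<in>C. \<exists>q\<in>C. \<forall>r\<in>C. fst p \<le> (fst r::real) \<and> fst r \<le> fst q"
proof -
  obtain p where "p \<in> C" "\<forall>r\<in>C. - fst r \<le> - fst p" using finite_argmax[OF assms, of "\<lambda>p. - fst p"] by blast
  moreover obtain q where "q \<in> C" "\<forall>r\<in>C. fst r \<le> fst q" using finite_argmax[OF assms, of fst] by blast
  ultimately show ?thesis by auto
qed

lemma four_point_hull:
  fixes P :: "(real \<times> real) set"
  assumes "finite P"
  shows "\<exists>V. finite V \<and> card V \<le> 4 \<and> P \<subseteq> convex hull V"
proof (cases "P = {}")
  case True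
  thus ?thesis by (intro exI[of _ "{}"]) auto
next
  case False
  obtain Y where Y: "\<And>p. p \<in> P \<Longrightarrow> \<bar>snd p\<bar> < Y" using finite_upper_bound[OF assms, of "\<lambda>p. \<bar>snd p\<bar>"] by blast
  obtain p q where pq: "p \<in> P" "q \<in> P" "\<And>r. r \<in> P \<Longrightarrow> fst p \<le> fst r \<and> fst r \<le> fst q"
    using ex_min_max_fst[OF assms False] by blast
  have "\<exists>V. finite V \<and> card V \<le> 4 \<and> P \<subseteq> convex hull V \<and> (\<forall>h. splits h V \<longrightarrow> crosses h (fst p) (fst q) (0, -Y) (0, Y))"
    using pq Y assms by (intro trapezoid_corners) (force simp: at_x_def)+
  thus ?thesis by blast
qed

lemma large_fibre:
  assumes "finite A" "card (f ` A) \<le> N" "N * s \<le> card A" "1 \<le> N" "1 \<le> s"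
  shows "\<exists>z. s \<le> card {a \<in> A. f a = z}"
proof (rule ccontr)
  assume "\<not> ?thesis"
  hence small: "card {a \<in> A. f a = z} \<le> s - 1" for z
    by (metis Suc_diff_1 assms(5) less_Suc_eq_le not_le not_less_eq_eq One_nat_def Suc_le_lessD)
  have "card A = (\<Sum>z\<in>f ` A. card {a \<in> A. f a = z})"
    using sum.image_gen[OF assms(1), of "\<lambda>_. 1::nat" f] by simp
  also have "\<dots> \<le> (\<Sum>z\<in>f ` A. s - 1)" using small by (intro sum_mono)
  also have "\<dots> \<le> N * (s - 1)" using assms(2) by simp
  also have "\<dots> < N * s" using assms(4,5) by simp
  finally show False using assms(3) by linarith
qed

text \<open>
  Cutting lemma for one cell. A set of $k$ lines that hits all trapezoids crossed by more than a $1/\rho$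
  fraction of the weight cuts the points into at most $2 (k + 2)^2$ classes; the largest class lies in a
  trapezoid that none of the $k$ lines crosses, so this trapezoid is crossed by little weight.
\<close>

lemma light_trapezoid:
  fixes L P :: "(real \<times> real) set" and w :: "real \<times> real \<Rightarrow> real"
  assumes fin: "finite L" "finite P" and w: "\<And>l. l \<in> L \<Longrightarrow> 0 \<le> w l"
    and off: "\<And>p l. p \<in> P \<Longrightarrow> l \<in> L \<Longrightarrow> snd p \<noteq> at_x l (fst p)"
    and gen: "\<And>p g h. p \<in> P \<Longrightarrow> g \<in> L \<Longrightarrow> h \<in> L \<Longrightarrow> g \<noteq> h \<Longrightarrow> at_x g (fst p) \<noteq> at_x h (fst p)"
    and \<rho>: "\<rho> \<ge> 1" and k: "(real (card P))\<^sup>2 * (real (card L + 2))\<^sup>2 * exp (- real k / \<rho>) < 1"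
    and s: "1 \<le> s" "2 * (k + 2)\<^sup>2 * s \<le> card P"
  shows "\<exists>P' V. P' \<subseteq> P \<and> card P' = s \<and> finite V \<and> card V \<le> 4 \<and> P' \<subseteq> convex hull V \<and>
           \<rho> * sum w {l \<in> L. splits l V} \<le> sum w L"
proof -
  obtain Y where Y: "Y > 0" "\<And>p. p \<in> P \<Longrightarrow> \<bar>snd p\<bar> + (\<Sum>l\<in>L. \<bar>at_x l (fst p)\<bar>) < Y"
    using finite_upper_bound[OF fin(2), of "\<lambda>p. \<bar>snd p\<bar> + (\<Sum>l\<in>L. \<bar>at_x l (fst p)\<bar>)"] by blast
  have Yp: "\<bar>snd p\<bar> < Y" if "p \<in> P" for p 
    using Y(2)[OF that] sum_nonneg[of L "\<lambda>l. \<bar>at_x l (fst p)\<bar>"] by (smt (verit) abs_ge_zero)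
  have Yl: "\<bar>at_x l (fst p)\<bar> < Y" if "p \<in> P" "l \<in> L" for p l
    using Y(2)[OF that(1)] member_le_sum[OF that(2), of "\<lambda>l. \<bar>at_x l (fst p)\<bar>"] fin by auto
  \<comment> \<open>two horizontal lines beyond everything that matters, so that every point has a line above and below\<close>
  define ends where "ends = {(0, Y), (0, - Y) :: real \<times> real}"
  have at_ends [simp]: "at_x (0, y) x = y" for x y by (simp add: at_x_def)
  \<comment> \<open>the vertical sides are taken through points of P, which leaves finitely many trapezoids\<close>
  define F where "F = {f \<in> P \<times> P \<times> (L \<union> ends) \<times> (L \<union> ends).
     sum w L < \<rho> * sum w {h \<in> L. case f of (p, q, l, u) \<Rightarrow> crosses h (fst p) (fst q) l u}}"
  have finF: "finite F" unfolding F_def ends_def using fin by auto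
  have "card F \<le> card (P \<times> P \<times> (L \<union> ends) \<times> (L \<union> ends))"
    unfolding F_def ends_def using fin by (intro card_mono) auto
  also have "\<dots> = card P * (card P * (card (L \<union> ends) * card (L \<union> ends)))"
    by (simp only: card_cartesian_product)
  also have "\<dots> \<le> card P * (card P * ((card L + 2) * (card L + 2)))"
  proof -
    have "card ends \<le> 2" unfolding ends_def by (simp add: card_insert_if)
    hence "card (L \<union> ends) \<le> card L + 2" using card_Un_le[of L ends] by linarith
    thus ?thesis by (intro mult_le_mono) auto
  qed
  finally have "real (card F) \<le> real (card P * (card P * ((card L + 2) * (card L + 2))))"
    by (simp only: of_nat_le_iff)
  hence cF: "real (card F) \<le> (real (card P))\<^sup>2 * (real (card L + 2))\<^sup>2"
    by (simp add: power2_eq_square algebra_simps)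
  have "\<exists>Q \<subseteq> L. card Q \<le> k \<and>
      real (card {f \<in> F. \<forall>h\<in>Q. \<not> (case f of (p, q, l, u) \<Rightarrow> crosses h (fst p) (fst q) l u)})
       \<le> real (card F) * (1 - 1 / \<rho>) ^ k"
  proof (rule greedy_hitting_set[OF fin(1) finF w])
    show "0 < \<rho>" using \<rho> by simp
    show "sum w L < \<rho> * sum w {h \<in> L. case f of (p, q, l, u) \<Rightarrow> crosses h (fst p) (fst q) l u}"
      if "f \<in> F" for f using that unfolding F_def mem_Collect_eq by (rule conjunct2)
  qed
  then obtain Q where Q: "Q \<subseteq> L" "card Q \<le> k"
    "real (card {f \<in> F. \<forall>h\<in>Q. \<not> (case f of (p, q, l, u) \<Rightarrow> crosses h (fst p) (fst q) l u)})
       \<le> real (card F) * (1 - 1 / \<rho>) ^ k"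
    by blast
  have "(1 - 1 / \<rho>) ^ k \<le> exp (- 1 / \<rho>) ^ k"
    using \<rho> exp_ge_add_one_self[of "- 1 / \<rho>"] by (intro power_mono) auto
  also have "\<dots> = exp (- real k / \<rho>)" by (simp flip: exp_of_nat_mult)
  finally have "real (card F) * (1 - 1 / \<rho>) ^ k \<le> (real (card P))\<^sup>2 * (real (card L + 2))\<^sup>2 * exp (- real k / \<rho>)"
    using cF \<rho> by (intro mult_mono zero_le_power) auto
  hence none: "card {f \<in> F. \<forall>h\<in>Q. \<not> (case f of (p, q, l, u) \<Rightarrow> crosses h (fst p) (fst q) l u)} = 0"
    using Q(3) k by linarith
  hence hit: "\<exists>h\<in>Q. crosses h (fst p) (fst q) l u" if "(p, q, l, u) \<in> F" for p q l u
  proof -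
    have "finite {f \<in> F. \<forall>h\<in>Q. \<not> (case f of (p, q, l, u) \<Rightarrow> crosses h (fst p) (fst q) l u)}"
      by (rule finite_subset[OF _ finF]) blast
    hence "{f \<in> F. \<forall>h\<in>Q. \<not> (case f of (p, q, l, u) \<Rightarrow> crosses h (fst p) (fst q) l u)} = {}"
      using none by (simp only: card_eq_0_iff simp_thms)
    thus ?thesis using that by fast
  qed
  define Q' where "Q' = Q \<union> ends"
  have finQ': "finite Q'" using Q(1) fin(1) finite_subset by (auto simp: Q'_def ends_def)
  have cQ': "card Q' \<le> k + 2"
  proof -
    have "card ends \<le> 2" unfolding ends_def by (simp add: card_insert_if)
    thus ?thesis using card_Un_le[of Q ends] Q(2) unfolding Q'_def by linarith
  qed
  have gen': "at_x g (fst p) \<noteq> at_x h (fst p)" if "p \<in> P" "g \<in> Q'" "h \<in> Q'" "g \<noteq> h" for p g h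
  proof -
    have "g \<in> L \<or> g = (0, Y) \<or> g = (0, -Y)" "h \<in> L \<or> h = (0, Y) \<or> h = (0, -Y)"
      using that Q(1) by (auto simp: Q'_def ends_def)
    thus ?thesis using gen[OF that(1)] that(4) Yl[OF that(1)] Y(1) 
      by (elim disjE) (fastforce simp: abs_less_iff)+
  qed
  have off': "snd p \<noteq> at_x l (fst p)" if "p \<in> P" "l \<in> Q'" for p l
  proof -
    have "l \<in> L \<or> l = (0, Y) \<or> l = (0, -Y)" using that(2) Q(1) by (auto simp: Q'_def ends_def)
    thus ?thesis using off[OF that(1)] Yp[OF that(1)] by fastforce
  qed
  have "\<forall>p\<in>P. \<exists>l. l \<in> Q' \<and> at_x l (fst p) < snd p \<and> (\<forall>g\<in>Q'. at_x g (fst p) < snd p \<longrightarrow> at_x g (fst p) \<le> at_x l (fst p))"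
  proof
    fix p assume p: "p \<in> P"
    have mem: "(0, -Y) \<in> Q'" "at_x (0, -Y) (fst p) < snd p" using Yp[OF p] by (auto simp: Q'_def ends_def abs_less_iff)
    show "\<exists>l. l \<in> Q' \<and> at_x l (fst p) < snd p \<and> (\<forall>g\<in>Q'. at_x g (fst p) < snd p \<longrightarrow> at_x g (fst p) \<le> at_x l (fst p))"
      using finite_argmax_such_that[where R = "\<lambda>g. at_x g (fst p) < snd p" and f = "\<lambda>g. at_x g (fst p)", OF finQ' mem] .
  qed
  then obtain lo where lo: "\<And>p. p \<in> P \<Longrightarrow> lo p \<in> Q' \<and> at_x (lo p) (fst p) < snd p"
    "\<And>p g. p \<in> P \<Longrightarrow> g \<in> Q' \<Longrightarrow> at_x g (fst p) < snd p \<Longrightarrow> at_x g (fst p) \<le> at_x (lo p) (fst p)"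
    by metis
  have "\<forall>p\<in>P. \<exists>l. l \<in> Q' \<and> snd p < at_x l (fst p) \<and> (\<forall>g\<in>Q'. snd p < at_x g (fst p) \<longrightarrow> at_x l (fst p) \<le> at_x g (fst p))"
  proof
    fix p assume p: "p \<in> P"
    have mem: "(0, Y) \<in> Q'" "snd p < at_x (0, Y) (fst p)" using Yp[OF p] by (auto simp: Q'_def ends_def abs_less_iff)
    show "\<exists>l. l \<in> Q' \<and> snd p < at_x l (fst p) \<and> (\<forall>g\<in>Q'. snd p < at_x g (fst p) \<longrightarrow> at_x l (fst p) \<le> at_x g (fst p))"
      using finite_argmax_such_that[where R = "\<lambda>g. snd p < at_x g (fst p)" and f = "\<lambda>g. - at_x g (fst p)", OF finQ' mem]
      by (simp only: neg_le_iff_le)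
  qed
  then obtain up where up: "\<And>p. p \<in> P \<Longrightarrow> up p \<in> Q' \<and> snd p < at_x (up p) (fst p)"
    "\<And>p g. p \<in> P \<Longrightarrow> g \<in> Q' \<Longrightarrow> snd p < at_x g (fst p) \<Longrightarrow> at_x (up p) (fst p) \<le> at_x g (fst p)"
    by metis
  have adj: "\<not> (at_x (lo p) (fst p) < at_x g (fst p) \<and> at_x g (fst p) < at_x (up p) (fst p))"
    if "p \<in> P" "g \<in> Q'" for p g
    using off'[OF that] lo(2)[OF that] up(2)[OF that] by linarith
  define key where "key = (\<lambda>p. ((lo p, card (met_before Q' (lo p) (fst p))), (up p, card (met_before Q' (up p) (fst p)))))"
  have "card (key ` P) \<le> 2 * (card Q')\<^sup>2"
    unfolding key_def
  proof (rule card_trapezoid_classes[OF finQ' fin(2)])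
    show "lo p \<in> Q' \<and> up p \<in> Q' \<and> at_x (lo p) (fst p) < at_x (up p) (fst p)" if "p \<in> P" for p
      using lo(1)[OF that] up(1)[OF that] by linarith
  qed (use adj gen' in blast)+
  also have "\<dots> \<le> 2 * (k + 2)\<^sup>2" using cQ' by (simp add: power_mono)
  finally have ckey: "card (key ` P) \<le> 2 * (k + 2)\<^sup>2" .
  obtain z where z: "s \<le> card {p \<in> P. key p = z}"
    using large_fibre[OF fin(2) ckey s(2) _ s(1)] by auto
  define C where "C = {p \<in> P. key p = z}"
  have finC: "finite C" using fin by (simp add: C_def)
  have "C \<noteq> {}" using z s(1) by (auto simp: C_def[symmetric])
  then obtain p q where pq: "p \<in> C" "q \<in> C" "\<And>r. r \<in> C \<Longrightarrow> fst p \<le> fst r \<and> fst r \<le> fst q"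
    using ex_min_max_fst[OF finC] by blast
  have pqP: "p \<in> P" "q \<in> P" using pq by (auto simp: C_def)
  have same: "lo r = lo p" "up r = up p" if "r \<in> C" for r
  proof -
    have "key r = key p" using that pq(1) by (simp add: C_def)
    thus "lo r = lo p" "up r = up p" by (auto simp: key_def)
  qed
  have "key p = key q" using pq(1,2) by (simp add: C_def)
  hence ceq: "card (met_before Q' (lo p) (fst p)) = card (met_before Q' (lo p) (fst q))"
    "card (met_before Q' (up p) (fst p)) = card (met_before Q' (up p) (fst q))"
    using same[OF pq(2)] unfolding key_def by (metis prod.inject)+
  have le: "fst p \<le> fst q" using pq by blast
  note meq = met_before_card_eq[OF finQ' le ceq(1)] met_before_card_eq[OF finQ' le ceq(2)]
  \<comment> \<open>between the leftmost point p and the rightmost point q of the class no line of the hitting set meets lo p or up p\<close>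
  have notF: "(p, q, lo p, up p) \<notin> F"
  proof
    assume "(p, q, lo p, up p) \<in> F"
    then obtain h where h: "h \<in> Q" "crosses h (fst p) (fst q) (lo p) (up p)" using hit by blast
    have hQ: "h \<in> Q'" using h(1) by (simp add: Q'_def)
    have ne: "h \<noteq> lo p" "h \<noteq> up p" using h(2) by (auto simp: crosses_def)
    have inQ: "lo p \<in> Q'" "up p \<in> Q'" using lo(1) up(1) pqP by auto
    note o1 = order_unchanged[OF hQ le meq(1) gen'[OF pqP(1) hQ inQ(1) ne(1)] gen'[OF pqP(2) hQ inQ(1) ne(1)]]
    note o2 = order_unchanged[OF hQ le meq(2) gen'[OF pqP(1) hQ inQ(2) ne(2)] gen'[OF pqP(2) hQ inQ(2) ne(2)]]
    show False using h(2) adj[OF pqP(1) hQ] gen'[OF pqP(1) hQ inQ(1) ne(1)] o1 o2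
      unfolding crosses_def by linarith
  qed
  have "lo p \<in> L \<union> ends" "up p \<in> L \<union> ends" using lo(1)[OF pqP(1)] up(1)[OF pqP(1)] Q(1) by (auto simp: Q'_def)
  hence light: "\<rho> * sum w {h \<in> L. crosses h (fst p) (fst q) (lo p) (up p)} \<le> sum w L"
    using notF pqP by (auto simp: F_def)
  have "\<exists>V. finite V \<and> card V \<le> 4 \<and> C \<subseteq> convex hull V \<and> (\<forall>h. splits h V \<longrightarrow> crosses h (fst p) (fst q) (lo p) (up p))"
  proof (rule trapezoid_corners[OF finC])
    fix r assume r: "r \<in> C"
    show "fst p \<le> fst r \<and> fst r \<le> fst q" using pq(3)[OF r] .
    have "r \<in> P" using r by (simp add: C_def)
    thus "at_x (lo p) (fst r) < snd r \<and> snd r < at_x (up p) (fst r)"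
      using lo(1)[of r] up(1)[of r] same[OF r] by auto
  qed (use pq in auto)
  then obtain V where V: "finite V" "card V \<le> 4" "C \<subseteq> convex hull V"
     "\<And>h. splits h V \<Longrightarrow> crosses h (fst p) (fst q) (lo p) (up p)" by blast
  have "sum w {l \<in> L. splits l V} \<le> sum w {h \<in> L. crosses h (fst p) (fst q) (lo p) (up p)}"
    using V(4) fin(1) w by (intro sum_mono2) auto
  hence "\<rho> * sum w {l \<in> L. splits l V} \<le> \<rho> * sum w {h \<in> L. crosses h (fst p) (fst q) (lo p) (up p)}"
    using \<rho> by (intro mult_left_mono) auto
  hence V5: "\<rho> * sum w {l \<in> L. splits l V} \<le> sum w L" using light by linarith
  have "s \<le> card C" using z by (simp only: C_def)
  then obtain P' where P': "P' \<subseteq> C" "card P' = s" "finite P'" by (rule obtain_subset_with_card_n)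
  have "P' \<subseteq> P" using P'(1) by (auto simp: C_def)
  moreover have "P' \<subseteq> convex hull V" using P'(1) V(3) by (rule order_trans)
  ultimately show ?thesis using P'(2) V(1,2) V5 by (intro exI[of _ P'] exI[of _ V] conjI)
qed

section \<open>Partitions cut by few lines\<close>

text \<open>
  The bound of \<open>light_trapezoid\<close> with $k \approx 0.7 \sqrt{t+1}$ and $\rho = \sqrt{t+1} / \Lambda$, where
  $\Lambda = 16 + 16 \ln M$. The number of trapezoids is at most $M^4$, and $k / \rho \ge \Lambda / 2$ exceeds
  $4 \ln M$. If $\sqrt{t+1} \le \Lambda$, the claim is trivial.
\<close>

lemma light_subset:
  fixes L P :: "(real \<times> real) set" and w :: "real \<times> real \<Rightarrow> real"
  assumes fin: "finite L" "finite P" and w: "\<And>l. l \<in> L \<Longrightarrow> 0 \<le> w l"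
    and off: "\<And>p l. p \<in> P \<Longrightarrow> l \<in> L \<Longrightarrow> snd p \<noteq> at_x l (fst p)"
    and gen: "\<And>p g h. p \<in> P \<Longrightarrow> g \<in> L \<Longrightarrow> h \<in> L \<Longrightarrow> g \<noteq> h \<Longrightarrow> at_x g (fst p) \<noteq> at_x h (fst p)"
    and M: "1 \<le> M" "real (card P) \<le> M" "real (card L) + 2 \<le> M"
    and s: "1 \<le> s" "Suc t * s \<le> card P"
  shows "\<exists>P' V. P' \<subseteq> P \<and> card P' = s \<and> finite V \<and> card V \<le> 4 \<and> P' \<subseteq> convex hull V \<and>
           sum w {l \<in> L. splits l V} \<le> sum w L * ((16 + 16 * ln M) / sqrt (real (Suc t)))"
proof -
  define \<Lambda> where "\<Lambda> = 16 + 16 * ln M"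
  define T where "T = sqrt (real (Suc t))"
  have lnM: "0 \<le> ln M" using M(1) by simp
  have W: "0 \<le> sum w L" using w by (rule sum_nonneg)
  have T: "T > 0" "T\<^sup>2 = real (Suc t)" by (auto simp: T_def)
  show ?thesis
  proof (cases "T \<le> \<Lambda>")
    case True
    obtain V where V: "finite V" "card V \<le> 4" "P \<subseteq> convex hull V" using four_point_hull[OF fin(2)] by blast
    have "s \<le> card P" using s by simp
    then obtain P' where P': "P' \<subseteq> P" "card P' = s" by (metis obtain_subset_with_card_n)
    have "sum w {l \<in> L. splits l V} \<le> sum w L * 1" using fin(1) w by (auto intro!: sum_mono2)
    also have "\<dots> \<le> sum w L * (\<Lambda> / T)" using True T(1) by (intro mult_left_mono W) simp
    finally have "sum w {l \<in> L. splits l V} \<le> sum w L * (\<Lambda> / T)" .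
    moreover have "P' \<subseteq> convex hull V" using P'(1) V(3) by (rule order_trans)
    ultimately show ?thesis unfolding T_def \<Lambda>_def using P' V(1,2) 
      by (intro exI[of _ P'] exI[of _ V] conjI)
  next
    case False
    hence big: "16 \<le> T" "\<Lambda> < T" using lnM by (auto simp: \<Lambda>_def)
    define k where "k = nat \<lfloor>7/10 * T\<rfloor> - 2"
    have k1: "real (k + 2) \<le> 7/10 * T" and k2: "T / 2 \<le> real k"
      using big(1) unfolding k_def by linarith+
    have "(real (k + 2))\<^sup>2 \<le> (7/10 * T)\<^sup>2" using k1 by (intro power_mono) auto
    also have "\<dots> \<le> T\<^sup>2 / 2" by (simp add: power_mult_distrib power2_eq_square)
    also have "\<dots> = real (Suc t) / 2" by (simp only: T(2))
    finally have "real (2 * (k + 2)\<^sup>2) \<le> real (Suc t)" by simp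
    hence "2 * (k + 2)\<^sup>2 \<le> Suc t" by (simp only: of_nat_le_iff)
    hence "2 * (k + 2)\<^sup>2 * s \<le> Suc t * s" by (rule mult_le_mono1)
    hence ks: "2 * (k + 2)\<^sup>2 * s \<le> card P" using s(2) by (rule order_trans)
    define \<rho> where "\<rho> = T / \<Lambda>"
    have L0: "\<Lambda> > 0" using lnM by (simp add: \<Lambda>_def)
    have \<rho>: "\<rho> \<ge> 1" using big(2) L0 by (simp add: \<rho>_def)
    have "\<Lambda> / 2 \<le> real k / \<rho>" using k2 L0 T(1) by (simp add: \<rho>_def field_simps)
    hence "exp (- real k / \<rho>) \<le> exp (- (8 + 8 * ln M))" by (simp add: \<Lambda>_def)
    also have "\<dots> < exp (- (4 * ln M))" using lnM by simp
    also have "\<dots> = inverse (M ^ 4)" using M(1) by (simp add: exp_minus exp_of_nat_mult[of 4, simplified])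
    finally have e: "exp (- real k / \<rho>) < inverse (M ^ 4)" .
    have "(real (card P))\<^sup>2 * (real (card L + 2))\<^sup>2 * exp (- real k / \<rho>) \<le> M\<^sup>2 * M\<^sup>2 * exp (- real k / \<rho>)"
      using M by (intro mult_mono power_mono) auto
    also have "\<dots> < M\<^sup>2 * M\<^sup>2 * inverse (M ^ 4)" using e M(1) by (intro mult_strict_left_mono) auto
    also have "\<dots> = 1" using M(1) by (simp add: field_simps flip: power_add)
    finally have "(real (card P))\<^sup>2 * (real (card L + 2))\<^sup>2 * exp (- real k / \<rho>) < 1" .
    note hyps = fin w off gen \<rho> this s(1) ks
    have "\<exists>P' V. P' \<subseteq> P \<and> card P' = s \<and> finite V \<and> card V \<le> 4 \<and> P' \<subseteq> convex hull V \<and>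
            \<rho> * sum w {l \<in> L. splits l V} \<le> sum w L"
      by (rule light_trapezoid) (fact hyps)+
    then obtain P' V where PV: "P' \<subseteq> P" "card P' = s" "finite V" "card V \<le> 4" "P' \<subseteq> convex hull V"
       "\<rho> * sum w {l \<in> L. splits l V} \<le> sum w L" by blast
    have "sum w {l \<in> L. splits l V} \<le> sum w L * (\<Lambda> / T)"
      using PV(6) L0 T(1) by (simp add: \<rho>_def field_simps)
    thus ?thesis unfolding T_def \<Lambda>_def using PV(1-5) by (intro exI[of _ P'] exI[of _ V] conjI)
  qed
qed

lemma sum_inverse_sqrt: "(\<Sum>i<t. 1 / sqrt (real (Suc i))) \<le> 2 * sqrt (real t)"
proof (induction t)
  case (Suc t)
  define a b where "a = sqrt (real t)" and "b = sqrt (real (Suc t))"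
  have ab: "0 \<le> a" "a \<le> b" "0 < b" "b\<^sup>2 = a\<^sup>2 + 1" by (auto simp: a_def b_def)
  have "1 = (b - a) * (b + a)" using ab(4) by (simp add: power2_eq_square algebra_simps)
  also have "\<dots> \<le> (b - a) * (2 * b)" using ab by (intro mult_left_mono) auto
  finally have "1 / b \<le> 2 * (b - a)" using ab(3) by (simp add: field_simps)
  thus ?case using Suc by (simp add: a_def b_def)
qed simp

lemma disjoint_family_on_update:
  assumes "disjoint_family_on Q I" "\<And>i. i \<in> I \<Longrightarrow> Q i \<inter> R = {}" "t \<notin> I"
  shows "disjoint_family_on (Q(t := R)) (insert t I)"
  unfolding disjoint_family_on_def
proof (intro ballI impI)
  fix m n assume mn: "m \<in> insert t I" "n \<in> insert t I" "m \<noteq> n"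
  show "(Q(t := R)) m \<inter> (Q(t := R)) n = {}"
  proof (cases "m = t \<or> n = t")
    case True
    thus ?thesis using mn assms(2)[of m] assms(2)[of n] by (auto simp: Int_commute)
  next
    case False
    thus ?thesis using mn assms(1) by (simp add: disjoint_family_on_def)
  qed
qed

text \<open>
  Classes are split off one by one. A line that crosses the new class doubles its weight, so the total weight
  after all steps, with all weights $1$ at the start, bounds $2^c$ for every number $c$ of crossings. It grows slowly because each class is
  crossed by a small fraction of the current weight.
\<close>

lemma reweighted_partition:
  fixes L P :: "(real \<times> real) set" and w :: "real \<times> real \<Rightarrow> real"
  assumes "finite L" "finite P" and "\<And>l. l \<in> L \<Longrightarrow> 0 \<le> w l"
    and "\<And>p l. p \<in> P \<Longrightarrow> l \<in> L \<Longrightarrow> snd p \<noteq> at_x l (fst p)"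
    and "\<And>p g h. p \<in> P \<Longrightarrow> g \<in> L \<Longrightarrow> h \<in> L \<Longrightarrow> g \<noteq> h \<Longrightarrow> at_x g (fst p) \<noteq> at_x h (fst p)"
    and M: "1 \<le> M" "real (card P) \<le> M" "real (card L) + 2 \<le> M"
    and "1 \<le> s" "t * s \<le> card P"
  shows "\<exists>Q V. disjoint_family_on Q {..<t} \<and>
           (\<forall>i<t. Q i \<subseteq> P \<and> card (Q i) = s \<and> finite (V i) \<and> card (V i) \<le> 4 \<and> Q i \<subseteq> convex hull V i) \<and>
           (\<Sum>l\<in>L. w l * 2 ^ card {i. i < t \<and> splits l (V i)}) \<le>
             sum w L * (\<Prod>i<t. 1 + (16 + 16 * ln M) / sqrt (real (Suc i)))"
  using assms(2-5,7,9-)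
proof (induction t arbitrary: P w)
  case 0
  show ?case by (intro exI[of _ "\<lambda>_. {}"]) (simp add: disjoint_family_on_def)
next
  case (Suc t)
  define \<Lambda> where "\<Lambda> = 16 + 16 * ln M"
  have \<Lambda>: "\<Lambda> \<ge> 0" using M(1) by (simp add: \<Lambda>_def)
  have "\<exists>P' V. P' \<subseteq> P \<and> card P' = s \<and> finite V \<and> card V \<le> 4 \<and> P' \<subseteq> convex hull V \<and>
           sum w {l \<in> L. splits l V} \<le> sum w L * (\<Lambda> / sqrt (real (Suc t)))"
    unfolding \<Lambda>_def by (rule light_subset) (fact assms(1) Suc.prems M)+
  then obtain P' V' where PV: "P' \<subseteq> P" "card P' = s" "finite V'" "card V' \<le> 4" "P' \<subseteq> convex hull V'"
     "sum w {l \<in> L. splits l V'} \<le> sum w L * (\<Lambda> / sqrt (real (Suc t)))"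
    by blast
  define w' where "w' l = (if splits l V' then 2 * w l else w l)" for l
  have finP': "finite P'" using PV(1) Suc.prems(1) by (rule finite_subset)
  have cP: "card (P - P') = card P - s" using PV(1,2) finP' by (simp add: card_Diff_subset)
  have "\<exists>Q V. disjoint_family_on Q {..<t} \<and>
           (\<forall>i<t. Q i \<subseteq> P - P' \<and> card (Q i) = s \<and> finite (V i) \<and> card (V i) \<le> 4 \<and> Q i \<subseteq> convex hull V i) \<and>
           (\<Sum>l\<in>L. w' l * 2 ^ card {i. i < t \<and> splits l (V i)}) \<le>
             sum w' L * (\<Prod>i<t. 1 + \<Lambda> / sqrt (real (Suc i)))"
    unfolding \<Lambda>_def
  proof (rule Suc.IH)
    show "real (card (P - P')) \<le> M" using Suc.prems(5) cP by linarith
    show "t * s \<le> card (P - P')" using Suc.prems(7) cP by simp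
  qed (use Suc.prems in \<open>auto simp: w'_def\<close>)
  then obtain Q V where QV: "disjoint_family_on Q {..<t}"
    "\<forall>i<t. Q i \<subseteq> P - P' \<and> card (Q i) = s \<and> finite (V i) \<and> card (V i) \<le> 4 \<and> Q i \<subseteq> convex hull V i"
    "(\<Sum>l\<in>L. w' l * 2 ^ card {i. i < t \<and> splits l (V i)}) \<le>
             sum w' L * (\<Prod>i<t. 1 + \<Lambda> / sqrt (real (Suc i)))"
    by (elim exE conjE) (rule that, assumption+)
  note part = QV(2)[rule_format]
  define Q' V'' where "Q' = Q(t := P')" and "V'' = V(t := V')"
  have set: "{i. i < Suc t \<and> splits l (V'' i)} = {i. i < t \<and> splits l (V i)} \<union> (if splits l V' then {t} else {})" for l
    by (auto simp: V''_def less_Suc_eq)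
  have weight: "w l * 2 ^ card {i. i < Suc t \<and> splits l (V'' i)} = w' l * 2 ^ card {i. i < t \<and> splits l (V i)}" for l
    unfolding set w'_def by (simp add: card_insert_if)
  have "sum w' L = (\<Sum>l\<in>L. w l + (if splits l V' then w l else 0))"
    by (intro sum.cong) (auto simp: w'_def)
  also have "\<dots> = sum w L + sum w {l \<in> L. splits l V'}"
    using assms(1) by (simp add: sum.distrib sum.inter_filter)
  also have "\<dots> \<le> sum w L * (1 + \<Lambda> / sqrt (real (Suc t)))" using PV(6) by (simp add: algebra_simps)
  finally have W': "sum w' L \<le> sum w L * (1 + \<Lambda> / sqrt (real (Suc t)))" .
  have "(\<Sum>l\<in>L. w l * 2 ^ card {i. i < Suc t \<and> splits l (V'' i)}) \<le>
             sum w' L * (\<Prod>i<t. 1 + \<Lambda> / sqrt (real (Suc i)))"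
    unfolding weight by (rule QV(3))
  also have "\<dots> \<le> (sum w L * (1 + \<Lambda> / sqrt (real (Suc t)))) * (\<Prod>i<t. 1 + \<Lambda> / sqrt (real (Suc i)))"
    using W' \<Lambda> by (intro mult_right_mono prod_nonneg) auto
  also have "\<dots> = sum w L * (\<Prod>i<Suc t. 1 + \<Lambda> / sqrt (real (Suc i)))" by simp
  finally have 1: "(\<Sum>l\<in>L. w l * 2 ^ card {i. i < Suc t \<and> splits l (V'' i)}) \<le>
     sum w L * (\<Prod>i<Suc t. 1 + \<Lambda> / sqrt (real (Suc i)))" .
  have "Q i \<inter> P' = {}" if "i < t" for i using part[OF that] by blast
  hence 2: "disjoint_family_on Q' {..<Suc t}"
    using disjoint_family_on_update[OF QV(1), of P' t] by (simp add: Q'_def lessThan_Suc)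
  have 3: "\<forall>i<Suc t. Q' i \<subseteq> P \<and> card (Q' i) = s \<and> finite (V'' i) \<and> card (V'' i) \<le> 4 \<and> Q' i \<subseteq> convex hull V'' i"
    using part PV(1-5) unfolding Q'_def V''_def by (auto simp: less_Suc_eq)
  show ?case using 1 2 3 unfolding \<Lambda>_def by (intro exI[of _ Q'] exI[of _ V''] conjI)
qed

text \<open>
  The factor by which a line may exceed the optimal number $q$ of crossings.
\<close>

definition partition_log :: "real \<Rightarrow> real" where
  "partition_log M = 66 * (1 + ln M)"

text \<open>
  By \<open>reweighted_partition\<close>, $2^c \le M \prod_{i \le t} (1 + \Lambda / \sqrt i) \le M e^{2 \Lambda \sqrt t}$ for
  the number $c$ of full classes that a line crosses; taking logarithms bounds $c$. The points that are left over
  form one more class, with index $t$.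
\<close>

lemma simplicial_partition_lines:
  fixes L P :: "(real \<times> real) set"
  assumes fin: "finite L" "finite P"
    and off: "\<And>p l. p \<in> P \<Longrightarrow> l \<in> L \<Longrightarrow> snd p \<noteq> at_x l (fst p)"
    and gen: "\<And>p g h. p \<in> P \<Longrightarrow> g \<in> L \<Longrightarrow> h \<in> L \<Longrightarrow> g \<noteq> h \<Longrightarrow> at_x g (fst p) \<noteq> at_x h (fst p)"
    and M: "1 \<le> M" "real (card P) \<le> M" "real (card L) + 2 \<le> M"
    and s: "1 \<le> s" "1 \<le> q" "card P \<le> s * q\<^sup>2"
  shows "\<exists>t Q V. t \<le> q\<^sup>2 \<and> disjoint_family_on Q {..t} \<and> (\<Union>i\<le>t. Q i) = P \<and>
           (\<forall>i<t. card (Q i) = s) \<and> card (Q t) < s \<and>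
           (\<forall>i\<le>t. finite (V i) \<and> card (V i) \<le> 4 \<and> Q i \<subseteq> convex hull V i) \<and>
           (\<forall>l\<in>L. real (card {i. i \<le> t \<and> splits l (V i)}) \<le> partition_log M * q)"
proof -
  define t where "t = card P div s"
  define \<Lambda> where "\<Lambda> = 16 + 16 * ln M"
  have \<Lambda>: "\<Lambda> \<ge> 0" using M(1) by (simp add: \<Lambda>_def)
  have ts: "t * s \<le> card P" by (simp add: t_def)
  have "t \<le> (s * q\<^sup>2) div s" unfolding t_def using s(3) by (rule div_le_mono)
  hence tq: "t \<le> q\<^sup>2" using s(1) by simp
  have rest: "card P < s + t * s" using s(1) unfolding t_def
    by (metis Suc_le_eq One_nat_def add.commute dividend_less_div_times)
  have "\<exists>Q V. disjoint_family_on Q {..<t} \<and>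
           (\<forall>i<t. Q i \<subseteq> P \<and> card (Q i) = s \<and> finite (V i) \<and> card (V i) \<le> 4 \<and> Q i \<subseteq> convex hull V i) \<and>
           (\<Sum>l\<in>L. 1 * 2 ^ card {i. i < t \<and> splits l (V i)}) \<le>
             (\<Sum>l\<in>L. 1) * (\<Prod>i<t. 1 + \<Lambda> / sqrt (real (Suc i)))"
    unfolding \<Lambda>_def by (rule reweighted_partition[where w = "\<lambda>_. 1"]) (rule zero_le_one | fact fin off gen M s(1) ts)+
  then obtain Q V where QV: "disjoint_family_on Q {..<t}"
    "\<forall>i<t. Q i \<subseteq> P \<and> card (Q i) = s \<and> finite (V i) \<and> card (V i) \<le> 4 \<and> Q i \<subseteq> convex hull V i"
    "(\<Sum>l\<in>L. 1 * 2 ^ card {i. i < t \<and> splits l (V i)}) \<le>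
             (\<Sum>l\<in>L. 1) * (\<Prod>i<t. 1 + \<Lambda> / sqrt (real (Suc i)))"
    by (elim exE conjE) (rule that, assumption+)
  note part = QV(2)[rule_format]
  define R where "R = P - (\<Union>i<t. Q i)"
  have "finite R" using fin(2) by (simp add: R_def)
  then obtain VR where VR: "finite VR" "card VR \<le> 4" "R \<subseteq> convex hull VR" using four_point_hull by blast
  have finQ: "finite (Q i)" if "i < t" for i using part[OF that] fin(2) finite_subset by blast
  have "card (\<Union>i<t. Q i) = (\<Sum>i<t. card (Q i))"
    using finQ QV(1) by (intro card_UN_disjoint) (auto simp: disjoint_family_on_def)
  also have "\<dots> = t * s" using part by simp
  finally have cU: "card (\<Union>i<t. Q i) = t * s" .
  have UP: "(\<Union>i<t. Q i) \<subseteq> P" using part by blast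
  have "card R = card P - t * s"
    unfolding R_def using UP fin(2) finite_subset[OF UP fin(2)] by (simp add: card_Diff_subset cU)
  hence cR: "card R < s" using rest s(1) by linarith
  define Q' V' where "Q' = Q(t := R)" and "V' = V(t := VR)"
  have cross: "real (card {i. i \<le> t \<and> splits l (V' i)}) \<le> partition_log M * q" if l: "l \<in> L" for l
  proof -
    define c where "c = card {i. i < t \<and> splits l (V i)}"
    have "(2::real) ^ c \<le> (\<Sum>l\<in>L. 2 ^ card {i. i < t \<and> splits l (V i)})"
      unfolding c_def using l fin(1) by (intro member_le_sum) auto
    also have "\<dots> \<le> real (card L) * (\<Prod>i<t. 1 + \<Lambda> / sqrt (real (Suc i)))" using QV(3) by simp
    also have "\<dots> \<le> M * (\<Prod>i<t. exp (\<Lambda> * (1 / sqrt (real (Suc i)))))"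
      using M \<Lambda> exp_ge_add_one_self by (intro mult_mono prod_mono prod_nonneg conjI) (auto simp: add_nonneg_nonneg)
    also have "(\<Prod>i<t. exp (\<Lambda> * (1 / sqrt (real (Suc i))))) = exp (\<Lambda> * (\<Sum>i<t. 1 / sqrt (real (Suc i))))"
      by (simp only: exp_sum[OF finite_lessThan] sum_distrib_left)
    also have "M * \<dots> \<le> M * exp (\<Lambda> * (2 * sqrt (real t)))"
      using M(1) \<Lambda> sum_inverse_sqrt[of t] by (intro mult_left_mono iffD2[OF exp_le_cancel_iff]) auto
    also have "sqrt (real t) \<le> real q"
      using tq by (intro real_le_lsqrt) (auto simp flip: of_nat_power)
    hence "M * exp (\<Lambda> * (2 * sqrt (real t))) \<le> M * exp (\<Lambda> * (2 * real q))"
      using M(1) \<Lambda> by (intro mult_left_mono iffD2[OF exp_le_cancel_iff]) auto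
    finally have "(2::real) ^ c \<le> M * exp (\<Lambda> * (2 * real q))" .
    hence "ln (2 ^ c) \<le> ln (M * exp (\<Lambda> * (2 * real q)))" using M(1) by (subst ln_le_cancel_iff) auto
    hence "real c * ln 2 \<le> ln M + \<Lambda> * (2 * real q)" using M(1) by (simp add: ln_mult ln_realpow)
    moreover have "real c * (1/2) \<le> real c * ln 2" using ln2_ge_two_thirds by (intro mult_left_mono) auto
    ultimately have c: "real c \<le> 2 * ln M + 4 * \<Lambda> * real q" by (simp add: algebra_simps)
    have "{i. i \<le> t \<and> splits l (V' i)} \<subseteq> insert t {i. i < t \<and> splits l (V i)}" by (auto simp: V'_def)
    hence "card {i. i \<le> t \<and> splits l (V' i)} \<le> card (insert t {i. i < t \<and> splits l (V i)})"
      by (intro card_mono) auto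
    also have "\<dots> \<le> c + 1" by (simp add: c_def card_insert_if)
    finally have "real (card {i. i \<le> t \<and> splits l (V' i)}) \<le> 1 + 2 * ln M + 4 * \<Lambda> * real q" using c by linarith
    also have "\<dots> \<le> (2 + 2 * ln M) * real q + 4 * \<Lambda> * real q"
    proof -
      have "(2 + 2 * ln M) * 1 \<le> (2 + 2 * ln M) * real q" using s(2) M(1) by (intro mult_left_mono) auto
      thus ?thesis by simp
    qed
    also have "\<dots> = partition_log M * q" by (simp add: partition_log_def \<Lambda>_def algebra_simps)
    finally show ?thesis .
  qed
  have "Q i \<inter> R = {}" if "i < t" for i using that by (auto simp: R_def)
  hence "disjoint_family_on Q' {..t}"
    using disjoint_family_on_update[OF QV(1), of R t] by (simp add: Q'_def flip: lessThan_Suc_atMost lessThan_Suc)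
  moreover have "(\<Union>i\<le>t. Q' i) = P"
  proof -
    have "(\<Union>i\<le>t. Q' i) = Q' t \<union> (\<Union>i<t. Q' i)"
      by (metis UN_insert lessThan_Suc lessThan_Suc_atMost)
    also have "(\<Union>i<t. Q' i) = (\<Union>i<t. Q i)" by (simp add: Q'_def)
    finally show ?thesis using UP by (simp add: Q'_def R_def Un_absorb2)
  qed
  moreover have "\<forall>i<t. card (Q' i) = s" "card (Q' t) < s" using part cR by (simp_all add: Q'_def)
  moreover have "\<forall>i\<le>t. finite (V' i) \<and> card (V' i) \<le> 4 \<and> Q' i \<subseteq> convex hull V' i"
  proof (intro allI impI)
    fix i assume "i \<le> t"
    thus "finite (V' i) \<and> card (V' i) \<le> 4 \<and> Q' i \<subseteq> convex hull V' i"
      using part[of i] VR by (cases "i = t") (simp_all add: Q'_def V'_def)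
  qed
  moreover have "\<forall>l\<in>L. real (card {i. i \<le> t \<and> splits l (V' i)}) \<le> partition_log M * q"
    using cross by blast
  ultimately show ?thesis using tq by (intro exI[of _ t] exI[of _ Q'] exI[of _ V'] conjI)
qed

section \<open>Partitions for affine functionals\<close>

definition affine_functional :: "(real \<times> real \<Rightarrow> real) \<Rightarrow> bool" where
  "affine_functional f \<longleftrightarrow> (\<exists>a b c. \<forall>p. f p = a * fst p + b * snd p + c)"

definition sign_change :: "('a \<Rightarrow> real) \<Rightarrow> 'a set \<Rightarrow> bool" where
  "sign_change f V \<longleftrightarrow> \<not> (\<forall>v\<in>V. 0 \<le> f v) \<and> \<not> (\<forall>v\<in>V. f v < 0)"

lemma sign_change_convex_hull:
  assumes "affine_functional f" "Q \<subseteq> convex hull V" "sign_change f Q"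
  shows "sign_change f V"
proof -
  obtain a b c where f: "\<And>p. f p = a * fst p + b * snd p + c"
    using assms(1) by (auto simp: affine_functional_def)
  have eq: "f p = (a, b) \<bullet> p + c" for p by (simp add: f inner_prod_def)
  have "convex {p. 0 \<le> f p}" "convex {p. f p < 0}"
  proof -
    have "{p. 0 \<le> f p} = {p. (a, b) \<bullet> p \<ge> - c}" "{p. f p < 0} = {p. (a, b) \<bullet> p < - c}"
      unfolding eq by auto
    thus "convex {p. 0 \<le> f p}" "convex {p. f p < 0}"
      using convex_halfspace_ge convex_halfspace_lt by metis+
  qed
  hence "V \<subseteq> {p. 0 \<le> f p} \<Longrightarrow> convex hull V \<subseteq> {p. 0 \<le> f p}"
    "V \<subseteq> {p. f p < 0} \<Longrightarrow> convex hull V \<subseteq> {p. f p < 0}"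
    by (simp_all add: hull_minimal)
  thus ?thesis using assms(2,3) unfolding sign_change_def by blast
qed

text \<open>
  The shear $(x, y) \mapsto (x - \theta y, y)$ turns $a x + b y + c$ into
  $a x + (a \theta + b) y + c$. For all but finitely many $\theta$ no line becomes vertical, and no two
  different lines meet on the vertical line through a point of $P$: for given lines and a given point the latter is
  one linear equation for $\theta$, which is trivial only if the lines coincide. Coincidence of the sheared
  lines is what the conclusion of the implication expresses.
\<close>

lemma generic_shear:
  fixes a b c :: "'i \<Rightarrow> real" and P :: "(real \<times> real) set"
  assumes "finite I" "finite P"
    and nz: "\<And>i. i \<in> I \<Longrightarrow> a i \<noteq> 0 \<or> b i \<noteq> 0"
    and off: "\<And>i p. i \<in> I \<Longrightarrow> p \<in> P \<Longrightarrow> a i * fst p + b i * snd p + c i \<noteq> 0"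
  shows "\<exists>\<theta>. (\<forall>i\<in>I. a i * \<theta> + b i \<noteq> 0) \<and>
    (\<forall>p\<in>P. \<forall>i\<in>I. \<forall>j\<in>I.
        (a j * fst p + b j * snd p + c j) * (a i * \<theta> + b i) = (a i * fst p + b i * snd p + c i) * (a j * \<theta> + b j) \<longrightarrow>
        a i * (a j * \<theta> + b j) = a j * (a i * \<theta> + b i) \<and> c i * (a j * \<theta> + b j) = c j * (a i * \<theta> + b i))"
proof -
  define f where "f i p = a i * fst p + b i * snd p + c i" for i p
  define bad where "bad = (\<lambda>i. - b i / a i) ` I \<union>
    (\<lambda>(i, j, p). (f j p * b i - f i p * b j) / (f i p * a j - f j p * a i)) ` (I \<times> I \<times> P)"
  have "finite bad" using assms(1,2) by (simp add: bad_def)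
  then obtain \<theta> where \<theta>: "\<theta> \<notin> bad" using ex_new_if_finite[OF infinite_UNIV_char_0] by blast
  have 1: "a i * \<theta> + b i \<noteq> 0" if "i \<in> I" for i
  proof
    assume *: "a i * \<theta> + b i = 0"
    have "a i \<noteq> 0" using * nz[OF that] by auto
    hence "\<theta> = - b i / a i" using * by (simp add: field_simps)
    thus False using \<theta> that by (auto simp: bad_def)
  qed
  have 2: "a i * (a j * \<theta> + b j) = a j * (a i * \<theta> + b i) \<and> c i * (a j * \<theta> + b j) = c j * (a i * \<theta> + b i)"
    if mem: "p \<in> P" "i \<in> I" "j \<in> I" and eq: "f j p * (a i * \<theta> + b i) = f i p * (a j * \<theta> + b j)" for p i j
  proof -
    have lin: "\<theta> * (f i p * a j - f j p * a i) = f j p * b i - f i p * b j" using eq by (simp add: algebra_simps)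
    have "f i p * a j - f j p * a i = 0"
    proof (rule ccontr)
      assume "f i p * a j - f j p * a i \<noteq> 0"
      hence "\<theta> = (f j p * b i - f i p * b j) / (f i p * a j - f j p * a i)"
        using lin by (simp add: field_simps)
      thus False using \<theta> mem by (force simp: bad_def)
    qed
    hence A: "f i p * a j = f j p * a i" and B: "f i p * b j = f j p * b i" using lin by auto
    have "f i p * f j p = f j p * f i p" by simp
    hence "f i p * (a j * fst p + b j * snd p + c j) = f j p * (a i * fst p + b i * snd p + c i)"
      by (simp only: f_def)
    hence "(f i p * a j) * fst p + (f i p * b j) * snd p + f i p * c j
        = (f j p * a i) * fst p + (f j p * b i) * snd p + f j p * c i" by (simp add: algebra_simps)
    hence C: "f i p * c j = f j p * c i" by (simp add: A B)
    have n: "f i p \<noteq> 0" using off mem by (simp add: f_def)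
    have "f i p * (a i * (a j * \<theta> + b j)) = a i * \<theta> * (f i p * a j) + a i * (f i p * b j)" by (simp add: algebra_simps)
    also have "\<dots> = (f j p * a i) * (a i * \<theta> + b i)" unfolding A B by (simp add: algebra_simps)
    also have "\<dots> = f i p * (a j * (a i * \<theta> + b i))" unfolding A[symmetric] by simp
    finally have r1: "a i * (a j * \<theta> + b j) = a j * (a i * \<theta> + b i)" using n by simp
    have "f i p * (c i * (a j * \<theta> + b j)) = c i * \<theta> * (f i p * a j) + c i * (f i p * b j)" by (simp add: algebra_simps)
    also have "\<dots> = (f j p * c i) * (a i * \<theta> + b i)" unfolding A B by (simp add: algebra_simps)
    also have "\<dots> = f i p * (c j * (a i * \<theta> + b i))" unfolding C[symmetric] by simp
    finally have r2: "c i * (a j * \<theta> + b j) = c j * (a i * \<theta> + b i)" using n by simp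
    show ?thesis using r1 r2 by simp
  qed
  show ?thesis
    by (rule exI[of _ \<theta>]) (use 1 2 in \<open>simp add: f_def\<close>)
qed

text \<open>
  Apart from the passage to lines in general position, this is \<open>simplicial_partition_lines\<close>. That each class lies in
  the hull of four points is used to decide with finitely many conditions whether a functional has constant sign on a
  whole class.
\<close>

theorem simplicial_partition:
  fixes P :: "(real \<times> real) set" and f :: "'i \<Rightarrow> real \<times> real \<Rightarrow> real"
  assumes fin: "finite P" "finite I" and aff: "\<And>i. i \<in> I \<Longrightarrow> affine_functional (f i)"
    and off: "\<And>i p. i \<in> I \<Longrightarrow> p \<in> P \<Longrightarrow> f i p \<noteq> 0"
    and M: "1 \<le> M" "real (card P) \<le> M" "real (card I) + 2 \<le> M"
    and s: "1 \<le> s" "1 \<le> q" "card P \<le> s * q\<^sup>2"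
  shows "\<exists>t Q V. t \<le> q\<^sup>2 \<and> disjoint_family_on Q {..t} \<and> (\<Union>j\<le>t. Q j) = P \<and>
           (\<forall>j<t. card (Q j) = s) \<and> card (Q t) < s \<and>
           (\<forall>j\<le>t. finite (V j) \<and> card (V j) \<le> 4 \<and> Q j \<subseteq> convex hull V j) \<and>
           (\<forall>i\<in>I. real (card {j. j \<le> t \<and> sign_change (f i) (V j)}) \<le> partition_log M * q)"
proof -
  have "\<forall>i\<in>I. \<exists>a b c. \<forall>p. f i p = a * fst p + b * snd p + c" using aff by (simp add: affine_functional_def)
  then obtain a b c where abc: "\<And>i p. i \<in> I \<Longrightarrow> f i p = a i * fst p + b i * snd p + c i" by metis
  define I' where "I' = {i \<in> I. a i \<noteq> 0 \<or> b i \<noteq> 0}"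
  have finI': "finite I'" using fin by (simp add: I'_def)
  obtain \<theta> where \<theta>1: "\<And>i. i \<in> I' \<Longrightarrow> a i * \<theta> + b i \<noteq> 0"
    and \<theta>2: "\<And>p i j. p \<in> P \<Longrightarrow> i \<in> I' \<Longrightarrow> j \<in> I' \<Longrightarrow>
        f j p * (a i * \<theta> + b i) = f i p * (a j * \<theta> + b j) \<Longrightarrow>
        a i * (a j * \<theta> + b j) = a j * (a i * \<theta> + b i) \<and> c i * (a j * \<theta> + b j) = c j * (a i * \<theta> + b i)"
  proof -
    have "\<exists>\<theta>. (\<forall>i\<in>I'. a i * \<theta> + b i \<noteq> 0) \<and>
    (\<forall>p\<in>P. \<forall>i\<in>I'. \<forall>j\<in>I'.
        (a j * fst p + b j * snd p + c j) * (a i * \<theta> + b i) = (a i * fst p + b i * snd p + c i) * (a j * \<theta> + b j) \<longrightarrow>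
        a i * (a j * \<theta> + b j) = a j * (a i * \<theta> + b i) \<and> c i * (a j * \<theta> + b j) = c j * (a i * \<theta> + b i))"
      by (rule generic_shear[OF finI' fin(1)]) (use off abc in \<open>auto simp: I'_def\<close>)
    then obtain \<theta> where t: "\<forall>i\<in>I'. a i * \<theta> + b i \<noteq> 0"
    "\<forall>p\<in>P. \<forall>i\<in>I'. \<forall>j\<in>I'.
        (a j * fst p + b j * snd p + c j) * (a i * \<theta> + b i) = (a i * fst p + b i * snd p + c i) * (a j * \<theta> + b j) \<longrightarrow>
        a i * (a j * \<theta> + b j) = a j * (a i * \<theta> + b i) \<and> c i * (a j * \<theta> + b j) = c j * (a i * \<theta> + b i)"
      by (elim exE conjE)
    have t2: "a i * (a j * \<theta> + b j) = a j * (a i * \<theta> + b i) \<and> c i * (a j * \<theta> + b j) = c j * (a i * \<theta> + b i)"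
      if "p \<in> P" "i \<in> I'" "j \<in> I'" "f j p * (a i * \<theta> + b i) = f i p * (a j * \<theta> + b j)" for p i j
      using t(2)[rule_format, OF that(1-3)] that(4) abc[of i p] abc[of j p] that(2,3) by (simp add: I'_def)
    show ?thesis by (rule that[of \<theta>]) (use t(1) t2 in blast)+
  qed
  define line where "line i = (- a i / (a i * \<theta> + b i), - c i / (a i * \<theta> + b i))" for i
  define \<sigma> where "\<sigma> p = (fst p - \<theta> * snd p, snd p)" for p :: "real \<times> real"
  define \<tau> where "\<tau> p = (fst p + \<theta> * snd p, snd p)" for p :: "real \<times> real"
  have \<tau>\<sigma>: "\<tau> (\<sigma> p) = p" "\<sigma> (\<tau> p) = p" for p by (simp_all add: \<sigma>_def \<tau>_def)
  have lin: "linear \<tau>" by (intro linearI) (simp_all add: \<tau>_def algebra_simps)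
  have above: "f i (\<tau> v) = (a i * \<theta> + b i) * (snd v - at_x (line i) (fst v))" if "i \<in> I'" for i v
  proof -
    have "(a i * \<theta> + b i) * (snd v - at_x (line i) (fst v)) = (a i * \<theta> + b i) * snd v + a i * fst v + c i"
    proof -
      define d where "d = a i * \<theta> + b i"
      have "d \<noteq> 0" using \<theta>1[OF that] by (simp add: d_def)
      thus ?thesis unfolding at_x_def line_def d_def[symmetric] by (simp add: field_simps)
    qed
    thus ?thesis using that abc[of i] by (simp add: I'_def \<tau>_def algebra_simps)
  qed
  define L where "L = line ` I'"
  have finL: "finite L" using finI' by (simp add: L_def)
  have "card L \<le> card I'" unfolding L_def by (rule card_image_le[OF finI'])
  also have "\<dots> \<le> card I" using fin by (intro card_mono) (auto simp: I'_def)
  finally have cL: "real (card L) + 2 \<le> M" using M(3) by linarith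
  have inj: "inj_on \<sigma> A" "inj_on \<tau> A" for A by (metis inj_onI \<tau>\<sigma>)+
  have cP: "card (\<sigma> ` P) = card P" by (rule card_image[OF inj(1)])
  have finP: "finite (\<sigma> ` P)" using fin by simp
  have off': "snd p \<noteq> at_x l (fst p)" if p: "p \<in> \<sigma> ` P" and l: "l \<in> L" for p l
  proof
    assume *: "snd p = at_x l (fst p)"
    obtain p' where p': "p' \<in> P" "p = \<sigma> p'" using p by blast
    obtain i where i: "i \<in> I'" "l = line i" using l by (auto simp: L_def)
    have "f i p' = 0" using above[OF i(1), of p] * by (simp add: i p' \<tau>\<sigma>)
    thus False using off[of i p'] i(1) p'(1) by (simp add: I'_def)
  qed
  have gen': "at_x g (fst p) \<noteq> at_x h (fst p)" if p: "p \<in> \<sigma> ` P" and gh: "g \<in> L" "h \<in> L" "g \<noteq> h" for p g h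
  proof
    assume *: "at_x g (fst p) = at_x h (fst p)"
    obtain p' where p': "p' \<in> P" "p = \<sigma> p'" using p by blast
    obtain i where i: "i \<in> I'" "g = line i" using gh by (auto simp: L_def)
    obtain j where j: "j \<in> I'" "h = line j" using gh by (auto simp: L_def)
    have fi: "f i p' = (a i * \<theta> + b i) * (snd p - at_x g (fst p))" using above[OF i(1), of p] by (simp add: i p' \<tau>\<sigma>)
    have fj: "f j p' = (a j * \<theta> + b j) * (snd p - at_x g (fst p))" using above[OF j(1), of p] * by (simp add: j p' \<tau>\<sigma>)
    have "a i * (a j * \<theta> + b j) = a j * (a i * \<theta> + b i) \<and> c i * (a j * \<theta> + b j) = c j * (a i * \<theta> + b i)"
      by (rule \<theta>2[OF p'(1) i(1) j(1)]) (simp add: fi fj)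
    hence "line i = line j" using \<theta>1[OF i(1)] \<theta>1[OF j(1)] by (simp add: line_def frac_eq_eq)
    thus False using gh(3) i j by simp
  qed
  have "\<exists>t Q V. t \<le> q\<^sup>2 \<and> disjoint_family_on Q {..t} \<and> (\<Union>i\<le>t. Q i) = \<sigma> ` P \<and>
           (\<forall>i<t. card (Q i) = s) \<and> card (Q t) < s \<and>
           (\<forall>i\<le>t. finite (V i) \<and> card (V i) \<le> 4 \<and> Q i \<subseteq> convex hull V i) \<and>
           (\<forall>l\<in>L. real (card {i. i \<le> t \<and> splits l (V i)}) \<le> partition_log M * q)"
    by (rule simplicial_partition_lines) (fact finL finP off' gen' M(1) M(2)[folded cP] cL s(1,2) s(3)[folded cP])+
  then obtain t Q V where QV: "t \<le> q\<^sup>2" "disjoint_family_on Q {..t}" "(\<Union>i\<le>t. Q i) = \<sigma> ` P"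
           "\<forall>i<t. card (Q i) = s" "card (Q t) < s"
           "\<forall>i\<le>t. finite (V i) \<and> card (V i) \<le> 4 \<and> Q i \<subseteq> convex hull V i"
           "\<forall>l\<in>L. real (card {i. i \<le> t \<and> splits l (V i)}) \<le> partition_log M * q"
    by (elim exE conjE) (rule that, assumption+)
  have log0: "0 \<le> partition_log M * q" using M(1) by (simp add: partition_log_def)
  show ?thesis
  proof (rule exI[of _ t], rule exI[of _ "\<lambda>j. \<tau> ` Q j"], rule exI[of _ "\<lambda>j. \<tau> ` V j"], intro conjI)
    show "disjoint_family_on (\<lambda>j. \<tau> ` Q j) {..t}"
      using QV(2) inj(2)[of UNIV] unfolding disjoint_family_on_def by (simp add: image_Int[symmetric])
    have "(\<Union>j\<le>t. \<tau> ` Q j) = \<tau> ` (\<sigma> ` P)" unfolding QV(3)[symmetric] by (simp add: image_UN)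
    thus "(\<Union>j\<le>t. \<tau> ` Q j) = P" by (simp add: image_image \<tau>\<sigma>)
    show "\<forall>j<t. card (\<tau> ` Q j) = s" "card (\<tau> ` Q t) < s" using QV(4,5) by (simp_all add: card_image[OF inj(2)])
    show "\<forall>j\<le>t. finite (\<tau> ` V j) \<and> card (\<tau> ` V j) \<le> 4 \<and> \<tau> ` Q j \<subseteq> convex hull (\<tau> ` V j)"
      using QV(6) by (simp add: card_image[OF inj(2)] convex_hull_linear_image[OF lin, symmetric] image_mono)
    show "\<forall>i\<in>I. real (card {j. j \<le> t \<and> sign_change (f i) (\<tau> ` V j)}) \<le> partition_log M * q"
    proof
      fix i assume i: "i \<in> I"
      show "real (card {j. j \<le> t \<and> sign_change (f i) (\<tau> ` V j)}) \<le> partition_log M * q"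
      proof (cases "i \<in> I'")
        case True
        have "splits (line i) (V j)" if "sign_change (f i) (\<tau> ` V j)" for j
          using that \<theta>1[OF True] unfolding sign_change_def splits_def
          by (auto simp: above[OF True] zero_le_mult_iff mult_less_0_iff not_le not_less linorder_neq_iff dest: less_imp_le)
        hence "card {j. j \<le> t \<and> sign_change (f i) (\<tau> ` V j)} \<le> card {j. j \<le> t \<and> splits (line i) (V j)}"
          by (intro card_mono) auto
        also have "real \<dots> \<le> partition_log M * q" using QV(7) True by (simp add: L_def)
        finally show ?thesis by simp
      next
        case False
        hence "f i = (\<lambda>p. c i)" using abc[OF i] i by (auto simp: I'_def)
        hence "\<not> sign_change (f i) X" for X by (auto simp: sign_change_def)
        thus ?thesis using log0 by simp
      qed
    qed
  qed (fact QV(1))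
qed

text \<open>
  Adding a small constant to the functionals removes their zeros on $P$ and keeps their signs there, since the
  sign of $0$ counts as nonnegative.
\<close>

corollary partition_few_sign_changes:
  fixes P :: "(real \<times> real) set" and f :: "'i \<Rightarrow> real \<times> real \<Rightarrow> real"
  assumes fin: "finite P" "finite I" and aff: "\<And>i. i \<in> I \<Longrightarrow> affine_functional (f i)"
    and M: "1 \<le> M" "real (card P) \<le> M" "real (card I) + 2 \<le> M"
    and s: "1 \<le> s" "1 \<le> q" "card P \<le> s * q\<^sup>2"
  shows "\<exists>t Q. t \<le> q\<^sup>2 \<and> disjoint_family_on Q {..t} \<and> (\<Union>j\<le>t. Q j) = P \<and>
           (\<forall>j<t. card (Q j) = s) \<and> card (Q t) < s \<and>
           (\<forall>i\<in>I. real (card {j. j \<le> t \<and> sign_change (f i) (Q j)}) \<le> partition_log M * q)"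
proof -
  define N where "N = {(i, p) \<in> I \<times> P. f i p < 0}"
  have "finite N" unfolding N_def using fin by (intro finite_subset[OF _ finite_cartesian_product[of I P]]) auto
  then obtain \<eta> where \<eta>: "\<eta> > 0" "\<And>i p. i \<in> I \<Longrightarrow> p \<in> P \<Longrightarrow> f i p < 0 \<Longrightarrow> \<eta> \<le> - f i p / 2"
    using finite_positive_lower_bound[of N "\<lambda>(i, p). - f i p / 2"] by (fastforce simp: N_def)
  define g where "g i p = f i p + \<eta>" for i p
  have aff': "affine_functional (g i)" if i: "i \<in> I" for i
  proof -
    obtain a b c where "\<And>p. f i p = a * fst p + b * snd p + c"
      using aff[OF i] by (auto simp: affine_functional_def)
    hence "\<forall>p. g i p = a * fst p + b * snd p + (c + \<eta>)" by (simp add: g_def)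
    thus ?thesis unfolding affine_functional_def by blast
  qed
  have g: "0 < g i p" if "0 \<le> f i p" for i p using that \<eta>(1) by (simp add: g_def)
  have g': "g i p < 0" if "i \<in> I" "p \<in> P" "f i p < 0" for i p
    using \<eta>(2)[OF that] that(3) by (simp add: g_def)
  have off: "g i p \<noteq> 0" if "i \<in> I" "p \<in> P" for i p
    using g[of i p] g'[OF that] by (cases "0 \<le> f i p") auto
  have "\<exists>t Q V. t \<le> q\<^sup>2 \<and> disjoint_family_on Q {..t} \<and> (\<Union>j\<le>t. Q j) = P \<and>
           (\<forall>j<t. card (Q j) = s) \<and> card (Q t) < s \<and>
           (\<forall>j\<le>t. finite (V j) \<and> card (V j) \<le> 4 \<and> Q j \<subseteq> convex hull V j) \<and>
           (\<forall>i\<in>I. real (card {j. j \<le> t \<and> sign_change (g i) (V j)}) \<le> partition_log M * q)"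
    by (rule simplicial_partition) (fact fin aff' off M s)+
  then obtain t Q V where QV: "t \<le> q\<^sup>2" "disjoint_family_on Q {..t}" "(\<Union>j\<le>t. Q j) = P"
           "\<forall>j<t. card (Q j) = s" "card (Q t) < s"
           "\<forall>j\<le>t. finite (V j) \<and> card (V j) \<le> 4 \<and> Q j \<subseteq> convex hull V j"
           "\<forall>i\<in>I. real (card {j. j \<le> t \<and> sign_change (g i) (V j)}) \<le> partition_log M * q"
    by (elim exE conjE) (rule that, assumption+)
  have "\<forall>i\<in>I. real (card {j. j \<le> t \<and> sign_change (f i) (Q j)}) \<le> partition_log M * q"
  proof
    fix i assume i: "i \<in> I"
    have "sign_change (g i) (V j)" if j: "j \<le> t" "sign_change (f i) (Q j)" for j
    proof (rule sign_change_convex_hull[OF aff'[OF i]])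
      show "Q j \<subseteq> convex hull V j" using QV(6) j(1) by blast
      have QP: "Q j \<subseteq> P" using QV(3) j(1) by blast
      obtain v w where vw: "v \<in> Q j" "f i v < 0" "w \<in> Q j" "0 \<le> f i w"
        using j(2) by (auto simp: sign_change_def not_le not_less)
      have "g i v < 0" "0 < g i w" using g'[OF i _ vw(2)] g[OF vw(4)] vw(1) QP by blast+
      thus "sign_change (g i) (Q j)" using vw unfolding sign_change_def by force
    qed
    hence "card {j. j \<le> t \<and> sign_change (f i) (Q j)} \<le> card {j. j \<le> t \<and> sign_change (g i) (V j)}"
      by (intro card_mono) auto
    also have "real \<dots> \<le> partition_log M * q" using QV(7) i by simp
    finally show "real (card {j. j \<le> t \<and> sign_change (f i) (Q j)}) \<le> partition_log M * q" by simp
  qed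
  thus ?thesis using QV(1-5) by (intro exI[of _ t] exI[of _ Q] conjI)
qed

section \<open>Counting triples with partitions\<close>

definition mixed :: "('a \<Rightarrow> bool) \<Rightarrow> 'a set \<Rightarrow> bool" where
  "mixed R A \<longleftrightarrow> (\<exists>x\<in>A. R x) \<and> (\<exists>x\<in>A. \<not> R x)"

lemma sum_card_swap:
  assumes "finite J" "finite Y"
  shows "(\<Sum>j\<in>J. real (card {y \<in> Y. R j y})) = (\<Sum>y\<in>Y. real (card {j \<in> J. R j y}))"
proof -
  have "(\<Sum>j\<in>J. real (card {y \<in> Y. R j y})) = (\<Sum>j\<in>J. \<Sum>y\<in>Y. if R j y then 1 else 0)"
    using assms by (simp add: sum.inter_filter[symmetric])
  also have "\<dots> = (\<Sum>y\<in>Y. \<Sum>j\<in>J. if R j y then 1 else 0)" by (rule sum.swap)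
  also have "\<dots> = (\<Sum>y\<in>Y. real (card {j \<in> J. R j y}))"
    using assms by (simp add: sum.inter_filter[symmetric])
  finally show ?thesis .
qed

lemma card_Collect_bex_le:
  assumes "finite A" "finite Y" "\<And>y. y \<in> Y \<Longrightarrow> real (card {x \<in> A. R x y}) \<le> B" "0 \<le> B" "card Y \<le> m"
  shows "real (card {x \<in> A. \<exists>y\<in>Y. R x y}) \<le> m * B"
proof -
  have "{x \<in> A. \<exists>y\<in>Y. R x y} = (\<Union>y\<in>Y. {x \<in> A. R x y})" by blast
  hence "card {x \<in> A. \<exists>y\<in>Y. R x y} \<le> (\<Sum>y\<in>Y. card {x \<in> A. R x y})"
    using card_UN_le[OF assms(2)] by simp
  hence "real (card {x \<in> A. \<exists>y\<in>Y. R x y}) \<le> (\<Sum>y\<in>Y. real (card {x \<in> A. R x y}))"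
    by (simp flip: of_nat_sum)
  also have "\<dots> \<le> (\<Sum>y\<in>Y. B)" using assms(3) by (rule sum_mono)
  also have "\<dots> \<le> m * B" using assms(4,5) by (simp add: mult_right_mono)
  finally show ?thesis .
qed

text \<open>
  On a class where $G$ is not mixed for $y$, either no pair counts or the whole class does. All later bounds
  estimate the two sums on the right.
\<close>

lemma card_pairs_by_parts:
  assumes "finite J" "finite Y" "\<And>j. j \<in> J \<Longrightarrow> finite (Q j)" "X \<subseteq> (\<Union>j\<in>J. Q j)"
  shows "real (card {(x, y). x \<in> X \<and> y \<in> Y \<and> G x y}) \<le>
    (\<Sum>j\<in>J. real (card {(x, y). x \<in> Q j \<and> y \<in> {y \<in> Y. mixed (\<lambda>x. G x y) (Q j)} \<and> G x y})) +
    (\<Sum>j\<in>J. real (card (Q j) * card {y \<in> Y. \<forall>x\<in>Q j. G x y}))"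
proof -
  define U where "U j = {(x, y). x \<in> Q j \<and> y \<in> {y \<in> Y. mixed (\<lambda>x. G x y) (Q j)} \<and> G x y}" for j
  define W where "W j = Q j \<times> {y \<in> Y. \<forall>x\<in>Q j. G x y}" for j
  have fin: "finite (U j)" "finite (W j)" if "j \<in> J" for j
  proof -
    show "finite (W j)" using assms(2) assms(3)[OF that] by (simp add: W_def)
    have "U j \<subseteq> Q j \<times> Y" by (auto simp: U_def)
    thus "finite (U j)" using assms(2) assms(3)[OF that] finite_subset by blast
  qed
  have sub: "{(x, y). x \<in> X \<and> y \<in> Y \<and> G x y} \<subseteq> (\<Union>j\<in>J. U j \<union> W j)"
  proof
    fix z assume "z \<in> {(x, y). x \<in> X \<and> y \<in> Y \<and> G x y}"
    then obtain x y where z: "z = (x, y)" "x \<in> X" "y \<in> Y" "G x y" by blast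
    then obtain j where j: "j \<in> J" "x \<in> Q j" using assms(4) by blast
    have "z \<in> U j \<union> W j" using z j by (auto simp: U_def W_def mixed_def)
    thus "z \<in> (\<Union>j\<in>J. U j \<union> W j)" using j(1) by blast
  qed
  have "card {(x, y). x \<in> X \<and> y \<in> Y \<and> G x y} \<le> card (\<Union>j\<in>J. U j \<union> W j)"
    using assms(1) fin by (intro card_mono[OF _ sub]) auto
  also have "\<dots> \<le> (\<Sum>j\<in>J. card (U j \<union> W j))" by (rule card_UN_le[OF assms(1)])
  also have "\<dots> \<le> (\<Sum>j\<in>J. card (U j) + card (W j))" by (intro sum_mono card_Un_le)
  finally have "real (card {(x, y). x \<in> X \<and> y \<in> Y \<and> G x y}) \<le> real (\<Sum>j\<in>J. card (U j) + card (W j))"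
    by (simp only: of_nat_le_iff)
  thus ?thesis by (simp add: U_def W_def sum.distrib card_cartesian_product)
qed

text \<open>
  Cut $Y$ into pieces of size $g$.
\<close>

lemma subadditive_bound:
  fixes f :: "'a set \<Rightarrow> real"
  assumes "finite Y" "1 \<le> g" "0 \<le> c"
    and sub: "\<And>A B. A \<subseteq> Y \<Longrightarrow> B \<subseteq> Y \<Longrightarrow> f (A \<union> B) \<le> f A + f B"
    and small: "\<And>A. A \<subseteq> Y \<Longrightarrow> card A \<le> g \<Longrightarrow> f A \<le> c"
  shows "f Y \<le> c * (real (card Y) / real g + 1)"
proof -
  have "f A \<le> c * (real (card A) / real g + 1)" if "A \<subseteq> Y" for A
    using that
  proof (induction "card A" arbitrary: A rule: less_induct)
    case less
    show ?case
    proof (cases "card A \<le> g")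
      case True
      have "c * 1 \<le> c * (real (card A) / real g + 1)" using assms(3) by (intro mult_left_mono) auto
      thus ?thesis using small[OF less.prems True] by simp
    next
      case False
      then obtain B where B: "B \<subseteq> A" "card B = g" "finite B" using obtain_subset_with_card_n[of g A] by auto
      have c: "card (A - B) = card A - g" using B by (simp add: card_Diff_subset)
      have "f (A - B) \<le> c * (real (card (A - B)) / real g + 1)"
        using less.hyps[of "A - B"] less.prems c False assms(2) by auto
      also have "\<dots> = c * (real (card A) / real g)"
        using c False assms(2) by (simp add: of_nat_diff field_simps)
      finally have "f (A - B) \<le> c * (real (card A) / real g)" .
      moreover have "f B \<le> c" using small[of B] B less.prems by auto
      moreover have "f A \<le> f B + f (A - B)"
      proof -
        have "B \<union> (A - B) = A" using B(1) by blast
        thus ?thesis using sub[of B "A - B"] B(1) less.prems by (metis Diff_subset order_trans)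
      qed
      ultimately show ?thesis by (simp add: algebra_simps)
    qed
  qed
  thus ?thesis by simp
qed

lemma card_pairs_subadditive:
  assumes "finite X" "finite Y" "A \<subseteq> Y" "B \<subseteq> Y"
  shows "real (card {(x, y). x \<in> X \<and> y \<in> A \<union> B \<and> G x y}) \<le>
     real (card {(x, y). x \<in> X \<and> y \<in> A \<and> G x y}) + real (card {(x, y). x \<in> X \<and> y \<in> B \<and> G x y})"
proof -
  have "{(x, y). x \<in> X \<and> y \<in> A \<union> B \<and> G x y} =
    {(x, y). x \<in> X \<and> y \<in> A \<and> G x y} \<union> {(x, y). x \<in> X \<and> y \<in> B \<and> G x y}" by blast
  thus ?thesis using card_Un_le[of "{(x, y). x \<in> X \<and> y \<in> A \<and> G x y}" "{(x, y). x \<in> X \<and> y \<in> B \<and> G x y}"]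
    by (simp flip: of_nat_add)
qed

lemma card_pairs_le_times:
  assumes "finite X" "finite Y" "card X \<le> m"
  shows "real (card {(x, y). x \<in> X \<and> y \<in> Y \<and> G x y}) \<le> real m * real (card Y)"
proof -
  have "card {(x, y). x \<in> X \<and> y \<in> Y \<and> G x y} \<le> card (X \<times> Y)"
    using assms by (intro card_mono) auto
  also have "\<dots> \<le> m * card Y" unfolding card_cartesian_product using assms(3) by (rule mult_le_mono1)
  finally show ?thesis by (simp flip: of_nat_mult)
qed

text \<open>
  The combinatorial content of the problem. The parameter $\kappa$ stands for the logarithmic loss in
  the partition theorem. All class sizes below are powers of $w$, so that the numbers of classes are
  squares and crossing numbers need no square roots. The assumption $u \le w$ makes a class of size $w$
  large enough to use that there are no complete boxes.
\<close>

locale partitionable_triples =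
  fixes S :: "'a set" and E :: "'a \<Rightarrow> 'a \<Rightarrow> 'a \<Rightarrow> bool" and u w :: nat and \<kappa> :: real
  assumes finS: "finite S" and cardS: "card S \<le> w ^ 5"
    and u1: "1 \<le> u" and uw: "u \<le> w" and \<kappa>1: "1 \<le> \<kappa>"
    and sym12: "\<And>a b c. a \<in> S \<Longrightarrow> b \<in> S \<Longrightarrow> c \<in> S \<Longrightarrow> E a b c = E b a c"
    and sym23: "\<And>a b c. a \<in> S \<Longrightarrow> b \<in> S \<Longrightarrow> c \<in> S \<Longrightarrow> E a b c = E a c b"
    and no_box: "\<And>A B C. A \<subseteq> S \<Longrightarrow> B \<subseteq> S \<Longrightarrow> C \<subseteq> S \<Longrightarrow> u \<le> card A \<Longrightarrow> u \<le> card B \<Longrightarrow> u \<le> card C \<Longrightarrow>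
      \<exists>a\<in>A. \<exists>b\<in>B. \<exists>c\<in>C. \<not> E a b c"
    and partition: "\<And>X s q. X \<subseteq> S \<Longrightarrow> 1 \<le> s \<Longrightarrow> 1 \<le> q \<Longrightarrow> card X \<le> s * q\<^sup>2 \<Longrightarrow>
      \<exists>t Q. t \<le> q\<^sup>2 \<and> (\<Union>j\<le>t. Q j) = X \<and> (\<forall>j<t. card (Q j) = s) \<and> card (Q t) < s \<and>
        (\<forall>b\<in>S. \<forall>c\<in>S. real (card {j \<in> {..t}. mixed (\<lambda>x. E x b c) (Q j)}) \<le> \<kappa> * q)"
begin

lemma w1: "1 \<le> w" using u1 uw by simp

lemma fin_sub: "X \<subseteq> S \<Longrightarrow> finite X" using finS finite_subset by blast

lemma partition_common:
  assumes "A \<subseteq> S" "card A = u" "X \<subseteq> S" "1 \<le> s" "1 \<le> q" "card X \<le> s * q\<^sup>2"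
  shows "\<exists>t Q. t \<le> q\<^sup>2 \<and> (\<Union>j\<le>t. Q j) = X \<and> (\<forall>j<t. card (Q j) = s) \<and> card (Q t) < s \<and>
        (\<forall>y\<in>S. real (card {j \<in> {..t}. mixed (\<lambda>x. \<forall>a\<in>A. E a x y) (Q j)}) \<le> u * \<kappa> * q)"
proof -
  obtain t Q where Q: "t \<le> q\<^sup>2" "(\<Union>j\<le>t. Q j) = X" "\<forall>j<t. card (Q j) = s" "card (Q t) < s"
    "\<forall>b\<in>S. \<forall>c\<in>S. real (card {j \<in> {..t}. mixed (\<lambda>x. E x b c) (Q j)}) \<le> \<kappa> * q"
    using partition[OF assms(3-6)] by (elim exE conjE) (rule that, assumption+)
  have finA: "finite A" using assms(1) by (rule fin_sub)
  have "real (card {j \<in> {..t}. mixed (\<lambda>x. \<forall>a\<in>A. E a x y) (Q j)}) \<le> u * \<kappa> * q" if y: "y \<in> S" for y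
  proof -
    have "{j \<in> {..t}. mixed (\<lambda>x. \<forall>a\<in>A. E a x y) (Q j)} \<subseteq> {j \<in> {..t}. \<exists>a\<in>A. mixed (\<lambda>x. E x a y) (Q j)}"
    proof safe
      fix j assume j: "j \<le> t" "mixed (\<lambda>x. \<forall>a\<in>A. E a x y) (Q j)"
      then obtain x x' a where x: "x \<in> Q j" "\<forall>a\<in>A. E a x y" "x' \<in> Q j" "a \<in> A" "\<not> E a x' y"
        by (auto simp: mixed_def)
      have "Q j \<subseteq> S" using Q(2) j assms(3) by blast
      hence "E x a y" "\<not> E x' a y" using x y assms(1) sym12 by blast+
      hence "mixed (\<lambda>x. E x a y) (Q j)" using x by (auto simp: mixed_def)
      thus "\<exists>a\<in>A. mixed (\<lambda>x. E x a y) (Q j)" using x(4) by blast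
    qed
    hence "card {j \<in> {..t}. mixed (\<lambda>x. \<forall>a\<in>A. E a x y) (Q j)} \<le> card {j \<in> {..t}. \<exists>a\<in>A. mixed (\<lambda>x. E x a y) (Q j)}"
      by (intro card_mono) auto
    also have "real \<dots> \<le> real u * (\<kappa> * q)"
    proof (rule card_Collect_bex_le[OF _ finA])
      show "real (card {j \<in> {..t}. mixed (\<lambda>x. E x a y) (Q j)}) \<le> \<kappa> * q" if "a \<in> A" for a
        using Q(5) that y assms(1) by blast
    qed (use assms(2) \<kappa>1 in auto)
    finally show ?thesis by (simp add: mult.assoc)
  qed
  thus ?thesis using Q(1-4) by (intro exI[of _ t] exI[of _ Q] conjI ballI)
qed

text \<open>
  Otherwise $A$, $B$ and the set of common neighbours would form a complete box.
\<close>

lemma few_common: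
  assumes "A \<subseteq> S" "card A = u" "B \<subseteq> S" "u \<le> card B" "Y \<subseteq> S"
  shows "card {y \<in> Y. \<forall>x\<in>B. \<forall>a\<in>A. E a x y} < u"
proof (rule ccontr)
  assume "\<not> ?thesis"
  hence "\<exists>a\<in>A. \<exists>b\<in>B. \<exists>c\<in>{y \<in> Y. \<forall>x\<in>B. \<forall>a\<in>A. E a x y}. \<not> E a b c"
    using assms by (intro no_box) auto
  thus False by blast
qed

text \<open>
  The larger side is partitioned into classes of size $u$. Each $y$ is mixed on about $w$ of these, and a
  class has fewer than $u$ common neighbours.
\<close>

lemma small_bipartite_bound:
  assumes A: "A \<subseteq> S" "card A = u" and Y: "Y \<subseteq> S" "card Y \<le> w" and Z: "Z \<subseteq> S" "card Z \<le> w\<^sup>2"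
  shows "real (card {(y, z). y \<in> Y \<and> z \<in> Z \<and> (\<forall>a\<in>A. E a y z)}) \<le> 3 * u\<^sup>2 * \<kappa> * w\<^sup>2"
proof -
  have cZ: "card Z \<le> u * w\<^sup>2" using mult_le_mono[OF u1 Z(2)] by simp
  obtain t Q where Q: "t \<le> w\<^sup>2" "(\<Union>j\<le>t. Q j) = Z" "\<forall>j<t. card (Q j) = u" "card (Q t) < u"
    "\<forall>y\<in>S. real (card {j \<in> {..t}. mixed (\<lambda>x. \<forall>a\<in>A. E a x y) (Q j)}) \<le> u * \<kappa> * w"
    using partition_common[OF A Z(1) u1 w1 cZ] by (elim exE conjE) (rule that, assumption+)
  have QS: "Q j \<subseteq> S" if "j \<le> t" for j using Q(2) Z(1) that by blast
  have finQ: "finite (Q j)" if "j \<le> t" for j using QS[OF that] by (rule fin_sub)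
  have cQ: "card (Q j) \<le> u" if "j \<le> t" for j using Q(3,4) that by (cases "j = t") auto
  have finY: "finite Y" using Y(1) by (rule fin_sub)
  define G where "G z y \<longleftrightarrow> (\<forall>a\<in>A. E a z y)" for z y
  have flip: "card {(y, z). y \<in> Y \<and> z \<in> Z \<and> (\<forall>a\<in>A. E a y z)} = card {(z, y). z \<in> Z \<and> y \<in> Y \<and> G z y}"
  proof -
    have "{(z, y). z \<in> Z \<and> y \<in> Y \<and> G z y} = prod.swap ` {(y, z). y \<in> Y \<and> z \<in> Z \<and> (\<forall>a\<in>A. E a y z)}"
      using sym23 A(1) Y(1) Z(1) unfolding G_def by (auto simp: image_iff) blast+
    thus ?thesis by (simp add: card_image)
  qed
  have "real (card {(z, y). z \<in> Z \<and> y \<in> Y \<and> G z y}) \<le>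
    (\<Sum>j\<le>t. real (card {(z, y). z \<in> Q j \<and> y \<in> {y \<in> Y. mixed (\<lambda>z. G z y) (Q j)} \<and> G z y})) +
    (\<Sum>j\<le>t. real (card (Q j) * card {y \<in> Y. \<forall>z\<in>Q j. G z y}))"
    using finY finQ Q(2) by (intro card_pairs_by_parts) auto
  also have "\<dots> \<le> u * (w * (u * \<kappa> * w)) + (u\<^sup>2 * w\<^sup>2 + u * w)"
  proof (rule add_mono)
    have "(\<Sum>j\<le>t. real (card {(z, y). z \<in> Q j \<and> y \<in> {y \<in> Y. mixed (\<lambda>z. G z y) (Q j)} \<and> G z y}))
        \<le> (\<Sum>j\<le>t. u * real (card {y \<in> Y. mixed (\<lambda>z. G z y) (Q j)}))"
    proof (rule sum_mono)
      fix j assume j: "j \<in> {..t}"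
      show "real (card {(z, y). z \<in> Q j \<and> y \<in> {y \<in> Y. mixed (\<lambda>z. G z y) (Q j)} \<and> G z y})
          \<le> u * real (card {y \<in> Y. mixed (\<lambda>z. G z y) (Q j)})"
        using finQ finY cQ j by (intro card_pairs_le_times) auto
    qed
    also have "\<dots> = u * (\<Sum>y\<in>Y. real (card {j \<in> {..t}. mixed (\<lambda>z. G z y) (Q j)}))"
      by (simp only: sum_card_swap[OF finite_atMost finY] flip: sum_distrib_left)
    also have "\<dots> \<le> u * (\<Sum>y\<in>Y. u * \<kappa> * w)"
      using Q(5) Y(1) unfolding G_def by (intro mult_left_mono sum_mono) auto
    also have "\<dots> \<le> u * (w * (u * \<kappa> * w))" using Y(2) \<kappa>1 by (auto intro!: mult_left_mono mult_right_mono)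
    finally show "(\<Sum>j\<le>t. real (card {(z, y). z \<in> Q j \<and> y \<in> {y \<in> Y. mixed (\<lambda>z. G z y) (Q j)} \<and> G z y}))
      \<le> u * (w * (u * \<kappa> * w))" .
    have "(\<Sum>j\<le>t. card (Q j) * card {y \<in> Y. \<forall>z\<in>Q j. G z y}) =
        (\<Sum>j<t. card (Q j) * card {y \<in> Y. \<forall>z\<in>Q j. G z y}) + card (Q t) * card {y \<in> Y. \<forall>z\<in>Q t. G z y}"
      by (simp add: lessThan_Suc_atMost[symmetric])
    also have "\<dots> \<le> (\<Sum>j<t. u * u) + u * w"
    proof (intro add_mono sum_mono mult_le_mono)
      fix j assume j: "j \<in> {..<t}"
      show "card (Q j) \<le> u" using cQ j by simp
      show "card {y \<in> Y. \<forall>z\<in>Q j. G z y} \<le> u"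
        using few_common[OF A QS, of j Y] Q(3) j Y(1) unfolding G_def by simp
    next
      show "card (Q t) \<le> u" using cQ by simp
      have "card {y \<in> Y. \<forall>z\<in>Q t. G z y} \<le> card Y" using finY by (intro card_mono) auto
      thus "card {y \<in> Y. \<forall>z\<in>Q t. G z y} \<le> w" using Y(2) by linarith
    qed
    also have "\<dots> \<le> w\<^sup>2 * (u * u) + u * w" using Q(1) by simp
    finally have "real (\<Sum>j\<le>t. card (Q j) * card {y \<in> Y. \<forall>z\<in>Q j. G z y}) \<le> real (w\<^sup>2 * (u * u) + u * w)"
      by (simp only: of_nat_le_iff)
    thus "(\<Sum>j\<le>t. real (card (Q j) * card {y \<in> Y. \<forall>z\<in>Q j. G z y})) \<le> u\<^sup>2 * w\<^sup>2 + u * w"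
      by (simp add: power2_eq_square mult_ac)
  qed
  also have "\<dots> \<le> 3 * u\<^sup>2 * \<kappa> * w\<^sup>2"
  proof -
    have "(real u)\<^sup>2 * (real w)\<^sup>2 * 1 \<le> (real u)\<^sup>2 * (real w)\<^sup>2 * \<kappa>" using \<kappa>1 by (intro mult_left_mono) auto
    moreover have "real (u * w) * 1 \<le> real (u * w) * real (u * w)" 
      using u1 w1 by (intro mult_left_mono) (auto simp: Suc_le_eq simp flip: of_nat_mult)
    ultimately show ?thesis by (simp add: power2_eq_square algebra_simps)
  qed
  finally show ?thesis by (simp add: flip)
qed

text \<open>
  The side $Y$ is partitioned into $w^2$ classes of size $w$. A point $z$ is mixed on about $w$ of them, so a class has
  about $w^2$ mixed points on average, to which \<open>small_bipartite_bound\<close> applies. The non-mixed part is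
  small because a class of size $w \ge u$ has fewer than $u$ common neighbours.
\<close>

lemma bipartite_bound:
  assumes A: "A \<subseteq> S" "card A = u" and Y: "Y \<subseteq> S" "card Y \<le> w ^ 3" and Z: "Z \<subseteq> S" "card Z \<le> w ^ 3"
  shows "real (card {(y, z). y \<in> Y \<and> z \<in> Z \<and> (\<forall>a\<in>A. E a y z)}) \<le> 11 * u ^ 3 * \<kappa>\<^sup>2 * w ^ 4"
proof -
  have cY: "card Y \<le> w * w\<^sup>2" using Y(2) by (simp add: power2_eq_square power3_eq_cube)
  obtain t Q where Q: "t \<le> w\<^sup>2" "(\<Union>j\<le>t. Q j) = Y" "\<forall>j<t. card (Q j) = w" "card (Q t) < w"
    "\<forall>y\<in>S. real (card {j \<in> {..t}. mixed (\<lambda>x. \<forall>a\<in>A. E a x y) (Q j)}) \<le> u * \<kappa> * w"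
    using partition_common[OF A Y(1) w1 w1 cY] by (elim exE conjE) (rule that, assumption+)
  have QS: "Q j \<subseteq> S" if "j \<le> t" for j using Q(2) Y(1) that by blast
  have finQ: "finite (Q j)" if "j \<le> t" for j using QS[OF that] by (rule fin_sub)
  have cQ: "card (Q j) \<le> w" if "j \<le> t" for j using Q(3,4) that by (cases "j = t") auto
  have finZ: "finite Z" using Z(1) by (rule fin_sub)
  define G where "G y z \<longleftrightarrow> (\<forall>a\<in>A. E a y z)" for y z
  define c where "c = 3 * u\<^sup>2 * \<kappa>"
  have c0: "0 \<le> c" using \<kappa>1 by (simp add: c_def)
  define ZM where "ZM j = {z \<in> Z. mixed (\<lambda>y. G y z) (Q j)}" for j
  have "real (card {(y, z). y \<in> Y \<and> z \<in> Z \<and> G y z}) \<le>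
    (\<Sum>j\<le>t. real (card {(y, z). y \<in> Q j \<and> z \<in> ZM j \<and> G y z})) +
    (\<Sum>j\<le>t. real (card (Q j) * card {z \<in> Z. \<forall>y\<in>Q j. G y z}))"
    unfolding ZM_def using finZ finQ Q(2) by (intro card_pairs_by_parts) auto
  also have "\<dots> \<le> c * (u * \<kappa> + 2) * w ^ 4 + 2 * u * w ^ 4"
  proof (rule add_mono)
    have "(\<Sum>j\<le>t. real (card {(y, z). y \<in> Q j \<and> z \<in> ZM j \<and> G y z}))
        \<le> (\<Sum>j\<le>t. c * w\<^sup>2 * (real (card (ZM j)) / real (w\<^sup>2) + 1))"
    proof (rule sum_mono)
      fix j assume j: "j \<in> {..t}"
      have ZMS: "ZM j \<subseteq> S" using Z(1) by (auto simp: ZM_def)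
      show "real (card {(y, z). y \<in> Q j \<and> z \<in> ZM j \<and> G y z}) \<le> c * w\<^sup>2 * (real (card (ZM j)) / real (w\<^sup>2) + 1)"
      proof (rule subadditive_bound[where f = "\<lambda>B. real (card {(y, z). y \<in> Q j \<and> z \<in> B \<and> G y z})"])
        show finZM: "finite (ZM j)" using ZMS by (rule fin_sub)
        show "1 \<le> w\<^sup>2" using w1 by simp
        show "0 \<le> c * w\<^sup>2" using c0 by simp
        show "real (card {(y, z). y \<in> Q j \<and> z \<in> B \<union> C \<and> G y z}) \<le>
          real (card {(y, z). y \<in> Q j \<and> z \<in> B \<and> G y z}) + real (card {(y, z). y \<in> Q j \<and> z \<in> C \<and> G y z})"
          if "B \<subseteq> ZM j" "C \<subseteq> ZM j" for B C
          using finQ j finZM that by (intro card_pairs_subadditive[of _ "ZM j"]) auto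
        show "real (card {(y, z). y \<in> Q j \<and> z \<in> B \<and> G y z}) \<le> c * w\<^sup>2"
          if "B \<subseteq> ZM j" "card B \<le> w\<^sup>2" for B
          using small_bipartite_bound[OF A QS cQ _ that(2), of j] that(1) j ZMS unfolding G_def c_def by auto
      qed
    qed
    also have "\<dots> = c * (\<Sum>j\<le>t. real (card (ZM j)) + w\<^sup>2)"
      unfolding sum_distrib_left using w1 by (intro sum.cong refl) (simp add: field_simps)
    also have "(\<Sum>j\<le>t. real (card (ZM j)) + w\<^sup>2) = (\<Sum>z\<in>Z. real (card {j \<in> {..t}. mixed (\<lambda>y. G y z) (Q j)})) + (real t + 1) * w\<^sup>2"
      using sum_card_swap[of "{..t}" Z "\<lambda>j z. mixed (\<lambda>y. G y z) (Q j)"] finZ by (simp add: sum.distrib ZM_def)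
    also have "c * \<dots> \<le> c * (real (w ^ 3) * (u * \<kappa> * w) + (real (w\<^sup>2) + real (w\<^sup>2)) * real (w\<^sup>2))"
    proof -
      have "(\<Sum>z\<in>Z. real (card {j \<in> {..t}. mixed (\<lambda>y. G y z) (Q j)})) \<le> (\<Sum>z\<in>Z. u * \<kappa> * w)"
        using Q(5) Z(1) unfolding G_def by (intro sum_mono) auto
      also have "\<dots> = real (card Z) * (u * \<kappa> * w)" by simp
      also have "\<dots> \<le> real (w ^ 3) * (u * \<kappa> * w)"
        using Z(2) \<kappa>1 by (intro mult_right_mono) (simp_all only: of_nat_le_iff, simp)
      finally have "(\<Sum>z\<in>Z. real (card {j \<in> {..t}. mixed (\<lambda>y. G y z) (Q j)})) \<le> real (w ^ 3) * (u * \<kappa> * w)" .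
      moreover have "real t \<le> real (w\<^sup>2)" using Q(1) by (simp only: of_nat_le_iff)
      moreover have "1 \<le> real (w\<^sup>2)" "0 \<le> real (w\<^sup>2)" using w1 by simp_all
      ultimately show ?thesis using c0 by (intro mult_left_mono add_mono mult_right_mono) assumption+
    qed
    also have "\<dots> = c * (u * \<kappa> + 2) * w ^ 4" by (simp add: power2_eq_square power3_eq_cube power4_eq_xxxx algebra_simps)
    finally show "(\<Sum>j\<le>t. real (card {(y, z). y \<in> Q j \<and> z \<in> ZM j \<and> G y z})) \<le> c * (u * \<kappa> + 2) * w ^ 4" .
    have "(\<Sum>j\<le>t. card (Q j) * card {z \<in> Z. \<forall>y\<in>Q j. G y z}) =
        (\<Sum>j<t. card (Q j) * card {z \<in> Z. \<forall>y\<in>Q j. G y z}) + card (Q t) * card {z \<in> Z. \<forall>y\<in>Q t. G y z}"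
      by (simp add: lessThan_Suc_atMost[symmetric])
    also have "\<dots> \<le> (\<Sum>j<t. w * u) + w * w ^ 3"
    proof (intro add_mono sum_mono mult_le_mono)
      fix j assume j: "j \<in> {..<t}"
      show "card (Q j) \<le> w" using cQ j by simp
      show "card {z \<in> Z. \<forall>y\<in>Q j. G y z} \<le> u"
        using few_common[OF A QS, of j Z] Q(3) j Z(1) uw unfolding G_def by simp
    next
      show "card (Q t) \<le> w" using cQ by simp
      have "card {z \<in> Z. \<forall>y\<in>Q t. G y z} \<le> card Z" using finZ by (intro card_mono) auto
      thus "card {z \<in> Z. \<forall>y\<in>Q t. G y z} \<le> w ^ 3" using Z(2) by linarith
    qed
    also have "\<dots> \<le> w\<^sup>2 * (w * u) + w * w ^ 3" using Q(1) by simp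
    also have "\<dots> \<le> w\<^sup>2 * (w * u) * w + u * (w * w ^ 3)" using w1 u1 by (intro add_mono) auto
    also have "\<dots> = 2 * u * w ^ 4" by (simp add: power2_eq_square power3_eq_cube power4_eq_xxxx)
    finally have "real (\<Sum>j\<le>t. card (Q j) * card {z \<in> Z. \<forall>y\<in>Q j. G y z}) \<le> real (2 * u * w ^ 4)"
      by (simp only: of_nat_le_iff)
    thus "(\<Sum>j\<le>t. real (card (Q j) * card {z \<in> Z. \<forall>y\<in>Q j. G y z})) \<le> 2 * u * w ^ 4" by simp
  qed
  also have "\<dots> = (c * (u * \<kappa> + 2) + 2 * u) * w ^ 4" by (simp add: algebra_simps)
  also have "\<dots> \<le> (11 * u ^ 3 * \<kappa>\<^sup>2) * w ^ 4"
  proof (rule mult_right_mono)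
    define x where "x = u * \<kappa>"
    have U: "1 \<le> real u" using u1 by simp
    have x1: "1 \<le> x" unfolding x_def using U \<kappa>1 mult_mono[of 1 "real u" 1 \<kappa>] by simp
    have "c * (u * \<kappa> + 2) + 2 * real u = 3 * real u * x * (x + 2) + 2 * real u" by (simp add: c_def x_def power2_eq_square)
    also have "\<dots> \<le> 3 * real u * x * (3 * x) + 2 * real u * (x * x)"
    proof (intro add_mono mult_left_mono)
      have "real u * 1 * 1 \<le> real u * x * x" using x1 U by (intro mult_mono) auto
      thus "2 * real u \<le> 2 * real u * (x * x)" by simp
    qed (use x1 U in auto)
    also have "\<dots> = 11 * u ^ 3 * \<kappa>\<^sup>2" by (simp add: x_def power2_eq_square power3_eq_cube)
    finally show "c * (u * \<kappa> + 2) + 2 * u \<le> 11 * u ^ 3 * \<kappa>\<^sup>2" by simp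
  qed simp
  finally show ?thesis unfolding G_def by simp
qed

text \<open>
  The set $X$ is partitioned into $w^4$ classes of size $u$. A pair is mixed on about $w^2$ classes, and the pairs that are
  related to all elements of a class form a bipartite graph to which \<open>bipartite_bound\<close> applies.
\<close>

lemma chunk_bound:
  assumes X: "X \<subseteq> S" "card X \<le> w ^ 4" and Y: "Y \<subseteq> S" "card Y \<le> w ^ 3" and Z: "Z \<subseteq> S" "card Z \<le> w ^ 3"
  shows "real (card {(x, p). x \<in> X \<and> p \<in> Y \<times> Z \<and> E x (fst p) (snd p)}) \<le> 13 * u ^ 4 * \<kappa>\<^sup>2 * w ^ 8"
proof -
  have "1 * card X \<le> u * w ^ 4" using X(2) u1 by (intro mult_le_mono)
  hence cX: "card X \<le> u * (w\<^sup>2)\<^sup>2" by (simp flip: power_mult)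
  have w2: "1 \<le> w\<^sup>2" using w1 by simp
  obtain t Q where Q: "t \<le> (w\<^sup>2)\<^sup>2" "(\<Union>j\<le>t. Q j) = X" "\<forall>j<t. card (Q j) = u" "card (Q t) < u"
    "\<forall>b\<in>S. \<forall>c\<in>S. real (card {j \<in> {..t}. mixed (\<lambda>x. E x b c) (Q j)}) \<le> \<kappa> * real (w\<^sup>2)"
    using partition[OF X(1) u1 w2 cX] by (elim exE conjE) (rule that, assumption+)
  have QS: "Q j \<subseteq> S" if "j \<le> t" for j using Q(2) X(1) that by blast
  have finQ: "finite (Q j)" if "j \<le> t" for j using QS[OF that] by (rule fin_sub)
  have cQ: "card (Q j) \<le> u" if "j \<le> t" for j using Q(3,4) that by (cases "j = t") auto
  have finYZ: "finite (Y \<times> Z)" using Y(1) Z(1) fin_sub by blast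
  have "card (Y \<times> Z) \<le> w ^ 3 * w ^ 3" unfolding card_cartesian_product using Y(2) Z(2) by (rule mult_le_mono)
  hence cYZ: "card (Y \<times> Z) \<le> w ^ 6" by (simp flip: power_add)
  define G where "G x p \<longleftrightarrow> E x (fst p) (snd p)" for x p
  have "real (card {(x, p). x \<in> X \<and> p \<in> Y \<times> Z \<and> G x p}) \<le>
    (\<Sum>j\<le>t. real (card {(x, p). x \<in> Q j \<and> p \<in> {p \<in> Y \<times> Z. mixed (\<lambda>x. G x p) (Q j)} \<and> G x p})) +
    (\<Sum>j\<le>t. real (card (Q j) * card {p \<in> Y \<times> Z. \<forall>x\<in>Q j. G x p}))"
    using finYZ finQ Q(2) by (intro card_pairs_by_parts) auto
  also have "\<dots> \<le> u * (w ^ 6 * (\<kappa> * w\<^sup>2)) + (w ^ 4 * (u * (11 * u ^ 3 * \<kappa>\<^sup>2 * w ^ 4)) + u * w ^ 6)"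
  proof (rule add_mono)
    have "(\<Sum>j\<le>t. real (card {(x, p). x \<in> Q j \<and> p \<in> {p \<in> Y \<times> Z. mixed (\<lambda>x. G x p) (Q j)} \<and> G x p}))
        \<le> (\<Sum>j\<le>t. u * real (card {p \<in> Y \<times> Z. mixed (\<lambda>x. G x p) (Q j)}))"
    proof (rule sum_mono)
      fix j assume j: "j \<in> {..t}"
      show "real (card {(x, p). x \<in> Q j \<and> p \<in> {p \<in> Y \<times> Z. mixed (\<lambda>x. G x p) (Q j)} \<and> G x p})
          \<le> u * real (card {p \<in> Y \<times> Z. mixed (\<lambda>x. G x p) (Q j)})"
        using finQ finYZ cQ j by (intro card_pairs_le_times) auto
    qed
    also have "\<dots> = u * (\<Sum>p\<in>Y \<times> Z. real (card {j \<in> {..t}. mixed (\<lambda>x. G x p) (Q j)}))"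
      by (simp only: sum_card_swap[OF finite_atMost finYZ] flip: sum_distrib_left)
    also have "\<dots> \<le> u * (\<Sum>p\<in>Y \<times> Z. \<kappa> * real (w\<^sup>2))"
    proof (intro mult_left_mono sum_mono)
      fix p assume "p \<in> Y \<times> Z"
      hence "fst p \<in> S" "snd p \<in> S" using Y(1) Z(1) by auto
      thus "real (card {j \<in> {..t}. mixed (\<lambda>x. G x p) (Q j)}) \<le> \<kappa> * real (w\<^sup>2)"
        using Q(5) unfolding G_def by blast
    qed simp
    also have "\<dots> = u * (real (card (Y \<times> Z)) * (\<kappa> * w\<^sup>2))" by simp
    also have "\<dots> \<le> u * (w ^ 6 * (\<kappa> * w\<^sup>2))" using cYZ \<kappa>1
      by (intro mult_left_mono mult_right_mono) (auto simp flip: of_nat_power)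
    finally show "(\<Sum>j\<le>t. real (card {(x, p). x \<in> Q j \<and> p \<in> {p \<in> Y \<times> Z. mixed (\<lambda>x. G x p) (Q j)} \<and> G x p}))
      \<le> u * (w ^ 6 * (\<kappa> * w\<^sup>2))" .
    have "(\<Sum>j\<le>t. real (card (Q j) * card {p \<in> Y \<times> Z. \<forall>x\<in>Q j. G x p})) =
        (\<Sum>j<t. real (card (Q j) * card {p \<in> Y \<times> Z. \<forall>x\<in>Q j. G x p})) + real (card (Q t) * card {p \<in> Y \<times> Z. \<forall>x\<in>Q t. G x p})"
      by (simp add: lessThan_Suc_atMost[symmetric])
    also have "\<dots> \<le> (\<Sum>j<t. u * (11 * u ^ 3 * \<kappa>\<^sup>2 * w ^ 4)) + real (u * w ^ 6)"
    proof (intro add_mono sum_mono)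
      fix j assume j: "j \<in> {..<t}"
      have "{p \<in> Y \<times> Z. \<forall>x\<in>Q j. G x p} = {(y, z). y \<in> Y \<and> z \<in> Z \<and> (\<forall>a\<in>Q j. E a y z)}"
        unfolding G_def by auto
      hence "real (card {p \<in> Y \<times> Z. \<forall>x\<in>Q j. G x p}) \<le> 11 * u ^ 3 * \<kappa>\<^sup>2 * w ^ 4"
        using bipartite_bound[of "Q j" Y Z] QS Q(3) j Y Z by simp
      thus "real (card (Q j) * card {p \<in> Y \<times> Z. \<forall>x\<in>Q j. G x p}) \<le> u * (11 * u ^ 3 * \<kappa>\<^sup>2 * w ^ 4)"
        using Q(3) j by (simp add: mult_left_mono)
    next
      have "card {p \<in> Y \<times> Z. \<forall>x\<in>Q t. G x p} \<le> card (Y \<times> Z)" using finYZ by (intro card_mono) auto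
      hence "card (Q t) * card {p \<in> Y \<times> Z. \<forall>x\<in>Q t. G x p} \<le> u * w ^ 6"
        using cYZ cQ[of t] by (intro mult_le_mono) auto
      thus "real (card (Q t) * card {p \<in> Y \<times> Z. \<forall>x\<in>Q t. G x p}) \<le> real (u * w ^ 6)" by (simp only: of_nat_le_iff)
    qed
    also have "\<dots> = real t * (u * (11 * u ^ 3 * \<kappa>\<^sup>2 * w ^ 4)) + u * w ^ 6" by simp
    also have "\<dots> \<le> w ^ 4 * (u * (11 * u ^ 3 * \<kappa>\<^sup>2 * w ^ 4)) + u * w ^ 6"
    proof (intro add_mono mult_right_mono)
      have "t \<le> w ^ 4" using Q(1) by (simp flip: power_mult)
      thus "real t \<le> real (w ^ 4)" by (simp only: of_nat_le_iff)
    qed auto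
    finally show "(\<Sum>j\<le>t. real (card (Q j) * card {p \<in> Y \<times> Z. \<forall>x\<in>Q j. G x p}))
      \<le> w ^ 4 * (u * (11 * u ^ 3 * \<kappa>\<^sup>2 * w ^ 4)) + u * w ^ 6" .
  qed
  also have "\<dots> = (u * \<kappa> + 11 * u ^ 4 * \<kappa>\<^sup>2) * w ^ 8 + u * w ^ 6" by (simp add: power_numeral_reduce algebra_simps)
  also have "\<dots> \<le> (u * \<kappa> + 11 * u ^ 4 * \<kappa>\<^sup>2) * w ^ 8 + u * w ^ 8"
  proof -
    have "u * w ^ 6 \<le> u * w ^ 8" using w1 by (intro mult_left_mono power_increasing) auto
    hence "real (u * w ^ 6) \<le> real (u * w ^ 8)" by (simp only: of_nat_le_iff)
    thus ?thesis by simp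
  qed
  also have "\<dots> = (u * \<kappa> + 11 * u ^ 4 * \<kappa>\<^sup>2 + u) * w ^ 8" by (simp add: algebra_simps)
  also have "\<dots> \<le> (13 * u ^ 4 * \<kappa>\<^sup>2) * w ^ 8"
  proof (rule mult_right_mono)
    have U: "1 \<le> real u" using u1 by simp
    have "real u ^ 1 * \<kappa> ^ 1 \<le> real u ^ 4 * \<kappa> ^ 2"
      using U \<kappa>1 by (intro mult_mono power_increasing) auto
    moreover have "real u ^ 1 * \<kappa> ^ 0 \<le> real u ^ 4 * \<kappa> ^ 2"
      using U \<kappa>1 by (intro mult_mono power_increasing) auto
    ultimately show "u * \<kappa> + 11 * u ^ 4 * \<kappa>\<^sup>2 + u \<le> 13 * u ^ 4 * \<kappa>\<^sup>2" by (simp add: mult_ac)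
  qed simp
  finally show ?thesis unfolding G_def by simp
qed

lemma complete_box_small:
  assumes "A \<subseteq> S" "B \<subseteq> S" "C \<subseteq> S" "\<And>a b c. a \<in> A \<Longrightarrow> b \<in> B \<Longrightarrow> c \<in> C \<Longrightarrow> E a b c"
    and "card A \<le> m" "card B \<le> k" "card C \<le> l"
  shows "card A * card B * card C \<le> u * (m * k + m * l + k * l)"
proof -
  consider "card A \<le> u" | "card B \<le> u" | "card C \<le> u"
    using no_box[OF assms(1-3)] assms(4) by (metis nle_le)
  thus ?thesis
  proof cases
    case 1
    hence "card A * (card B * card C) \<le> u * (k * l)" using assms by (intro mult_le_mono)
    also have "\<dots> \<le> u * (m * k + m * l + k * l)" by (intro mult_le_mono) auto
    finally show ?thesis by (simp add: mult_ac)
  next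
    case 2
    hence "card B * (card A * card C) \<le> u * (m * l)" using assms by (intro mult_le_mono)
    also have "\<dots> \<le> u * (m * k + m * l + k * l)" by (intro mult_le_mono) auto
    finally show ?thesis by (simp add: mult_ac)
  next
    case 3
    hence "card C * (card A * card B) \<le> u * (m * k)" using assms by (intro mult_le_mono)
    also have "\<dots> \<le> u * (m * k + m * l + k * l)" by (intro mult_le_mono) auto
    finally show ?thesis by (simp add: mult_ac)
  qed
qed

text \<open>
  About $w^4$ points are mixed on an average box; cut into chunks of size $w^4$, they contribute about
  $w^8$ triples per box. The other points contribute complete boxes, which are small in some direction.
\<close>

lemma triples_bound:
  assumes Q: "t \<le> w\<^sup>2" "(\<Union>j\<le>t. Q j) = S" "\<And>j. j \<le> t \<Longrightarrow> card (Q j) \<le> w ^ 3"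
    and R: "t' \<le> w\<^sup>2" "(\<Union>k\<le>t'. R k) = S" "\<And>k. k \<le> t' \<Longrightarrow> card (R k) \<le> w ^ 3"
    and mix: "\<And>a. a \<in> S \<Longrightarrow> real (card {z \<in> {..t} \<times> {..t'}.
                mixed (\<lambda>p. E a (fst p) (snd p)) (Q (fst z) \<times> R (snd z))}) \<le> \<kappa> * w ^ 3"
  shows "real (card {(p, a). p \<in> S \<times> S \<and> a \<in> S \<and> E a (fst p) (snd p)}) \<le> 77 * u ^ 4 * \<kappa> ^ 3 * w ^ 12"
proof -
  define J where "J = {..t} \<times> {..t'}"
  define box where "box z = Q (fst z) \<times> R (snd z)" for z
  define G where "G p a \<longleftrightarrow> E a (fst p) (snd p)" for p a
  define M where "M z = {a \<in> S. mixed (\<lambda>p. G p a) (box z)}" for z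
  define c where "c = 13 * u ^ 4 * \<kappa>\<^sup>2 * w ^ 8"
  have c0: "0 \<le> c" by (simp add: c_def)
  have finJ: "finite J" by (simp add: J_def)
  have QS: "Q (fst z) \<subseteq> S" "R (snd z) \<subseteq> S" if "z \<in> J" for z using Q(2) R(2) that by (auto simp: J_def)
  have cQR: "card (Q (fst z)) \<le> w ^ 3" "card (R (snd z)) \<le> w ^ 3" if "z \<in> J" for z
    using Q(3) R(3) that by (auto simp: J_def)
  have finbox: "finite (box z)" if "z \<in> J" for z using QS[OF that] fin_sub by (simp add: box_def)
  have cJ: "card J \<le> 4 * w ^ 4"
  proof -
    have "1 \<le> w\<^sup>2" using w1 by simp
    hence "t + 1 \<le> 2 * w\<^sup>2" "t' + 1 \<le> 2 * w\<^sup>2" using Q(1) R(1) by linarith+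
    hence "(t + 1) * (t' + 1) \<le> (2 * w\<^sup>2) * (2 * w\<^sup>2)" by (rule mult_le_mono)
    thus ?thesis by (simp add: J_def card_cartesian_product power2_eq_square power4_eq_xxxx mult_ac)
  qed
  have cover: "S \<times> S \<subseteq> (\<Union>z\<in>J. box z)"
  proof
    fix p assume "p \<in> S \<times> S"
    then obtain b c where p: "p = (b, c)" "b \<in> S" "c \<in> S" by blast
    obtain j k where "j \<le> t" "b \<in> Q j" "k \<le> t'" "c \<in> R k" using p Q(2) R(2) by blast
    hence "(j, k) \<in> J" "p \<in> box (j, k)" using p by (auto simp: J_def box_def)
    thus "p \<in> (\<Union>z\<in>J. box z)" by blast
  qed
  have "real (card {(p, a). p \<in> S \<times> S \<and> a \<in> S \<and> G p a}) \<le>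
    (\<Sum>z\<in>J. real (card {(p, a). p \<in> box z \<and> a \<in> M z \<and> G p a})) +
    (\<Sum>z\<in>J. real (card (box z) * card {a \<in> S. \<forall>p\<in>box z. G p a}))"
    unfolding M_def using finJ finS finbox cover by (rule card_pairs_by_parts)
  also have "\<dots> \<le> c * (5 * \<kappa> * w ^ 4) + 12 * u * w ^ 12"
  proof (rule add_mono)
    have "(\<Sum>z\<in>J. real (card {(p, a). p \<in> box z \<and> a \<in> M z \<and> G p a}))
        \<le> (\<Sum>z\<in>J. c * (real (card (M z)) / real (w ^ 4) + 1))"
    proof (rule sum_mono)
      fix z assume z: "z \<in> J"
      have MS: "M z \<subseteq> S" by (auto simp: M_def)
      show "real (card {(p, a). p \<in> box z \<and> a \<in> M z \<and> G p a}) \<le> c * (real (card (M z)) / real (w ^ 4) + 1)"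
      proof (rule subadditive_bound[where f = "\<lambda>A. real (card {(p, a). p \<in> box z \<and> a \<in> A \<and> G p a})"])
        show finM: "finite (M z)" using MS by (rule fin_sub)
        show "1 \<le> w ^ 4" using w1 by simp
        show "0 \<le> c" using c0 .
        show "real (card {(p, a). p \<in> box z \<and> a \<in> A \<union> B \<and> G p a}) \<le>
          real (card {(p, a). p \<in> box z \<and> a \<in> A \<and> G p a}) + real (card {(p, a). p \<in> box z \<and> a \<in> B \<and> G p a})"
          if "A \<subseteq> M z" "B \<subseteq> M z" for A B
          using finbox[OF z] finM that by (rule card_pairs_subadditive)
        show "real (card {(p, a). p \<in> box z \<and> a \<in> A \<and> G p a}) \<le> c"
          if A: "A \<subseteq> M z" "card A \<le> w ^ 4" for A
        proof -
          have "{(p, a). p \<in> box z \<and> a \<in> A \<and> G p a} = 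
            prod.swap ` {(x, p). x \<in> A \<and> p \<in> Q (fst z) \<times> R (snd z) \<and> E x (fst p) (snd p)}"
            by (auto simp: box_def G_def image_iff)
          hence "card {(p, a). p \<in> box z \<and> a \<in> A \<and> G p a} =
            card {(x, p). x \<in> A \<and> p \<in> Q (fst z) \<times> R (snd z) \<and> E x (fst p) (snd p)}"
            by (simp add: card_image)
          moreover have "A \<subseteq> S" using A(1) MS by blast
          ultimately show ?thesis
            using chunk_bound[OF _ A(2) QS(1)[OF z] cQR(1)[OF z] QS(2)[OF z] cQR(2)[OF z]] by (simp add: c_def)
        qed
      qed
    qed
    also have "\<dots> = c * ((\<Sum>z\<in>J. real (card (M z))) / real (w ^ 4) + real (card J))"
      by (simp add: sum.distrib sum_divide_distrib flip: sum_distrib_left)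
    also have "\<dots> \<le> c * (\<kappa> * w ^ 4 + 4 * w ^ 4)"
    proof (intro mult_left_mono c0 add_mono)
      have "(\<Sum>z\<in>J. real (card (M z))) = (\<Sum>a\<in>S. real (card {z \<in> J. mixed (\<lambda>p. G p a) (box z)}))"
        unfolding M_def by (rule sum_card_swap[OF finJ finS])
      also have "\<dots> \<le> (\<Sum>a\<in>S. \<kappa> * w ^ 3)"
        using mix unfolding J_def box_def G_def by (intro sum_mono) blast
      also have "\<dots> = real (card S) * (\<kappa> * w ^ 3)" by simp
      also have "\<dots> \<le> real (w ^ 5) * (\<kappa> * w ^ 3)"
        using cardS \<kappa>1 by (intro mult_right_mono) (simp_all only: of_nat_le_iff, simp)
      also have "\<dots> = \<kappa> * w ^ 4 * real (w ^ 4)" by (simp add: algebra_simps flip: power_add)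
      finally have "(\<Sum>z\<in>J. real (card (M z))) \<le> \<kappa> * w ^ 4 * real (w ^ 4)" .
      moreover have "0 < real (w ^ 4)" using w1 by simp
      ultimately show "(\<Sum>z\<in>J. real (card (M z))) / real (w ^ 4) \<le> \<kappa> * w ^ 4" by (simp only: pos_divide_le_eq)
      show "real (card J) \<le> 4 * w ^ 4" using cJ by (simp only: of_nat_le_iff)
    qed
    also have "\<dots> \<le> c * (5 * \<kappa> * w ^ 4)"
    proof (intro mult_left_mono c0)
      have "4 * real (w ^ 4) * 1 \<le> 4 * real (w ^ 4) * \<kappa>" using \<kappa>1 by (intro mult_left_mono) auto
      thus "\<kappa> * real (w ^ 4) + real (4 * w ^ 4) \<le> 5 * \<kappa> * real (w ^ 4)" by (simp add: mult_ac)
    qed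
    finally show "(\<Sum>z\<in>J. real (card {(p, a). p \<in> box z \<and> a \<in> M z \<and> G p a})) \<le> c * (5 * \<kappa> * w ^ 4)" .
    have "(\<Sum>z\<in>J. card (box z) * card {a \<in> S. \<forall>p\<in>box z. G p a}) \<le> (\<Sum>z\<in>J. 3 * u * w ^ 8)"
    proof (rule sum_mono)
      fix z assume z: "z \<in> J"
      define F where "F = {a \<in> S. \<forall>p\<in>box z. G p a}"
      have "card F * card (Q (fst z)) * card (R (snd z)) \<le> u * (w ^ 5 * w ^ 3 + w ^ 5 * w ^ 3 + w ^ 3 * w ^ 3)"
      proof (rule complete_box_small)
        show "card F \<le> w ^ 5" using card_mono[OF finS, of F] cardS by (auto simp: F_def)
      qed (use QS[OF z] cQR[OF z] in \<open>auto simp: F_def box_def G_def\<close>)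
      also have "\<dots> = u * (2 * w ^ 8 + w ^ 6)" by (simp flip: power_add)
      also have "\<dots> \<le> u * (2 * w ^ 8 + w ^ 8)" using w1 by (intro mult_le_mono add_mono power_increasing) auto
      finally show "card (box z) * card F \<le> 3 * u * w ^ 8"
        by (simp add: box_def card_cartesian_product mult_ac)
    qed
    also have "\<dots> \<le> 4 * w ^ 4 * (3 * u * w ^ 8)"
      using mult_le_mono1[OF cJ, of "3 * u * w ^ 8"] by (simp only: sum_constant of_nat_id)
    also have "\<dots> = 12 * u * w ^ 12" by (simp add: algebra_simps flip: power_add)
    finally have "real (\<Sum>z\<in>J. card (box z) * card {a \<in> S. \<forall>p\<in>box z. G p a}) \<le> real (12 * u * w ^ 12)"
      by (simp only: of_nat_le_iff)
    thus "(\<Sum>z\<in>J. real (card (box z) * card {a \<in> S. \<forall>p\<in>box z. G p a})) \<le> 12 * u * w ^ 12" by simp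
  qed
  also have "\<dots> = (65 * (u ^ 4 * \<kappa> ^ 3) + 12 * u) * w ^ 12"
    by (simp add: c_def algebra_simps power2_eq_square power3_eq_cube flip: power_add)
  also have "\<dots> \<le> (77 * u ^ 4 * \<kappa> ^ 3) * w ^ 12"
  proof (rule mult_right_mono)
    have U: "1 \<le> real u" using u1 by simp
    have "real u ^ 1 * \<kappa> ^ 0 \<le> real u ^ 4 * \<kappa> ^ 3"
      using U \<kappa>1 by (intro mult_mono power_increasing) auto
    thus "65 * (u ^ 4 * \<kappa> ^ 3) + 12 * u \<le> 77 * u ^ 4 * \<kappa> ^ 3" by (simp add: mult_ac)
  qed simp
  finally show ?thesis by (simp add: G_def)
qed

end

section \<open>Triangles with area in a window\<close>

definition area2 :: "real \<times> real \<Rightarrow> real \<times> real \<Rightarrow> real \<times> real \<Rightarrow> real" where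
  "area2 a b c = (fst b - fst a) * (snd c - snd a) - (snd b - snd a) * (fst c - fst a)"

lemma area2_swap: "area2 b a c = - area2 a b c" "area2 a c b = - area2 a b c"
  by (simp_all add: area2_def algebra_simps)

lemma area2_degenerate [simp]: "area2 a a c = 0" "area2 a b a = 0" "area2 a b b = 0"
  by (simp_all add: area2_def)

lemma affine_area2:
  "affine_functional (\<lambda>x. area2 x b c - \<tau>)" "affine_functional (\<lambda>x. area2 a x c - \<tau>)"
  "affine_functional (\<lambda>x. area2 a b x - \<tau>)"
proof -
  have "area2 x b c - \<tau> = (snd b - snd c) * fst x + (fst c - fst b) * snd x + (fst b * snd c - snd b * fst c - \<tau>)" for x
    by (simp add: area2_def algebra_simps)
  thus 1: "affine_functional (\<lambda>x. area2 x b c - \<tau>)" unfolding affine_functional_def by blast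
  have "area2 a x c - \<tau> = (snd c - snd a) * fst x + (fst a - fst c) * snd x + (snd a * fst c - fst a * snd c - \<tau>)" for x
    by (simp add: area2_def algebra_simps)
  thus "affine_functional (\<lambda>x. area2 a x c - \<tau>)" unfolding affine_functional_def by blast
  have "area2 a b x - \<tau> = (snd a - snd b) * fst x + (fst b - fst a) * snd x + (fst a * snd b - snd a * fst b - \<tau>)" for x
    by (simp add: area2_def algebra_simps)
  thus "affine_functional (\<lambda>x. area2 a b x - \<tau>)" unfolding affine_functional_def by blast
qed

lemma no_sign_change_same_sign:
  assumes "affine_functional f" "\<not> sign_change f V" "Q \<subseteq> convex hull V" "v \<in> V" "q \<in> Q"
  shows "0 \<le> f q \<longleftrightarrow> 0 \<le> f v"
proof -
  have "insert v Q \<subseteq> convex hull V" using assms(3,4) by (auto intro: hull_inc)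
  hence "\<not> sign_change f (insert v Q)" using sign_change_convex_hull[OF assms(1)] assms(2) by blast
  thus ?thesis using assms(5) unfolding sign_change_def by (auto simp: not_le)
qed

text \<open>
  Only finitely many areas occur, so the window can be widened slightly without new areas entering it. No area
  then equals one of the ends, as the assumption of \<open>simplicial_partition\<close> on zeros demands.
\<close>

lemma generic_thresholds:
  fixes A :: "real set"
  assumes "finite A" "0 < x" "x < y"
  shows "\<exists>lo hi. 0 < lo \<and> lo < hi \<and> (\<forall>v\<in>A. v \<noteq> lo \<and> v \<noteq> hi \<and> (x \<le> v \<and> v \<le> y \<longleftrightarrow> lo < v \<and> v < hi))"
proof -
  have "\<exists>\<eta>>0. \<forall>v\<in>A. \<eta> \<le> (if v < x then x - v else if y < v then v - y else 1)"
    by (rule finite_positive_lower_bound[OF assms(1)]) auto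
  then obtain \<eta> where \<eta>: "\<eta> > 0" "\<And>v. v \<in> A \<Longrightarrow> \<eta> \<le> (if v < x then x - v else if y < v then v - y else 1)"
    by blast
  define \<delta> where "\<delta> = min \<eta> x / 2"
  have \<delta>: "0 < \<delta>" "\<delta> < \<eta>" "\<delta> < x" using \<eta>(1) assms(2) by (auto simp: \<delta>_def min_def)
  show ?thesis
  proof (intro exI conjI ballI)
    show "0 < x - \<delta>" "x - \<delta> < y + \<delta>" using \<delta> assms by auto
    fix v assume v: "v \<in> A"
    show "v \<noteq> x - \<delta>" "v \<noteq> y + \<delta>" "x \<le> v \<and> v \<le> y \<longleftrightarrow> x - \<delta> < v \<and> v < y + \<delta>"
      using \<eta>(2)[OF v] \<delta> assms(3) by (auto split: if_splits)
  qed
qed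

text \<open>
  The ends of the window are chosen so that they are not attained on $S$.
\<close>

locale area_window =
  fixes S :: "(real \<times> real) set" and lo hi :: real and w :: nat
  assumes finS: "finite S" and cardS: "card S \<le> w ^ 5" and w1: "1 \<le> w" and lo: "0 < lo" "lo < hi"
    and generic: "\<And>a b c. a \<in> S \<Longrightarrow> b \<in> S \<Longrightarrow> c \<in> S \<Longrightarrow> \<bar>area2 a b c\<bar> \<noteq> lo \<and> \<bar>area2 a b c\<bar> \<noteq> hi"
begin

definition in_window :: "real \<times> real \<Rightarrow> real \<times> real \<Rightarrow> real \<times> real \<Rightarrow> bool" where
  "in_window a b c \<longleftrightarrow> lo < \<bar>area2 a b c\<bar> \<and> \<bar>area2 a b c\<bar> < hi"

text \<open>
  The comparisons of the signed area with these four numbers decide membership in the window.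
\<close>

definition thresholds :: "real set" where
  "thresholds = {lo, hi, - lo, - hi}"

text \<open>
  Every family of lines and every set of points to which the partition theorem is applied below has at most
  $40 w^{10}$ members.
\<close>

definition crossing :: real where "crossing = partition_log (40 * real w ^ 10)"

lemma thresholds: "finite thresholds" "card thresholds \<le> 4"
  by (simp_all add: thresholds_def card_insert_if)

lemma off_threshold:
  assumes "a \<in> S" "b \<in> S" "c \<in> S" "\<tau> \<in> thresholds"
  shows "area2 a b c - \<tau> \<noteq> 0"
  using generic[OF assms(1-3)] assms(4) lo unfolding thresholds_def by auto

lemma in_window_by_signs:
  assumes "a \<in> S" "b \<in> S" "c \<in> S" "a' \<in> S" "b' \<in> S" "c' \<in> S"
    and "\<And>\<tau>. \<tau> \<in> thresholds \<Longrightarrow> 0 \<le> area2 a b c - \<tau> \<longleftrightarrow> 0 \<le> area2 a' b' c' - \<tau>"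
  shows "in_window a b c \<longleftrightarrow> in_window a' b' c'"
proof -
  define x y where "x = area2 a b c" and "y = area2 a' b' c'"
  have "\<bar>x\<bar> \<noteq> lo" "\<bar>x\<bar> \<noteq> hi" "\<bar>y\<bar> \<noteq> lo" "\<bar>y\<bar> \<noteq> hi" using generic assms(1-6) by (auto simp: x_def y_def)
  moreover have "lo \<le> x \<longleftrightarrow> lo \<le> y" "hi \<le> x \<longleftrightarrow> hi \<le> y" "- lo \<le> x \<longleftrightarrow> - lo \<le> y" "- hi \<le> x \<longleftrightarrow> - hi \<le> y"
    using assms(7)[of lo] assms(7)[of hi] assms(7)[of "- lo"] assms(7)[of "- hi"]
    by (auto simp: thresholds_def x_def y_def)
  ultimately show ?thesis unfolding in_window_def x_def[symmetric] y_def[symmetric] using lo by argo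
qed

lemma log_ge: "66 \<le> crossing"
proof -
  have "1 \<le> real w ^ 10" using w1 by simp
  hence "1 \<le> 40 * real w ^ 10" by linarith
  thus ?thesis by (simp add: crossing_def partition_log_def)
qed

lemma size_bounds:
  assumes "m \<le> 32 * w ^ 10"
  shows "1 \<le> 40 * real w ^ 10" "real m \<le> 40 * real w ^ 10" "real m + 2 \<le> 40 * real w ^ 10"
proof -
  have w: "1 \<le> real w ^ 10" using w1 by simp
  have "real m \<le> real (32 * w ^ 10)" using assms by (simp only: of_nat_le_iff)
  thus "1 \<le> 40 * real w ^ 10" "real m \<le> 40 * real w ^ 10" "real m + 2 \<le> 40 * real w ^ 10"
    using w by simp_all
qed

lemma card_sub_bound:
  assumes "X \<subseteq> S"
  shows "real (card X) \<le> 40 * real w ^ 10"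
proof (rule size_bounds(2))
  have "card X \<le> card S" by (rule card_mono[OF finS assms])
  also have "\<dots> \<le> w ^ 5" by (rule cardS)
  also have "\<dots> \<le> w ^ 10" using w1 by (intro power_increasing) auto
  finally show "card X \<le> 32 * w ^ 10" by simp
qed

lemma card_pairs_thresholds:
  "real (card (S \<times> S \<times> thresholds)) + 2 \<le> 40 * real w ^ 10"
proof (rule size_bounds(3))
  have "card (S \<times> S \<times> thresholds) \<le> w ^ 5 * (w ^ 5 * 4)"
    unfolding card_cartesian_product using cardS thresholds(2) by (intro mult_le_mono)
  also have "\<dots> = 4 * w ^ 10" by (simp flip: power_add)
  finally show "card (S \<times> S \<times> thresholds) \<le> 32 * w ^ 10" by simp
qed

lemma partition_S:
  assumes X: "X \<subseteq> S" and s: "1 \<le> s" "1 \<le> q" "card X \<le> s * q\<^sup>2"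
  shows "\<exists>t Q. t \<le> q\<^sup>2 \<and> (\<Union>j\<le>t. Q j) = X \<and> (\<forall>j<t. card (Q j) = s) \<and> card (Q t) < s \<and>
        (\<forall>b\<in>S. \<forall>c\<in>S. real (card {j \<in> {..t}. mixed (\<lambda>x. in_window x b c) (Q j)}) \<le> 40 * crossing * q)"
proof -
  define f where "f = (\<lambda>(b, c, \<tau>) x. area2 x b c - \<tau>)"
  have finX: "finite X" using X finS finite_subset by blast
  have finI: "finite (S \<times> S \<times> thresholds)" using finS thresholds by simp
  have aff: "affine_functional (f i)" for i by (cases i) (simp add: f_def affine_area2)
  have "\<exists>t Q. t \<le> q\<^sup>2 \<and> disjoint_family_on Q {..t} \<and> (\<Union>j\<le>t. Q j) = X \<and>
           (\<forall>j<t. card (Q j) = s) \<and> card (Q t) < s \<and>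
           (\<forall>i\<in>S \<times> S \<times> thresholds. real (card {j. j \<le> t \<and> sign_change (f i) (Q j)}) \<le> crossing * q)"
    unfolding crossing_def
    by (rule partition_few_sign_changes)
       (rule aff | fact finX finI size_bounds(1)[of 0, simplified] card_sub_bound[OF X] card_pairs_thresholds s)+
  then obtain t Q where Q: "t \<le> q\<^sup>2" "(\<Union>j\<le>t. Q j) = X" "\<forall>j<t. card (Q j) = s" "card (Q t) < s"
     "\<forall>i\<in>S \<times> S \<times> thresholds. real (card {j. j \<le> t \<and> sign_change (f i) (Q j)}) \<le> crossing * q"
    by (elim exE conjE) (rule that, assumption+)
  have "real (card {j \<in> {..t}. mixed (\<lambda>x. in_window x b c) (Q j)}) \<le> 40 * crossing * q" if bc: "b \<in> S" "c \<in> S" for b c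
  proof -
    have "{j \<in> {..t}. mixed (\<lambda>x. in_window x b c) (Q j)} \<subseteq> {j \<in> {..t}. \<exists>\<tau>\<in>thresholds. sign_change (f (b, c, \<tau>)) (Q j)}"
    proof safe
      fix j assume j: "j \<le> t" "mixed (\<lambda>x. in_window x b c) (Q j)"
      then obtain x y where xy: "x \<in> Q j" "y \<in> Q j" "in_window x b c" "\<not> in_window y b c" by (auto simp: mixed_def)
      have "x \<in> S" "y \<in> S" using xy j(1) Q(2) X by blast+
      then obtain \<tau> where \<tau>: "\<tau> \<in> thresholds" "\<not> (0 \<le> area2 x b c - \<tau> \<longleftrightarrow> 0 \<le> area2 y b c - \<tau>)"
        using in_window_by_signs[of x b c y b c] xy(3,4) bc by blast
      hence "sign_change (f (b, c, \<tau>)) (Q j)" using xy(1,2) unfolding sign_change_def f_def by force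
      thus "\<exists>\<tau>\<in>thresholds. sign_change (f (b, c, \<tau>)) (Q j)" using \<tau>(1) by blast
    qed
    hence "card {j \<in> {..t}. mixed (\<lambda>x. in_window x b c) (Q j)} \<le> card {j \<in> {..t}. \<exists>\<tau>\<in>thresholds. sign_change (f (b, c, \<tau>)) (Q j)}"
      by (intro card_mono) auto
    also have "real \<dots> \<le> real 4 * (crossing * q)"
      using Q(5) bc log_ge thresholds by (intro card_Collect_bex_le) auto
    also have "\<dots> \<le> 40 * crossing * q" using log_ge by (auto intro!: mult_right_mono)
    finally show ?thesis by simp
  qed
  thus ?thesis using Q(1-4) by (intro exI[of _ t] exI[of _ Q] conjI ballI)
qed

text \<open>
  First the classes $R_k$ are formed, with corners $V_k$. Then the classes $Q_j$ are formed with respect to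
  the lines given by a point $a$ and a corner. If none of the corners of $R_k$ makes the sign change on $Q_j$, and a single
  representative of $Q_j$ sees no sign change on $V_k$, then all signs are constant on $Q_j \times R_k$.
  So a point $a$ is mixed only on about $w^2 \cdot w$ boxes for the first reason and as many for the second.
\<close>

lemma partition_boxes:
  "\<exists>t Q t' R. t \<le> w\<^sup>2 \<and> (\<Union>j\<le>t. Q j) = S \<and> (\<forall>j\<le>t. card (Q j) \<le> w ^ 3) \<and>
      t' \<le> w\<^sup>2 \<and> (\<Union>k\<le>t'. R k) = S \<and> (\<forall>k\<le>t'. card (R k) \<le> w ^ 3) \<and>
      (\<forall>a\<in>S. real (card {z \<in> {..t} \<times> {..t'}. mixed (\<lambda>p. in_window a (fst p) (snd p)) (Q (fst z) \<times> R (snd z))})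
         \<le> 40 * crossing * w ^ 3)"
proof -
  have w3: "1 \<le> w ^ 3" using w1 by simp
  have cS: "card S \<le> w ^ 3 * w\<^sup>2" using cardS by (simp flip: power_add)
  have finI: "finite (S \<times> S \<times> thresholds)" using finS thresholds by simp
  define f where "f = (\<lambda>(a, b, \<tau>) x. area2 a b x - \<tau>)"
  have aff: "affine_functional (f i)" for i by (cases i) (simp add: f_def affine_area2)
  have off: "f i p \<noteq> 0" if "i \<in> S \<times> S \<times> thresholds" "p \<in> S" for i p
  proof -
    obtain a b \<tau> where "i = (a, b, \<tau>)" by (cases i)
    thus ?thesis using off_threshold[of a b p \<tau>] that by (simp add: f_def)
  qed
  have "\<exists>t R V. t \<le> w\<^sup>2 \<and> disjoint_family_on R {..t} \<and> (\<Union>j\<le>t. R j) = S \<and>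
           (\<forall>j<t. card (R j) = w ^ 3) \<and> card (R t) < w ^ 3 \<and>
           (\<forall>j\<le>t. finite (V j) \<and> card (V j) \<le> 4 \<and> R j \<subseteq> convex hull V j) \<and>
           (\<forall>i\<in>S \<times> S \<times> thresholds. real (card {j. j \<le> t \<and> sign_change (f i) (V j)}) \<le> crossing * w)"
    unfolding crossing_def
    by (rule simplicial_partition)
       (rule aff | fact finS finI off size_bounds(1)[of 0, simplified] card_sub_bound[OF order_refl] card_pairs_thresholds w3 w1 cS)+
  then obtain t' R V where R: "t' \<le> w\<^sup>2" "(\<Union>k\<le>t'. R k) = S" "\<forall>k<t'. card (R k) = w ^ 3" "card (R t') < w ^ 3"
     "\<forall>k\<le>t'. finite (V k) \<and> card (V k) \<le> 4 \<and> R k \<subseteq> convex hull V k"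
     "\<forall>i\<in>S \<times> S \<times> thresholds. real (card {k. k \<le> t' \<and> sign_change (f i) (V k)}) \<le> crossing * w"
    by (elim exE conjE) (rule that, assumption+)
  define W where "W = (\<Union>k\<le>t'. V k)"
  have finW: "finite W" using R(5) by (simp add: W_def)
  have "card W \<le> (\<Sum>k\<le>t'. card (V k))" unfolding W_def by (rule card_UN_le) simp
  also have "\<dots> \<le> (\<Sum>k\<le>t'. 4)" using R(5) by (intro sum_mono) simp
  also have "\<dots> = 4 * (t' + 1)" by simp
  also have "\<dots> \<le> 8 * w\<^sup>2"
  proof -
    have "1 \<le> w\<^sup>2" using w1 by simp
    hence "4 * (t' + 1) \<le> 4 * (w\<^sup>2 + w\<^sup>2)" using R(1) by (intro mult_le_mono2 add_le_mono)
    thus ?thesis by simp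
  qed
  finally have cW: "card W \<le> 8 * w\<^sup>2" .
  define g where "g = (\<lambda>(a, v, \<tau>) x. area2 a x v - \<tau>)"
  have affg: "affine_functional (g i)" for i by (cases i) (simp add: g_def affine_area2)
  have finI': "finite (S \<times> W \<times> thresholds)" using finS finW thresholds by simp
  have cI': "real (card (S \<times> W \<times> thresholds)) + 2 \<le> 40 * real w ^ 10"
  proof (rule size_bounds(3))
    have "card (S \<times> W \<times> thresholds) \<le> w ^ 5 * (8 * w\<^sup>2 * 4)"
      unfolding card_cartesian_product using cardS cW thresholds(2) by (intro mult_le_mono)
    also have "\<dots> = 32 * w ^ 7" by (simp flip: power_add)
    also have "\<dots> \<le> 32 * w ^ 10" using w1 by (intro mult_le_mono power_increasing) auto
    finally show "card (S \<times> W \<times> thresholds) \<le> 32 * w ^ 10" .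
  qed
  have "\<exists>t Q. t \<le> w\<^sup>2 \<and> disjoint_family_on Q {..t} \<and> (\<Union>j\<le>t. Q j) = S \<and>
           (\<forall>j<t. card (Q j) = w ^ 3) \<and> card (Q t) < w ^ 3 \<and>
           (\<forall>i\<in>S \<times> W \<times> thresholds. real (card {j. j \<le> t \<and> sign_change (g i) (Q j)}) \<le> crossing * w)"
    unfolding crossing_def
    by (rule partition_few_sign_changes)
       (rule affg | fact finS finI' size_bounds(1)[of 0, simplified] card_sub_bound[OF order_refl] cI' w3 w1 cS)+
  then obtain t Q where Q: "t \<le> w\<^sup>2" "(\<Union>j\<le>t. Q j) = S" "\<forall>j<t. card (Q j) = w ^ 3" "card (Q t) < w ^ 3"
     "\<forall>i\<in>S \<times> W \<times> thresholds. real (card {j. j \<le> t \<and> sign_change (g i) (Q j)}) \<le> crossing * w"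
    by (elim exE conjE) (rule that, assumption+)
  define rep where "rep j = (SOME b. b \<in> Q j)" for j
  have mix: "real (card {z \<in> {..t} \<times> {..t'}. mixed (\<lambda>p. in_window a (fst p) (snd p)) (Q (fst z) \<times> R (snd z))})
         \<le> 40 * crossing * w ^ 3" (is "real (card ?Z) \<le> _") if a: "a \<in> S" for a
  proof -
    \<comment> \<open>Z1 k: classes on which a corner of R k sees a sign change; Z2 j: corner sets on which rep j sees one\<close>
    define Z1 where "Z1 k = {j \<in> {..t}. \<exists>i\<in>V k \<times> thresholds. sign_change (g (a, fst i, snd i)) (Q j)}" for k
    define Z2 where "Z2 j = {k \<in> {..t'}. \<exists>\<tau>\<in>thresholds. Q j \<noteq> {} \<and> sign_change (f (a, rep j, \<tau>)) (V k)}" for j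
    have Z1: "real (card (Z1 k)) \<le> 16 * (crossing * w)" if k: "k \<le> t'" for k
    proof -
      have "card (V k \<times> thresholds) \<le> 4 * 4"
        unfolding card_cartesian_product using R(5) k thresholds(2) by (intro mult_le_mono) auto
      moreover have "V k \<subseteq> W" using k by (auto simp: W_def)
      ultimately have "real (card (Z1 k)) \<le> real 16 * (crossing * w)" unfolding Z1_def
        using R(5) Q(5) k a thresholds log_ge by (intro card_Collect_bex_le) auto
      thus ?thesis by simp
    qed
    have Z2: "real (card (Z2 j)) \<le> 4 * (crossing * w)" if j: "j \<le> t" for j
    proof (cases "Q j = {}")
      case True
      thus ?thesis using log_ge by (simp add: Z2_def)
    next
      case False
      hence "rep j \<in> Q j" unfolding rep_def by (simp add: some_in_eq)
      hence "rep j \<in> S" using Q(2) j by blast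
      hence "real (card (Z2 j)) \<le> real 4 * (crossing * w)" unfolding Z2_def
        using R(6) a thresholds log_ge False by (intro card_Collect_bex_le) auto
      thus ?thesis by simp
    qed
    have "?Z \<subseteq> (\<Union>k\<le>t'. (\<lambda>j. (j, k)) ` Z1 k) \<union> (\<Union>j\<le>t. (\<lambda>k. (j, k)) ` Z2 j)"
    proof
      fix z assume z: "z \<in> ?Z"
      obtain j k where jk: "z = (j, k)" "j \<le> t" "k \<le> t'" using z by auto
      obtain b c b' c' where bc: "b \<in> Q j" "c \<in> R k" "b' \<in> Q j" "c' \<in> R k" "in_window a b c" "\<not> in_window a b' c'"
        using z jk by (auto simp: mixed_def)
      have rep: "rep j \<in> Q j" using bc(1) unfolding rep_def by (rule someI)
      have QRS: "Q j \<subseteq> S" "R k \<subseteq> S" using Q(2) R(2) jk by blast+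
      have hull: "R k \<subseteq> convex hull V k" using R(5) jk by blast
      have "V k \<noteq> {}" using hull bc(2) by auto
      then obtain v where v: "v \<in> V k" by blast
      show "z \<in> (\<Union>k\<le>t'. (\<lambda>j. (j, k)) ` Z1 k) \<union> (\<Union>j\<le>t. (\<lambda>k. (j, k)) ` Z2 j)"
      proof (rule ccontr)
        assume "\<not> ?thesis"
        hence n1: "j \<notin> Z1 k" and n2: "k \<notin> Z2 j" using jk by auto
        have g0: "\<not> sign_change (g (a, x, \<tau>)) (Q j)" if "x \<in> V k" "\<tau> \<in> thresholds" for x \<tau>
          using n1 jk(2) that by (auto simp: Z1_def)
        have f0: "\<not> sign_change (f (a, rep j, \<tau>)) (V k)" if "\<tau> \<in> thresholds" for \<tau>
          using n2 jk(3) that bc(1) by (auto simp: Z2_def)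
        have same: "0 \<le> area2 a y d - \<tau> \<longleftrightarrow> 0 \<le> area2 a (rep j) v - \<tau>"
          if y: "y \<in> Q j" and d: "d \<in> R k" and \<tau>: "\<tau> \<in> thresholds" for y d \<tau>
        proof -
          have s1: "0 \<le> area2 a y x - \<tau> \<longleftrightarrow> 0 \<le> area2 a (rep j) x - \<tau>" if "x \<in> V k" for x
          proof -
            have "(\<forall>b\<in>Q j. 0 \<le> area2 a b x - \<tau>) \<or> (\<forall>b\<in>Q j. area2 a b x - \<tau> < 0)"
              using g0[OF that \<tau>] unfolding sign_change_def g_def prod.case de_Morgan_conj not_not .
            thus ?thesis using y rep by (metis not_less)
          qed
          have "\<not> sign_change (f (a, y, \<tau>)) (V k)"
            using f0[OF \<tau>] s1 unfolding sign_change_def f_def prod.case not_le[symmetric] by simp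
          hence "0 \<le> f (a, y, \<tau>) d \<longleftrightarrow> 0 \<le> f (a, y, \<tau>) v"
            by (intro no_sign_change_same_sign[OF aff _ hull v d])
          thus ?thesis using s1[OF v] by (simp add: f_def)
        qed
        have "in_window a b c \<longleftrightarrow> in_window a b' c'"
        proof (rule in_window_by_signs)
          show "b \<in> S" "b' \<in> S" "c \<in> S" "c' \<in> S" using bc QRS by blast+
          show "0 \<le> area2 a b c - \<tau> \<longleftrightarrow> 0 \<le> area2 a b' c' - \<tau>" if "\<tau> \<in> thresholds" for \<tau>
            using same[OF bc(1,2) that] same[OF bc(3,4) that] by (rule trans[OF _ sym])
        qed (fact a)+
        thus False using bc(5,6) by simp
      qed
    qed
    hence "card ?Z \<le> card ((\<Union>k\<le>t'. (\<lambda>j. (j, k)) ` Z1 k) \<union> (\<Union>j\<le>t. (\<lambda>k. (j, k)) ` Z2 j))"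
      by (intro card_mono) (auto simp: Z1_def Z2_def)
    also have "\<dots> \<le> card (\<Union>k\<le>t'. (\<lambda>j. (j, k)) ` Z1 k) + card (\<Union>j\<le>t. (\<lambda>k. (j, k)) ` Z2 j)" by (rule card_Un_le)
    also have "\<dots> \<le> (\<Sum>k\<le>t'. card (Z1 k)) + (\<Sum>j\<le>t. card (Z2 j))"
      by (intro add_mono order_trans[OF card_UN_le] sum_mono card_image_le) (auto simp: Z1_def Z2_def)
    finally have "real (card ?Z) \<le> (\<Sum>k\<le>t'. real (card (Z1 k))) + (\<Sum>j\<le>t. real (card (Z2 j)))"
      by (simp flip: of_nat_sum of_nat_add)
    also have "\<dots> \<le> (\<Sum>k\<le>t'. 16 * (crossing * w)) + (\<Sum>j\<le>t. 4 * (crossing * w))"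
      using Z1 Z2 by (intro add_mono sum_mono) auto
    also have "\<dots> = (real (t' + 1) * 16 + real (t + 1) * 4) * (crossing * w)" by (simp add: algebra_simps)
    also have "\<dots> \<le> (real (2 * w\<^sup>2) * 16 + real (2 * w\<^sup>2) * 4) * (crossing * w)"
    proof -
      have "1 \<le> w\<^sup>2" using w1 by simp
      hence "t' + 1 \<le> 2 * w\<^sup>2" "t + 1 \<le> 2 * w\<^sup>2" using R(1) Q(1) by linarith+
      hence "real (t' + 1) \<le> real (2 * w\<^sup>2)" "real (t + 1) \<le> real (2 * w\<^sup>2)" by (simp_all only: of_nat_le_iff)
      thus ?thesis using log_ge by (intro mult_right_mono add_mono) auto
    qed
    also have "\<dots> = 40 * crossing * w ^ 3" by (simp add: power2_eq_square power3_eq_cube)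
    finally show ?thesis .
  qed
  have mix': "\<forall>a\<in>S. real (card {z \<in> {..t} \<times> {..t'}. mixed (\<lambda>p. in_window a (fst p) (snd p)) (Q (fst z) \<times> R (snd z))})
         \<le> 40 * crossing * w ^ 3"
    using mix by (rule ballI)
  have "\<forall>j\<le>t. card (Q j) \<le> w ^ 3" "\<forall>k\<le>t'. card (R k) \<le> w ^ 3"
    using Q(3,4) R(3,4) by (simp_all add: le_less)
  thus ?thesis using Q(1,2) R(1,2) mix'
    by (intro exI[of _ t], intro exI[of _ Q], intro exI[of _ t'], intro exI[of _ R], intro conjI)
qed

lemma count_area_window:
  assumes u: "1 \<le> u" "u \<le> w"
    and no_box: "\<And>A B C. A \<subseteq> S \<Longrightarrow> B \<subseteq> S \<Longrightarrow> C \<subseteq> S \<Longrightarrow> u \<le> card A \<Longrightarrow> u \<le> card B \<Longrightarrow> u \<le> card C \<Longrightarrow>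
      \<exists>a\<in>A. \<exists>b\<in>B. \<exists>c\<in>C. \<not> in_window a b c"
  shows "real (card {(p, a). p \<in> S \<times> S \<and> a \<in> S \<and> in_window a (fst p) (snd p)}) \<le> 77 * u ^ 4 * (40 * crossing) ^ 3 * w ^ 12"
proof -
  interpret partitionable_triples S in_window u w "40 * crossing"
  proof
    show "1 \<le> 40 * crossing" using log_ge by simp
    show "in_window a b c = in_window b a c" for a b c
      unfolding in_window_def area2_swap(1)[of a b] by simp
    show "in_window a b c = in_window a c b" for a b c
      unfolding in_window_def area2_swap(2)[of a b] by simp
  qed (fact finS cardS u no_box partition_S)+
  obtain t Q t' R where parts: "t \<le> w\<^sup>2" "(\<Union>j\<le>t. Q j) = S" "\<forall>j\<le>t. card (Q j) \<le> w ^ 3"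
    "t' \<le> w\<^sup>2" "(\<Union>k\<le>t'. R k) = S" "\<forall>k\<le>t'. card (R k) \<le> w ^ 3"
    "\<forall>a\<in>S. real (card {z \<in> {..t} \<times> {..t'}. mixed (\<lambda>p. in_window a (fst p) (snd p)) (Q (fst z) \<times> R (snd z))})
         \<le> 40 * crossing * w ^ 3"
    using partition_boxes by (elim exE conjE) (rule that, assumption+)
  have "real (card {(p, a). p \<in> S \<times> S \<and> a \<in> S \<and> in_window a (fst p) (snd p)}) \<le> real (77 * u ^ 4) * (40 * crossing) ^ 3 * real (w ^ 12)"
    by (rule triples_bound[of t Q t' R]) (fact parts parts(3,6,7)[rule_format])+
  thus ?thesis by simp
qed

end

section \<open>The bound for sets of points in the plane\<close>

definition coords :: "real^2 \<Rightarrow> real \<times> real" where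
  "coords p = (p $ 1, p $ 2)"

definition of_coords :: "real \<times> real \<Rightarrow> real^2" where
  "of_coords p = vector [fst p, snd p]"

lemma coords_inverse [simp]: "coords (of_coords q) = q" "of_coords (coords p) = p"
  by (simp_all add: coords_def of_coords_def vec_eq_iff forall_2)

lemma inj_coords: "inj_on coords A" "inj_on of_coords B"
  by (metis coords_inverse inj_onI)+

lemma triangle_area_eq_area2:
  "triangle_area {a, b, c} = \<bar>area2 (coords a) (coords b) (coords c)\<bar> / 2"
  unfolding triangle_area_def content_triangle by (simp add: area2_def coords_def abs_minus_commute mult.commute)

lemma window_iff:
  "0.9 \<le> triangle_area {a, b, c} \<and> triangle_area {a, b, c} \<le> 1.1 \<longleftrightarrow>
     1.8 \<le> \<bar>area2 (coords a) (coords b) (coords c)\<bar> \<and> \<bar>area2 (coords a) (coords b) (coords c)\<bar> \<le> 2.2"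
  unfolding triangle_area_eq_area2 by auto

text \<open>
  Every triangle arises from an ordered triple, and a complete box of ordered triples is a copy of
  $K_{u,u,u}$: its sides are disjoint because a triple with a repeated point has area $0$.
\<close>

lemma card_area_triangles_le:
  fixes S :: "(real^2) set"
  assumes S: "finite S" "card S \<le> w ^ 5" and u: "1 \<le> u" "u \<le> w"
    and free: "\<not> contains_K3 u S (area_triangles S)"
  shows "real (card (area_triangles S)) \<le> 77 * u ^ 4 * (40 * partition_log (40 * real w ^ 10)) ^ 3 * w ^ 12"
proof -
  define P where "P = coords ` S"
  have finP: "finite P" using S by (simp add: P_def)
  have cP: "card P \<le> w ^ 5" using S(2) by (simp add: P_def card_image[OF inj_coords(1)])
  define vals where "vals = (\<lambda>(a, b, c). \<bar>area2 a b c\<bar>) ` (P \<times> P \<times> P)"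
  have "finite vals" using finP by (simp add: vals_def)
  then obtain lo hi where lh: "0 < lo" "lo < hi"
    "\<forall>v\<in>vals. v \<noteq> lo \<and> v \<noteq> hi \<and> (1.8 \<le> v \<and> v \<le> 2.2 \<longleftrightarrow> lo < v \<and> v < hi)"
    using generic_thresholds[of vals "1.8" "2.2"] by auto
  have val: "\<bar>area2 a b c\<bar> \<in> vals" if "a \<in> P" "b \<in> P" "c \<in> P" for a b c
    using that by (force simp: vals_def)
  interpret area_window P lo hi w
  proof
    show "\<bar>area2 a b c\<bar> \<noteq> lo \<and> \<bar>area2 a b c\<bar> \<noteq> hi" if "a \<in> P" "b \<in> P" "c \<in> P" for a b c
      using lh(3) val[OF that] by blast
    show "1 \<le> w" using u by linarith
  qed (fact finP cP lh)+
  have in_window_iff: "in_window (coords a) (coords b) (coords c) \<longleftrightarrow> 0.9 \<le> triangle_area {a, b, c} \<and> triangle_area {a, b, c} \<le> 1.1"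
    if "a \<in> S" "b \<in> S" "c \<in> S" for a b c
  proof -
    have "\<bar>area2 (coords a) (coords b) (coords c)\<bar> \<in> vals" using that by (intro val) (auto simp: P_def)
    thus ?thesis unfolding window_iff in_window_def using lh(3) by blast
  qed
  have in_window_distinct: "a \<noteq> b \<and> a \<noteq> c \<and> b \<noteq> c" if "in_window a b c" for a b c
    using that lh(1) by (auto simp: in_window_def)
  have box: "\<exists>a\<in>A. \<exists>b\<in>B. \<exists>c\<in>C. \<not> in_window a b c"
    if sub: "A \<subseteq> P" "B \<subseteq> P" "C \<subseteq> P" and big: "u \<le> card A" "u \<le> card B" "u \<le> card C" for A B C
  proof (rule ccontr)
    assume "\<not> ?thesis"
    hence all: "in_window a b c" if "a \<in> A" "b \<in> B" "c \<in> C" for a b c using that by blast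
    have ne: "A \<noteq> {}" "B \<noteq> {}" "C \<noteq> {}" using big u(1) by auto
    have disj: "A \<inter> B = {}" "A \<inter> C = {}" "B \<inter> C = {}"
      using ne all in_window_distinct by blast+
    have img: "of_coords ` X \<subseteq> S" if "X \<subseteq> P" for X using that by (auto simp: P_def)
    have "contains_K3 u S (area_triangles S)"
      unfolding contains_K3_def
    proof (rule exI[of _ "of_coords ` A"], rule exI[of _ "of_coords ` B"], rule exI[of _ "of_coords ` C"], intro conjI ballI)
      show "of_coords ` A \<subseteq> S" "of_coords ` B \<subseteq> S" "of_coords ` C \<subseteq> S" by (fact img[OF sub(1)] img[OF sub(2)] img[OF sub(3)])+
      show "of_coords ` A \<inter> of_coords ` B = {}" "of_coords ` A \<inter> of_coords ` C = {}" "of_coords ` B \<inter> of_coords ` C = {}"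
        using disj by (simp_all flip: image_Int[OF inj_coords(2)])
      show "u \<le> card (of_coords ` A)" "u \<le> card (of_coords ` B)" "u \<le> card (of_coords ` C)"
        using big by (simp_all add: card_image[OF inj_coords(2)])
      fix x y z assume "x \<in> of_coords ` A" "y \<in> of_coords ` B" "z \<in> of_coords ` C"
      then obtain a b c where abc: "a \<in> A" "b \<in> B" "c \<in> C" "x = of_coords a" "y = of_coords b" "z = of_coords c" by blast
      have xyz: "x \<in> S" "y \<in> S" "z \<in> S" using abc img sub by blast+
      have in_window: "in_window (coords x) (coords y) (coords z)" using all abc by simp
      hence "x \<noteq> y" "x \<noteq> z" "y \<noteq> z" using in_window_distinct by blast+
      hence "card {x, y, z} = 3" by simp
      thus "{x, y, z} \<in> area_triangles S" using xyz in_window in_window_iff[OF xyz] by (simp add: area_triangles_def)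
    qed
    thus False using free by contradiction
  qed
  define N where "N = {(p, a). p \<in> P \<times> P \<and> a \<in> P \<and> in_window a (fst p) (snd p)}"
  have finN: "finite N" by (rule finite_subset[of _ "(P \<times> P) \<times> P"]) (use finP in \<open>auto simp: N_def\<close>)
  have "area_triangles S \<subseteq> (\<lambda>(p, a). {of_coords a, of_coords (fst p), of_coords (snd p)}) ` N"
  proof
    fix T assume T: "T \<in> area_triangles S"
    then obtain a b c where abc: "T = {a, b, c}" by (auto simp: area_triangles_def card_3_iff)
    have mem: "a \<in> S" "b \<in> S" "c \<in> S" using T abc by (auto simp: area_triangles_def)
    have "in_window (coords a) (coords b) (coords c)" using in_window_iff[OF mem] T abc by (simp add: area_triangles_def)
    hence "((coords b, coords c), coords a) \<in> N" using mem by (simp add: N_def P_def)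
    thus "T \<in> (\<lambda>(p, a). {of_coords a, of_coords (fst p), of_coords (snd p)}) ` N"
      unfolding abc by (rule rev_image_eqI) simp
  qed
  hence "card (area_triangles S) \<le> card N" using finN surj_card_le by blast
  hence "real (card (area_triangles S)) \<le> real (card N)" by simp
  also have "\<dots> \<le> 77 * real u ^ 4 * (40 * crossing) ^ 3 * real (w ^ 12)"
    unfolding N_def by (rule count_area_window[OF u]) (fact box)
  finally show ?thesis by (simp add: crossing_def)
qed

text \<open>
  The integer $w$ is the larger one of $u$ and the fifth root of $n$ rounded up; the factor $u + 2$ pays for both.
\<close>

lemma fifth_root_scale:
  assumes "1 \<le> n" "1 \<le> u"
  shows "\<exists>w::nat. n \<le> w ^ 5 \<and> u \<le> w \<and> real w \<le> (real u + 2) * real n powr (1/5)"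
proof -
  define r where "r = real n powr (1/5)"
  have r1: "1 \<le> r" using assms(1) by (simp add: r_def ge_one_powr_ge_zero)
  have r5: "r ^ 5 = real n" using assms(1) by (simp add: r_def powr_power)
  define w where "w = max u (nat \<lceil>r\<rceil>)"
  have "r \<le> real w" by (simp add: w_def le_max_iff_disj) linarith
  hence "real n \<le> real w ^ 5" unfolding r5[symmetric] using r1 by (intro power_mono) auto
  hence "n \<le> w ^ 5" by (simp flip: of_nat_power)
  moreover have "real w \<le> real u + (r + 1)" using r1 by (simp add: w_def) linarith
  hence "real w \<le> (real u + 2) * r"
  proof -
    have "real u * 1 \<le> real u * r" using r1 by (intro mult_left_mono) auto
    thus ?thesis using \<open>real w \<le> real u + (r + 1)\<close> r1 by (simp add: algebra_simps)
  qed
  ultimately show ?thesis by (intro exI[of _ w]) (auto simp: r_def w_def)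
qed

lemma partition_log_bound:
  assumes "0 < \<delta>" "1 \<le> w"
  shows "partition_log (40 * w ^ 10) \<le> 66 * (1 + ln 40 + 10 / \<delta>) * w powr \<delta>"
proof -
  define p where "p = w powr \<delta>"
  have p: "1 \<le> p" using assms by (simp add: p_def ge_one_powr_ge_zero)
  have 1: "ln (40 * w ^ 10) = ln 40 + 10 * ln w" using assms(2) by (simp add: ln_mult ln_realpow)
  have "ln w \<le> p / \<delta>" unfolding p_def using assms by (intro ln_powr_bound) auto
  hence 2: "10 * ln w \<le> 10 / \<delta> * p" by simp
  have "(1 + ln 40) * 1 \<le> (1 + ln 40) * p" using p by (intro mult_left_mono) auto
  hence "1 + ln (40 * w ^ 10) \<le> (1 + ln 40) * p + 10 / \<delta> * p" using 1 2 by simp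
  also have "\<dots> = (1 + ln 40 + 10 / \<delta>) * p" by (simp add: algebra_simps)
  finally have "66 * (1 + ln (40 * w ^ 10)) \<le> 66 * ((1 + ln 40 + 10 / \<delta>) * p)" by (rule mult_left_mono) simp
  thus ?thesis by (simp only: partition_log_def p_def mult.assoc)
qed

theorem corollary5p1:
  fixes u :: nat and \<epsilon> :: real
  assumes "u \<ge> 1" and "\<epsilon> > 0"
  shows "\<exists>C::real. \<forall>(n::nat) (S :: (real^2) set).
           finite S \<and> card S = n \<and> \<not> contains_K3 u S (area_triangles S) \<longrightarrow>
           real (card (area_triangles S)) \<le> C * real n powr (12/5 + \<epsilon>)"
proof -
  define \<delta> where "\<delta> = 5 * \<epsilon> / 3"
  have \<delta>: "\<delta> > 0" using assms(2) by (simp add: \<delta>_def)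
  define K where "K = 40 * (66 * (1 + ln 40 + 10 / \<delta>))"
  have K: "0 \<le> K" using \<delta> by (simp add: K_def)
  define C where "C = 77 * real u ^ 4 * K ^ 3 * (real u + 2) powr (3 * \<delta> + 12)"
  have "real (card (area_triangles S)) \<le> C * real n powr (12/5 + \<epsilon>)"
    if S: "finite S" "card S = n" "\<not> contains_K3 u S (area_triangles S)" for n and S :: "(real^2) set"
  proof (cases "n = 0")
    case True
    hence "area_triangles S = {}" using S(1,2) by (auto simp: area_triangles_def)
    thus ?thesis using True by simp
  next
    case False
    hence "1 \<le> n" by simp
    then obtain w where w: "n \<le> w ^ 5" "u \<le> w" "real w \<le> (real u + 2) * real n powr (1/5)"
      using fifth_root_scale[OF _ assms(1)] by blast
    have w1: "1 \<le> real w" using w(2) assms(1) by simp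
    define \<Lambda> where "\<Lambda> = 40 * partition_log (40 * real w ^ 10)"
    have "1 \<le> real w ^ 10" using w1 by simp
    hence "1 \<le> 40 * real w ^ 10" by linarith
    hence L0: "0 \<le> \<Lambda>" by (simp add: \<Lambda>_def partition_log_def)
    have "\<Lambda> \<le> 40 * (66 * (1 + ln 40 + 10 / \<delta>) * real w powr \<delta>)"
      unfolding \<Lambda>_def by (intro mult_left_mono partition_log_bound[OF \<delta> w1]) simp
    also have "\<dots> = K * real w powr \<delta>" by (simp only: K_def mult.assoc)
    finally have L3: "\<Lambda> ^ 3 \<le> (K * real w powr \<delta>) ^ 3" using L0 by (intro power_mono)
    have "real (card (area_triangles S)) \<le> 77 * u ^ 4 * \<Lambda> ^ 3 * w ^ 12"
      unfolding \<Lambda>_def using card_area_triangles_le[OF S(1) _ assms(1) w(2) S(3)] w(1) S(2) by simp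
    also have "\<dots> \<le> 77 * real u ^ 4 * (K * real w powr \<delta>) ^ 3 * real w ^ 12"
      using L3 by (simp add: mult_left_mono mult_right_mono)
    also have "\<dots> = 77 * real u ^ 4 * K ^ 3 * real w powr (3 * \<delta> + 12)"
    proof -
      have "(real w powr \<delta>) ^ 3 = real w powr (3 * \<delta>)" using w1 by (simp add: powr_power mult.commute)
      moreover have "real w ^ 12 = real w powr 12" using w1 by (simp add: powr_numeral)
      ultimately show ?thesis by (simp add: power_mult_distrib powr_add)
    qed
    also have "\<dots> \<le> 77 * real u ^ 4 * K ^ 3 * ((real u + 2) * real n powr (1/5)) powr (3 * \<delta> + 12)"
      using w(3) \<delta> K by (intro mult_left_mono powr_mono2) auto
    also have "\<dots> = C * real n powr ((1/5) * (3 * \<delta> + 12))"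
      by (simp add: C_def powr_mult powr_powr add.commute)
    also have "(1/5) * (3 * \<delta> + 12) = 12/5 + \<epsilon>" by (simp add: \<delta>_def)
    finally show ?thesis .
  qed
  thus ?thesis by blast
qed

end
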